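(* Let $d$ be a positive integer, let $S=\mathbb{C}[x,y,z]$, let $f=T_d(x,y,z)\in S_d$ be the homogenization (with respect to $z$, to degree $d$) of the polynomial $T_d(x)+T_d(y)$, where $T_d$ is the Chebyshev polynomial of degree $d$, and let $M=M(f)=S/(f_x,f_y,f_z)$ be its graded Milnor algebra. (i) If $d=2m$ is even, then there is a (graded) free resolution of $M$ of the form $$0 \to S^m(-4m+1) \to S^{m-1}(-4m+3)\oplus S^3(-4m+2)\to S^3(-2m+1) \to S \to M \to 0.$$ In particular, $$P(M)(t)=1-3t^{2m-1}+(m-1)t^{4m-3}+3t^{4m-2}-mt^{4m-1}.$$ (ii) If $d=2m+1$ is odd, then there is a (graded) free resolution of $M$ of the form $$0 \to S^m(-4m-1) \to S^{m}(-4m+1)\oplus S^2(-4m)\to S^3(-2m) \to S \to M \to 0.$$ In particular, $$P(M)(t)=1-3t^{2m}+mt^{4m-1}+2t^{4m}-mt^{4m+1}.$$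
   Context: The Chebyshev polynomial $T_d(x)$ is the polynomial of degree $d$ determined by $T_d(x)=\cos(d\arccos x)$. $S=\mathbb{C}[x,y,z]$ has the standard grading and $S_r$ is the space of homogeneous polynomials of degree $r$. For $f\in S_r$, the Jacobian ideal $J_f$ is generated by the partial derivatives $f_x,f_y,f_z$, and the graded Milnor algebra is $M(f)=S/J_f$. $S^k$ denotes the direct sum of $k$ copies of $S$, with grading $(S^k)_r=S_r\oplus\dots\oplus S_r$, and the shift is defined by $(S^k(e))_r=(S^k)_{e+r}$. Morphisms of graded modules preserve the grading: $u(N_r)\subset N'_r$. For a finitely generated graded $S$-module $N$, the Hilbert–Poincaré series is $HP(N)(t)=\sum_{k\ge 0}\dim N_k\,t^k$, and for $M$ the polynomial $P(M)(t)$ is defined by $HP(M)(t)=P(M)(t)/(1-t)^3$. *)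

theory Defs
  imports
    "HOL-Algebra.QuotRing"
    "HOL-Algebra.Module"
    "HOL-Algebra.Algebraic_Closure_Type"
    "HOL-Library.Poly_Mapping"
    "HOL-Library.Numeral_Type"
    "HOL-Computational_Algebra.Computational_Algebra"
begin

text \<open>
  Elements of \<open>S = \<complex>[x,y,z]\<close> map exponent vectors (indexed by the three-element type
  \<^typ>\<open>3\<close>) to their coefficients; the indices 1, 2, 3 stand for \<open>x\<close>, \<open>y\<close>, \<open>z\<close>
  (in the type \<^typ>\<open>3\<close>, the numeral 3 denotes the same element as 0).
\<close>

type_synonym mpoly3 = "(3 \<Rightarrow>\<^sub>0 nat) \<Rightarrow>\<^sub>0 complex"

definition S_ring :: "mpoly3 ring" where
  "S_ring = ring_of_type_algebra"

definition mconst :: "complex \<Rightarrow> mpoly3" where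
  "mconst c = Poly_Mapping.single 0 c"

definition mvar :: "3 \<Rightarrow> mpoly3" where
  "mvar i = Poly_Mapping.single (Poly_Mapping.single i 1) 1"

definition tdeg :: "(3 \<Rightarrow>\<^sub>0 nat) \<Rightarrow> nat" where
  "tdeg u = (\<Sum>i\<in>UNIV. Poly_Mapping.lookup u i)"

text \<open>Degrees range over the integers, so that twists need no case distinction:
  \<open>S\<^sub>r = 0\<close> for \<open>r < 0\<close>.\<close>

definition homog :: "int \<Rightarrow> mpoly3 set" where
  "homog r = {p. \<forall>u\<in>Poly_Mapping.keys p. int (tdeg u) = r}"

definition partial_deriv :: "3 \<Rightarrow> mpoly3 \<Rightarrow> mpoly3" where
  "partial_deriv i p =
     (\<Sum>u\<in>Poly_Mapping.keys p.
        Poly_Mapping.single (u - Poly_Mapping.single i 1)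
          (of_nat (Poly_Mapping.lookup u i) * Poly_Mapping.lookup p u))"

text \<open>Homogenization to degree \<open>d\<close> with respect to the third variable, for polynomials
  of degree at most \<open>d\<close> not involving that variable.\<close>

definition homogenize :: "nat \<Rightarrow> mpoly3 \<Rightarrow> mpoly3" where
  "homogenize d g =
     (\<Sum>u\<in>Poly_Mapping.keys g.
        Poly_Mapping.single (u + Poly_Mapping.single 3 (d - tdeg u)) (Poly_Mapping.lookup g u))"

definition chebyshev :: "nat \<Rightarrow> real poly" where
  "chebyshev d =
     (THE p. degree p = d \<and> (\<forall>x\<in>{-1..1}. poly p x = cos (real d * arccos x)))"

definition chebyshev_at :: "nat \<Rightarrow> mpoly3 \<Rightarrow> mpoly3" where
  "chebyshev_at d q = poly (map_poly (\<lambda>c. mconst (of_real c)) (chebyshev d)) q"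

definition chebyshev_form :: "nat \<Rightarrow> mpoly3" where
  "chebyshev_form d = homogenize d (chebyshev_at d (mvar 1) + chebyshev_at d (mvar 2))"

record ('a, 'b) graded_module = "('a, 'b) module" +
  grade :: "int \<Rightarrow> 'b set"

text \<open>\<open>free_graded [e\<^sub>1, \<dots>, e\<^sub>k]\<close> is \<open>S(e\<^sub>1) \<oplus> \<dots> \<oplus> S(e\<^sub>k)\<close>, with \<open>S(e)\<^sub>r = S\<^sub>e\<^sub>+\<^sub>r\<close>, a vector
  being a function that vanishes from index \<open>k\<close> on. The record type makes a module a
  \<open>ring\<close> record; the fields \<open>mult\<close> and \<open>one\<close> play no role here.\<close>

definition free_graded :: "int list \<Rightarrow> (mpoly3, nat \<Rightarrow> mpoly3) graded_module" where
  "free_graded es =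
     \<lparr>carrier = {v. \<forall>i\<ge>length es. v i = 0},
      monoid.mult = (\<lambda>v w i. v i * w i),
      one = (\<lambda>i. if i < length es then 1 else 0),
      zero = (\<lambda>i. 0),
      add = (\<lambda>v w i. v i + w i),
      module.smult = (\<lambda>a v i. a * v i),
      grade = (\<lambda>r. {v. (\<forall>i\<ge>length es. v i = 0) \<and> (\<forall>i<length es. v i \<in> homog (es ! i + r))})\<rparr>"

definition jacobian_ideal :: "mpoly3 \<Rightarrow> mpoly3 set" where
  "jacobian_ideal f = Idl\<^bsub>S_ring\<^esub> {partial_deriv 1 f, partial_deriv 2 f, partial_deriv 3 f}"

definition milnor_algebra :: "mpoly3 \<Rightarrow> (mpoly3, mpoly3 set) graded_module" where
  "milnor_algebra f =
     (let J = jacobian_ideal f; Q = S_ring Quot J in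
      \<lparr>carrier = carrier Q, monoid.mult = monoid.mult Q, one = one Q, zero = zero Q, add = add Q,
       module.smult = (\<lambda>a C. (J +>\<^bsub>S_ring\<^esub> a) \<otimes>\<^bsub>Q\<^esub> C),
       grade = (\<lambda>r. (\<lambda>p. J +>\<^bsub>S_ring\<^esub> p) ` homog r)\<rparr>)"

definition graded_hom ::
    "(mpoly3, 'b) graded_module \<Rightarrow> (mpoly3, 'c) graded_module \<Rightarrow> ('b \<Rightarrow> 'c) set" where
  "graded_hom N N' =
     {u \<in> carrier N \<rightarrow> carrier N'.
        (\<forall>v\<in>carrier N. \<forall>w\<in>carrier N. u (v \<oplus>\<^bsub>N\<^esub> w) = u v \<oplus>\<^bsub>N'\<^esub> u w) \<and>
        (\<forall>a. \<forall>v\<in>carrier N. u (a \<odot>\<^bsub>N\<^esub> v) = a \<odot>\<^bsub>N'\<^esub> u v) \<and>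
        (\<forall>r. u ` grade N r \<subseteq> grade N' r)}"

text \<open>Existence of an exact sequence \<open>0 \<rightarrow> F\<^sub>3 \<rightarrow> F\<^sub>2 \<rightarrow> F\<^sub>1 \<rightarrow> F\<^sub>0 \<rightarrow> M \<rightarrow> 0\<close> of graded modules,
  where \<open>F\<^sub>i\<close> is the graded free module with the i-th list of twists.\<close>

definition has_graded_free_resolution ::
    "(mpoly3, 'b) graded_module \<Rightarrow> int list \<Rightarrow> int list \<Rightarrow> int list \<Rightarrow> int list \<Rightarrow> bool" where
  "has_graded_free_resolution M e3 e2 e1 e0 \<longleftrightarrow>
     (let F3 = free_graded e3; F2 = free_graded e2; F1 = free_graded e1; F0 = free_graded e0 in
      \<exists>\<phi>3 \<phi>2 \<phi>1 \<epsilon>.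
        \<phi>3 \<in> graded_hom F3 F2 \<and> \<phi>2 \<in> graded_hom F2 F1 \<and> \<phi>1 \<in> graded_hom F1 F0 \<and>
        \<epsilon> \<in> graded_hom F0 M \<and>
        inj_on \<phi>3 (carrier F3) \<and>
        \<phi>3 ` carrier F3 = a_kernel F2 F1 \<phi>2 \<and>
        \<phi>2 ` carrier F2 = a_kernel F1 F0 \<phi>1 \<and>
        \<phi>1 ` carrier F1 = a_kernel F0 M \<epsilon> \<and>
        \<epsilon> ` carrier F0 = carrier M)"

text \<open>Every graded component is a complex vector space, with scalars acting as constant
  polynomials; \<open>cdim\<close> is its dimension and is only meaningful for finite-dimensional
  subspaces.\<close>

definition clincomb :: "(mpoly3, 'b) graded_module \<Rightarrow> ('b \<Rightarrow> complex) \<Rightarrow> 'b set \<Rightarrow> 'b" where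
  "clincomb N c B = (\<Oplus>\<^bsub>N\<^esub>b\<in>B. mconst (c b) \<odot>\<^bsub>N\<^esub> b)"

definition cbasis :: "(mpoly3, 'b) graded_module \<Rightarrow> 'b set \<Rightarrow> 'b set \<Rightarrow> bool" where
  "cbasis N V B \<longleftrightarrow>
     finite B \<and> B \<subseteq> V \<and>
     (\<forall>v\<in>V. \<exists>c. v = clincomb N c B) \<and>
     (\<forall>c. clincomb N c B = \<zero>\<^bsub>N\<^esub> \<longrightarrow> (\<forall>b\<in>B. c b = 0))"

definition cdim :: "(mpoly3, 'b) graded_module \<Rightarrow> 'b set \<Rightarrow> nat" where
  "cdim N V = (THE n. \<exists>B. cbasis N V B \<and> card B = n)"

definition HP :: "(mpoly3, 'b) graded_module \<Rightarrow> rat fps" where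
  "HP N = Abs_fps (\<lambda>k. of_nat (cdim N (grade N (int k))))"

definition HP_numerator :: "(mpoly3, 'b) graded_module \<Rightarrow> rat poly" where
  "HP_numerator N = (THE p. HP N = fps_of_poly p / (1 - fps_X) ^ 3)"

end

theory Submission
  imports Defs "Jordan_Normal_Form.Determinant" "HOL-Library.Function_Algebras"
begin

text \<open>
  Put \<open>X = 2x\<close>, \<open>Y = 2y\<close> and let \<open>s\<^sub>k\<close>, \<open>u\<^sub>k\<close> be the homogenized Chebyshev polynomials of the second
  kind \<open>U\<^sub>k\<^sub>-\<^sub>1\<close> in \<open>x\<close> and in \<open>y\<close>. Up to the factor \<open>d\<close> the partial derivatives of the form are
  \<open>s\<^sub>d\<close>, \<open>u\<^sub>d\<close> and \<open>-zW\<close> with \<open>W = s\<^sub>d\<^sub>-\<^sub>1 + u\<^sub>d\<^sub>-\<^sub>1\<close>. Since \<open>s\<^sub>d, u\<^sub>d, z\<close> is a regular sequence, the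
  syzygies are, up to the Koszul syzygy of \<open>s\<^sub>d, u\<^sub>d\<close>, the colon ideal \<open>(s\<^sub>d, u\<^sub>d) : W\<close>.

  Over \<open>B = \<complex>[y, z]\<close> the ring \<open>B[x]/(s\<^sub>d)\<close> is free on \<open>s\<^sub>1, \<dots>, s\<^sub>d\<^sub>-\<^sub>1\<close>, and multiplication by \<open>s\<^sub>d\<^sub>-\<^sub>1\<close> sends
  \<open>s\<^sub>a\<close> to \<open>z\<^sup>2\<^sup>a\<^sup>-\<^sup>2 s\<^sub>d\<^sub>-\<^sub>a\<close>. So the colon ideal splits into conditions on the pairs of coordinates
  \<open>(a, d - a)\<close>, each a 2 by 2 linear system with determinant \<open>u\<^sub>d\<close>. Cramer's rule shows that the
  ideal is generated by \<open>s\<^sub>d\<close>, \<open>g\<^sub>a = s\<^sub>a u\<^sub>d\<^sub>-\<^sub>a - s\<^sub>d\<^sub>-\<^sub>a u\<^sub>a\<close> and \<open>h\<^sub>a = s\<^sub>a u\<^sub>d\<^sub>+\<^sub>1\<^sub>-\<^sub>a - z\<^sup>2 s\<^sub>d\<^sub>-\<^sub>a u\<^sub>a\<^sub>-\<^sub>1\<close>.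
  The identities \<open>g\<^sub>d\<^sub>-\<^sub>a = -g\<^sub>a\<close>, \<open>h\<^sub>d\<^sub>-\<^sub>a = h\<^sub>a - Y g\<^sub>a\<close> and \<open>h\<^sub>a\<^sub>+\<^sub>2 = h\<^sub>a + X g\<^sub>a\<^sub>+\<^sub>1 - Y g\<^sub>a\<close> cut this down to a
  minimal set, and the second syzygies lift
  \<open>X h\<^sub>a - Y h\<^sub>a\<^sub>+\<^sub>1 + z\<^sup>2 g\<^sub>a\<^sub>+\<^sub>1 - z\<^sup>2 g\<^sub>a\<^sub>-\<^sub>1 = 0\<close>. The Hilbert series then follows degree by degree from
  rank-nullity.
\<close>

section \<open>Division by a monic Chebyshev polynomial\<close>

text \<open>For \<open>w = z\<^sup>2\<close> and twice a variable in place of \<open>x\<close>, this is the homogenized Chebyshev polynomial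
  \<open>U\<^sub>n\<^sub>-\<^sub>1\<close> of the second kind; note the index shift.\<close>

fun cseq :: "'a::comm_ring_1 \<Rightarrow> 'a \<Rightarrow> nat \<Rightarrow> 'a" where
  "cseq w x 0 = 0"
| "cseq w x (Suc 0) = 1"
| "cseq w x (Suc (Suc n)) = x * cseq w x (Suc n) - w * cseq w x n"

text \<open>Addition formula: as functions of \<open>j\<close> both sides satisfy the same recursion
  of second order, so two initial values suffice.\<close>

lemma cseq_add:
  "cseq w x (Suc (i + j)) = cseq w x (Suc i) * cseq w x (Suc j) - w * cseq w x i * cseq w x j"
proof (induction w x j rule: cseq.induct)
  case (3 w x n)
  have "cseq w x (Suc (i + Suc (Suc n))) = x * cseq w x (Suc (i + Suc n)) - w * cseq w x (Suc (i + n))"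
    by simp
  then show ?case
    unfolding 3 by (simp add: algebra_simps)
qed auto

text \<open>The left side is a 2 by 2 determinant of terms of the sequence, and raising
  \<open>i\<close> by one multiplies it by \<open>w\<close>. This is an identity of d'Ocagne
  type.\<close>

lemma cseq_docagne:
  "cseq w x (i + l) * cseq w x (Suc i) - cseq w x (Suc (i + l)) * cseq w x i = w ^ i * cseq w x l"
proof (induction i)
  case (Suc i)
  have *: "cseq w x (Suc i + l) * cseq w x (Suc (Suc i)) - cseq w x (Suc (Suc i + l)) * cseq w x (Suc i)
     = w * (cseq w x (i + l) * cseq w x (Suc i) - cseq w x (Suc (i + l)) * cseq w x i)"
    by (simp add: algebra_simps)
  show ?case
    by (simp only: * Suc power_Suc mult.assoc)
qed auto

text \<open>This says that \<open>R\<close> is the polynomial ring \<open>B[x]\<close>, with the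
  powers of \<open>x\<close> as a basis over \<open>B\<close>. Subsets of one type are used so that
  the same facts serve for \<open>\<complex>[y,z][x]\<close> and for \<open>\<complex>[z][y]\<close>
  inside one ring.\<close>

locale adjunction =
  fixes B R :: "'a::idom set" and x :: 'a
  assumes B_zero: "0 \<in> B" and B_one: "1 \<in> B"
    and B_add: "a \<in> B \<Longrightarrow> b \<in> B \<Longrightarrow> a + b \<in> B"
    and B_mult: "a \<in> B \<Longrightarrow> b \<in> B \<Longrightarrow> a * b \<in> B"
    and B_uminus: "a \<in> B \<Longrightarrow> - a \<in> B"
    and B_subset: "B \<subseteq> R" and x_mem: "x \<in> R"
    and R_add: "a \<in> R \<Longrightarrow> b \<in> R \<Longrightarrow> a + b \<in> R"
    and R_mult: "a \<in> R \<Longrightarrow> b \<in> R \<Longrightarrow> a * b \<in> R"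
    and generated: "p \<in> R \<Longrightarrow> \<exists>f n. (\<forall>k. f k \<in> B) \<and> p = (\<Sum>k<n. f k * x ^ k)"
    and independent: "(\<And>k. f k \<in> B) \<Longrightarrow> (\<Sum>k<n. f k * x ^ k) = 0 \<Longrightarrow> k < n \<Longrightarrow> f k = 0"
begin

section \<open>Closure properties and the filtration of \<open>B[x]\<close> by degree\<close>

lemma B_diff: "a \<in> B \<Longrightarrow> b \<in> B \<Longrightarrow> a - b \<in> B"
  using B_add[of a "- b"] B_uminus[of b] by simp

lemma B_power: "a \<in> B \<Longrightarrow> a ^ k \<in> B"
  by (induction k) (auto intro: B_one B_mult)

lemma B_cseq: "w \<in> B \<Longrightarrow> v \<in> B \<Longrightarrow> cseq w v k \<in> B"
  by (induction w v k rule: cseq.induct) (auto intro!: B_zero B_one B_diff B_mult)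

lemma R_uminus: "a \<in> R \<Longrightarrow> - a \<in> R"
  using R_mult[of "- 1" a] B_subset B_uminus[OF B_one] by auto

lemma R_diff: "a \<in> R \<Longrightarrow> b \<in> R \<Longrightarrow> a - b \<in> R"
  using R_add[of a "- b"] R_uminus[of b] by simp

lemma generated_induct [consumes 1, case_names one add scale shift]:
  assumes "p \<in> R" and "1 \<in> D" and "\<And>u v. u \<in> D \<Longrightarrow> v \<in> D \<Longrightarrow> u + v \<in> D"
    and "\<And>b v. b \<in> B \<Longrightarrow> v \<in> D \<Longrightarrow> b * v \<in> D" and "\<And>v. v \<in> D \<Longrightarrow> x * v \<in> D"
  shows "p \<in> D"
proof -
  obtain a n where a: "\<And>k. a k \<in> B" and p: "p = (\<Sum>k<n. a k * x ^ k)"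
    using generated[OF assms(1)] by blast
  have "x ^ k \<in> D" for k
    by (induction k) (use assms in auto)
  then have 1: "a k * x ^ k \<in> D" for k
    using a assms(4) by blast
  have "0 \<in> D" using assms(4)[OF B_zero assms(2)] by simp
  then have "(\<Sum>k<n. a k * x ^ k) \<in> D"
    by (induction n) (auto intro: assms(3) 1)
  then show ?thesis using p by simp
qed

text \<open>These are the elements of degree less than \<open>n\<close> in \<open>x\<close>. Hence
  \<open>p - x ^ k \<in> below k\<close> says that \<open>p\<close> is monic of degree
  \<open>k\<close>.\<close>

definition below :: "nat \<Rightarrow> 'a set" where
  "below n = {p. \<exists>a. (\<forall>k. a k \<in> B) \<and> p = (\<Sum>k<n. a k * x ^ k)}"

lemma below_0: "0 \<in> below n"
  unfolding below_def using B_zero by (auto intro!: exI[of _ "\<lambda>_. 0"])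

lemma below_add: "p \<in> below n \<Longrightarrow> q \<in> below n \<Longrightarrow> p + q \<in> below n"
  unfolding below_def mem_Collect_eq
proof (elim exE conjE)
  fix a b assume "\<forall>k. a k \<in> B" "p = (\<Sum>k<n. a k * x ^ k)" "\<forall>k. b k \<in> B" "q = (\<Sum>k<n. b k * x ^ k)"
  then show "\<exists>a. (\<forall>k. a k \<in> B) \<and> p + q = (\<Sum>k<n. a k * x ^ k)"
    by (intro exI[of _ "\<lambda>k. a k + b k"]) (auto simp: sum.distrib algebra_simps intro: B_add)
qed

lemma below_scale: "b \<in> B \<Longrightarrow> p \<in> below n \<Longrightarrow> b * p \<in> below n"
  unfolding below_def mem_Collect_eq
proof (elim exE conjE)
  fix a assume "b \<in> B" "\<forall>k. a k \<in> B" "p = (\<Sum>k<n. a k * x ^ k)"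
  then show "\<exists>a. (\<forall>k. a k \<in> B) \<and> b * p = (\<Sum>k<n. a k * x ^ k)"
    by (intro exI[of _ "\<lambda>k. b * a k"]) (auto simp: sum_distrib_left algebra_simps intro: B_mult)
qed

lemma below_monomial: "b \<in> B \<Longrightarrow> k < n \<Longrightarrow> b * x ^ k \<in> below n"
  unfolding below_def
  by (auto intro!: exI[of _ "\<lambda>i. if i = k then b else 0"] B_zero simp: if_distrib[of "\<lambda>t. t * _"] cong: if_cong)

lemma below_sum: "(\<And>i. i \<in> I \<Longrightarrow> f i \<in> below n) \<Longrightarrow> sum f I \<in> below n"
  by (induction I rule: infinite_finite_induct) (auto intro: below_0 below_add)

lemma below_mono: assumes "p \<in> below n" "n \<le> m" shows "p \<in> below m"
proof -
  obtain a where a: "\<And>k. a k \<in> B" "p = (\<Sum>k<n. a k * x ^ k)" using assms by (auto simp: below_def)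
  then show ?thesis using assms(2)
    by (auto intro!: below_sum below_monomial)
qed

lemma below_shift: assumes "p \<in> below n" shows "x * p \<in> below (Suc n)"
proof -
  obtain a where a: "\<And>k. a k \<in> B" "p = (\<Sum>k<n. a k * x ^ k)" using assms by (auto simp: below_def)
  have "x * p = (\<Sum>k<n. a k * x ^ Suc k)" by (simp add: a(2) sum_distrib_left algebra_simps)
  also have "\<dots> \<in> below (Suc n)" using a by (intro below_sum below_monomial) auto
  finally show ?thesis .
qed

text \<open>A family with one monic member in each degree is independent over \<open>B\<close>: the
  top coefficient of a vanishing combination is zero, and induction handles the rest.\<close>

lemma monic_independent:
  assumes "\<And>k. e k - x ^ k \<in> below k" and "\<And>k. c k \<in> B" and "(\<Sum>k<n. c k * e k) = 0" and "k < n"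
  shows "c k = 0"
  using assms(3,4)
proof (induction n arbitrary: k)
  case (Suc n)
  have e: "e k \<in> below (Suc k)" for k
    using below_add[OF below_mono[OF assms(1)[of k], of "Suc k"] below_monomial[OF B_one, of k "Suc k"]] by simp
  have "(\<Sum>k<n. c k * e k) + c n * (e n - x ^ n) \<in> below n"
    using assms(2) by (intro below_add below_sum below_scale below_mono[OF e] assms(1)) auto
  then obtain a where a: "\<And>k. a k \<in> B" "(\<Sum>k<n. c k * e k) + c n * (e n - x ^ n) = (\<Sum>k<n. a k * x ^ k)"
    by (auto simp: below_def)
  define a' where "a' k = (if k = n then c n else a k)" for k
  have "c n * x ^ n + (\<Sum>k<n. a k * x ^ k) = 0"
    using Suc.prems(1) by (simp only: a(2)[symmetric]) (simp add: algebra_simps)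
  then have "(\<Sum>k<Suc n. a' k * x ^ k) = 0"
    by (simp add: a'_def add.commute)
  then have "a' n = 0" using independent[of a' "Suc n" n] a(1) assms(2) by (simp add: a'_def)
  then have cn: "c n = 0" by (simp add: a'_def)
  then have "(\<Sum>k<n. c k * e k) = 0" using Suc.prems(1) by simp
  then show ?case using Suc.IH[of k] Suc.prems(2) cn by (cases "k = n") auto
qed simp

lemma cseq_monic: assumes "w \<in> B" shows "cseq w x (Suc k) - x ^ k \<in> below k"
proof (induction k rule: less_induct)
  case (less k)
  consider "k = 0" | "k = 1" | l where "k = Suc (Suc l)"
    by (metis One_nat_def not0_implies_Suc)
  then show ?case
  proof cases
    case 3
    have m: "cseq w x (Suc l) \<in> below (Suc l)"
      using below_add[OF below_mono[OF less[of l], of "Suc l"] below_monomial[OF B_one, of l "Suc l"]] 3 by simp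
    have "cseq w x (Suc k) - x ^ k = x * (cseq w x (Suc (Suc l)) - x ^ (Suc l)) + (- w) * cseq w x (Suc l)"
      using 3 by (simp add: algebra_simps)
    also have "\<dots> \<in> below k"
      unfolding \<open>k = Suc (Suc l)\<close> using 3
      by (intro below_add[OF below_shift[OF less[of "Suc l"]] below_scale[OF B_uminus[OF assms] below_mono[OF m]]]) auto
    finally show ?thesis .
  qed (auto simp: below_0)
qed

lemma cseq_division_unique:
  assumes w: "w \<in> B" and d: "d > 0" and c: "\<And>a. c a \<in> B" and q: "q \<in> R"
    and eq: "(\<Sum>a\<in>{1..<d}. c a * cseq w x a) + q * cseq w x d = 0"
  shows "a \<in> {1..<d} \<Longrightarrow> c a = 0" and "q = 0"
proof -
  obtain b n where b: "\<And>k. b k \<in> B" and qs: "q = (\<Sum>k<n. b k * x ^ k)" using generated[OF q] by blast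
  \<comment> \<open>The basis of remainders fills the degrees below \<open>d - 1\<close>, and the
    multiples of the divisor by powers of \<open>x\<close> continue it. Member \<open>k\<close> is
    monic of degree \<open>k\<close>, so the whole family is independent.\<close>
  define e where "e k = (if Suc k < d then cseq w x (Suc k) else x ^ (Suc k - d) * cseq w x d)" for k
  define c' where "c' k = (if Suc k < d then c (Suc k) else b (Suc k - d))" for k
  obtain d' where d': "d = Suc d'" using d by (cases d) auto
  have shifts: "x ^ j * (cseq w x d - x ^ d') \<in> below (j + d')" for j
    using below_shift cseq_monic[OF w, of d'] d' by (induction j) (auto simp: mult.assoc)
  have monic: "e k - x ^ k \<in> below k" for k
  proof (cases "Suc k < d")
    case False
    define j where "j = Suc k - d"
    have kj: "k = j + d'" using False d' j_def by simp
    have "e k - x ^ k = x ^ j * (cseq w x d - x ^ d')"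
      unfolding e_def using False by (simp add: j_def[symmetric]) (simp add: kj algebra_simps power_add)
    then show ?thesis using shifts[of j] kj by simp
  qed (use cseq_monic[OF w] in \<open>auto simp: e_def\<close>)
  have "(\<Sum>k<d' + n. c' k * e k) = (\<Sum>k<d'. c' k * e k) + (\<Sum>k<n. c' (d' + k) * e (d' + k))"
    by (induction n) (simp_all add: add.assoc)
  also have "(\<Sum>k<d'. c' k * e k) = (\<Sum>a\<in>{1..<d}. c a * cseq w x a)"
    unfolding d' by (rule sum.reindex_bij_witness[of _ "\<lambda>a. a - 1" Suc]) (auto simp: c'_def e_def d')
  also have "(\<Sum>k<n. c' (d' + k) * e (d' + k)) = q * cseq w x d"
    by (simp add: c'_def e_def d' qs sum_distrib_right mult.assoc)
  finally have 0: "(\<Sum>k<d' + n. c' k * e k) = 0" using eq by simp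
  have z: "c' k = 0" if "k < d' + n" for k
    using monic_independent[OF monic _ 0 that] b c by (simp add: c'_def)
  show "c a = 0" if "a \<in> {1..<d}" using z[of "a - 1"] that d' by (cases a) (auto simp: c'_def)
  have "b k = 0" if "k < n" for k using z[of "d' + k"] that d' by (auto simp: c'_def)
  then show "q = 0" by (simp add: qs)
qed

text \<open>The elements that admit such a division are closed under multiplication by
  \<open>x\<close>, since \<open>x\<close> times term \<open>a\<close> is term \<open>a + 1\<close>
  plus \<open>w\<close> times term \<open>a - 1\<close>. Here term 0 vanishes and term
  \<open>d\<close> counts as a multiple of the divisor.\<close>

lemma cseq_division:
  assumes w: "w \<in> B" and d: "d > 0" and p: "p \<in> R"
  obtains c q where "\<And>a. c a \<in> B" "q \<in> R" "p = (\<Sum>a\<in>{1..<d}. c a * cseq w x a) + q * cseq w x d"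
proof -
  define D where "D = {p. \<exists>c q. (\<forall>a. c a \<in> B) \<and> q \<in> R \<and> p = (\<Sum>a\<in>{1..<d}. c a * cseq w x a) + q * cseq w x d}"
  have R0: "0 \<in> R" "1 \<in> R" using B_zero B_one B_subset by auto
  have add: "u + v \<in> D" if "u \<in> D" "v \<in> D" for u v
    using that unfolding D_def mem_Collect_eq
  proof (elim exE conjE)
    fix c q c' q' assume *: "\<forall>a. c a \<in> B" "q \<in> R" "u = (\<Sum>a\<in>{1..<d}. c a * cseq w x a) + q * cseq w x d"
      "\<forall>a. c' a \<in> B" "q' \<in> R" "v = (\<Sum>a\<in>{1..<d}. c' a * cseq w x a) + q' * cseq w x d"
    show "\<exists>c q. (\<forall>a. c a \<in> B) \<and> q \<in> R \<and> u + v = (\<Sum>a\<in>{1..<d}. c a * cseq w x a) + q * cseq w x d"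
      using * by (intro exI[of _ "\<lambda>a. c a + c' a"] exI[of _ "q + q'"])
        (auto simp: sum.distrib algebra_simps intro: B_add R_add)
  qed
  have scale: "b * v \<in> D" if "b \<in> B" "v \<in> D" for b v
    using that unfolding D_def mem_Collect_eq
  proof (elim exE conjE)
    fix c q assume *: "b \<in> B" "\<forall>a. c a \<in> B" "q \<in> R" "v = (\<Sum>a\<in>{1..<d}. c a * cseq w x a) + q * cseq w x d"
    show "\<exists>c q. (\<forall>a. c a \<in> B) \<and> q \<in> R \<and> b * v = (\<Sum>a\<in>{1..<d}. c a * cseq w x a) + q * cseq w x d"
      using * B_subset by (intro exI[of _ "\<lambda>a. b * c a"] exI[of _ "b * q"])
        (auto simp: sum_distrib_left algebra_simps intro: B_mult R_mult)
  qed
  have Q: "q * cseq w x d \<in> D" if "q \<in> R" for q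
    unfolding D_def using that B_zero by (auto intro!: exI[of _ "\<lambda>_. 0"] exI[of _ q])
  have s: "cseq w x a \<in> D" if "a \<le> d" for a
  proof -
    consider "a = 0" | "a = d" | "a \<in> {1..<d}" using \<open>a \<le> d\<close> by force
    then show ?thesis
    proof cases
      case 1 then show ?thesis using Q[OF R0(1)] by simp
    next
      case 2 then show ?thesis using Q[OF R0(2)] by simp
    next
      case 3 then show ?thesis unfolding D_def
        by (auto intro!: exI[of _ "\<lambda>i. if i = a then 1 else 0"] exI[of _ "0::'a"] B_zero B_one R0
            simp: if_distrib[of "\<lambda>t. t * _"] sum.delta cong: if_cong)
    qed
  qed
  have D_sum: "sum f I \<in> D" if "\<And>i. i \<in> I \<Longrightarrow> f i \<in> D" for I and f :: "nat \<Rightarrow> 'a"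
    using that Q[OF R0(1)] by (induction I rule: infinite_finite_induct) (auto intro: add)
  have "p \<in> D" using p
  proof (induction rule: generated_induct)
    case one
    then show ?case using s[of 1] d by simp
  next
    case (shift v)
    then obtain c q where *: "\<And>a. c a \<in> B" "q \<in> R" "v = (\<Sum>a\<in>{1..<d}. c a * cseq w x a) + q * cseq w x d"
      unfolding D_def by blast
    have "x * v = (\<Sum>a\<in>{1..<d}. c a * (x * cseq w x a)) + (x * q) * cseq w x d"
      by (simp add: *(3) sum_distrib_left algebra_simps)
    also have "(\<Sum>a\<in>{1..<d}. c a * (x * cseq w x a)) = (\<Sum>a\<in>{1..<d}. c a * (cseq w x (Suc a) + w * cseq w x (a - 1)))"
    proof (rule sum.cong)
      fix a assume "a \<in> {1..<d}"
      then show "c a * (x * cseq w x a) = c a * (cseq w x (Suc a) + w * cseq w x (a - 1))" by (cases a) auto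
    qed simp
    also have "\<dots> + (x * q) * cseq w x d \<in> D"
      using * x_mem w by (intro add Q D_sum scale s R_mult) auto
    finally show ?case .
  qed (use add scale in auto)
  then show ?thesis using that unfolding D_def by blast
qed

text \<open>The quotient of \<open>R\<close> by \<open>cseq w x d\<close> is free over
  \<open>B\<close>, hence torsion-free: multiplying by \<open>t\<close> multiplies all coordinates
  by \<open>t\<close>.\<close>

lemma cseq_dvd_cancel:
  assumes w: "w \<in> B" and d: "d > 0" and t: "t \<in> B" "t \<noteq> 0" and p: "p \<in> R" "q \<in> R"
    and eq: "t * p = cseq w x d * q"
  obtains p' where "p' \<in> R" "p = cseq w x d * p'"
proof -
  obtain c r where c: "\<And>a. c a \<in> B" and r: "r \<in> R" and p': "p = (\<Sum>a\<in>{1..<d}. c a * cseq w x a) + r * cseq w x d"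
    using cseq_division[OF w d p(1)] by metis
  have "(\<Sum>a\<in>{1..<d}. (t * c a) * cseq w x a) + (t * r - q) * cseq w x d = t * p - cseq w x d * q"
    by (simp add: p' sum_distrib_left algebra_simps)
  then have 0: "(\<Sum>a\<in>{1..<d}. (t * c a) * cseq w x a) + (t * r - q) * cseq w x d = 0" using eq by simp
  have "t * c a = 0" if "a \<in> {1..<d}" for a
    using cseq_division_unique(1)[OF w d _ _ 0 that] t c r p B_subset by (auto intro: B_mult R_mult R_diff)
  then have "c a = 0" if "a \<in> {1..<d}" for a using t that by auto
  then have "p = cseq w x d * r" by (simp add: p')
  then show ?thesis using that r by blast
qed

lemma cseq_nonzero: assumes "w \<in> B" "d > 0" shows "cseq w x d \<noteq> 0"
proof
  assume *: "cseq w x d = 0"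
  have "(\<Sum>a\<in>{1..<d}. 0 * cseq w x a) + 1 * cseq w x d = 0" using * by simp
  from cseq_division_unique(2)[OF assms _ _ this] show False using B_zero B_one B_subset by auto
qed

end

section \<open>The complex of syzygies and its exactness\<close>

text \<open>\<open>B\<close> and \<open>A\<close> play the roles of \<open>\<complex>[y, z]\<close> and \<open>\<complex>[z]\<close>, while \<open>x\<close> and \<open>y\<close> are twice the variables.\<close>

locale chebyshev_syzygies = adjunction B UNIV x + base: adjunction A B y
  for A B :: "'a::{idom,ring_char_0} set" and x y +
  fixes z :: 'a and d :: nat
  assumes z_mem: "z \<in> A" and z_nonzero: "z \<noteq> 0" and d_pos: "d > 0"
    and half: "\<exists>h\<in>B. 2 * h = 1"
begin

abbreviation "Z \<equiv> z * z"
abbreviation "s \<equiv> cseq Z x"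
abbreviation "u \<equiv> cseq Z y"
abbreviation "\<kappa> a \<equiv> (if a = 1 then z else 0) + (if Suc a = d then z else 0)"

definition n :: nat where "n = (d - 1) div 2"
definition m :: nat where "m = d div 2"
definition W :: 'a where "W = s (d - 1) + u (d - 1)"

definition e :: "nat \<Rightarrow> nat \<Rightarrow> 'a" where "e j i = (if i = j then 1 else 0)"

text \<open>The vectors \<open>e 0, \<dots>, e (m + 1)\<close> are the standard basis of the second free module. The
  vectors \<open>g a\<close>, \<open>h a\<close> in it are mapped by \<open>\<phi>2\<close> to the syzygies \<open>gl a\<close>, \<open>hl a\<close> whose last coordinates
  are \<open>g\<^sub>a\<close> and \<open>h\<^sub>a\<close>. For odd \<open>d\<close> the value of \<open>h 0\<close> is chosen so that \<open>h 0 = h d\<close>.\<close>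

definition g :: "nat \<Rightarrow> nat \<Rightarrow> 'a" where
  "g a i = (if a = Suc i \<and> i < n then 1 else if a + Suc i = d \<and> i < n then - 1 else 0)"

fun h :: "nat \<Rightarrow> nat \<Rightarrow> 'a" where
  "h 0 i = (if even d then e (m - 1) i else e m i + (\<Sum>j<m. x * g (2 * j + 2) i - y * g (2 * j + 1) i))"
| "h (Suc 0) i = e m i"
| "h (Suc (Suc a)) i = h a i + x * g (Suc a) i - y * g a i"

text \<open>The correction \<open>\<kappa>\<close> is needed because, while \<open>g 0 = g d = 0\<close>, the formulas for \<open>z\<^sup>2\<close> times the lifts
  of \<open>g\<^sub>0\<close> and \<open>g\<^sub>d\<close> give \<open>z\<close> and \<open>-z\<close> times the Koszul syzygy.\<close>

definition \<rho> :: "nat \<Rightarrow> nat \<Rightarrow> 'a" where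
  "\<rho> a i = x * h a i - y * h (Suc a) i + Z * g (Suc a) i - Z * g (a - 1) i - \<kappa> a * e (Suc m) i"

definition gl :: "nat \<Rightarrow> nat \<Rightarrow> 'a" where
  "gl a i = (if i = 0 then - z * (s (a - 1) * u (d - a) - s (d - a - 1) * u a)
    else if i = 1 then - z * (s a * u (d - a - 1) - s (d - a) * u (a - 1))
    else if i = 2 then s a * u (d - a) - s (d - a) * u a else 0)"

text \<open>This is \<open>z\<^sup>2\<close> times the term of index \<open>k - 1\<close> of the sequence, which makes sense also for \<open>k = 0\<close>.\<close>

definition r :: "'a \<Rightarrow> nat \<Rightarrow> 'a" where
  "r v k = v * cseq Z v k - cseq Z v (Suc k)"

definition hl :: "nat \<Rightarrow> nat \<Rightarrow> 'a" where
  "hl a i = (if i = 0 then - z * (s (a - 1) * u (Suc d - a) - r x (d - a) * u (a - 1))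
    else if i = 1 then - z * (s a * u (d - a) - s (d - a) * r y (a - 1))
    else if i = 2 then s a * u (Suc d - a) - Z * s (d - a) * u (a - 1) else 0)"

text \<open>The Koszul syzygy between \<open>s d\<close> and \<open>z * W\<close>. It is the lift
  belonging to both \<open>h 0\<close> and \<open>h d\<close>.\<close>

definition Ql :: "nat \<Rightarrow> 'a" where
  "Ql i = (if i = 0 then - z * W else if i = 2 then s d else 0)"

text \<open>The Koszul syzygy between \<open>s d\<close> and \<open>u d\<close>, the one not seen by
  the last coordinate.\<close>

definition Kl :: "nat \<Rightarrow> 'a" where
  "Kl i = (if i = 0 then u d else if i = 1 then - s d else 0)"

text \<open>In the range \<open>j < m + 2\<close> the value \<open>Ql\<close> is reached only for
  even \<open>d\<close>, at \<open>j = m - 1\<close>; for odd \<open>d\<close> one has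
  \<open>n = m\<close>. This is where the two parities differ.\<close>

definition col :: "nat \<Rightarrow> nat \<Rightarrow> 'a" where
  "col j = (if j < n then gl (Suc j) else if j = m then hl 1 else if j = Suc m then Kl else Ql)"

text \<open>The factor \<open>d\<close> of the partial derivatives and the sign of the third one are
  left out; they are units and do not affect the ideal.\<close>

definition \<phi>1 :: "(nat \<Rightarrow> 'a) \<Rightarrow> 'a" where
  "\<phi>1 v = v 0 * s d + v 1 * u d + v 2 * (z * W)"

definition \<phi>2 :: "(nat \<Rightarrow> 'a) \<Rightarrow> nat \<Rightarrow> 'a" where
  "\<phi>2 v i = (\<Sum>j<m + 2. v j * col j i)"

definition \<phi>3 :: "(nat \<Rightarrow> 'a) \<Rightarrow> nat \<Rightarrow> 'a" where
  "\<phi>3 v i = (\<Sum>a<m. v a * \<rho> (Suc a) i)"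

section \<open>Linearity of \<open>\<phi>2\<close> and symmetry under the reflection of
  \<open>a\<close> to \<open>d - a\<close>\<close>

lemma n_le_m: "n \<le> m" by (simp add: n_def m_def)
lemma even_m: "even d \<Longrightarrow> m = Suc n" "even d \<Longrightarrow> d = 2 * m"
  using d_pos by (auto simp: n_def m_def elim!: evenE)
lemma odd_m: "odd d \<Longrightarrow> m = n" "odd d \<Longrightarrow> d = Suc (2 * m)"
  by (auto simp: n_def m_def elim!: oddE)

lemma \<phi>2_add: "\<phi>2 (\<lambda>j. v j + w j) i = \<phi>2 v i + \<phi>2 w i"
  by (simp add: \<phi>2_def sum.distrib algebra_simps)
lemma \<phi>2_diff: "\<phi>2 (\<lambda>j. v j - w j) i = \<phi>2 v i - \<phi>2 w i"
  by (simp add: \<phi>2_def sum_subtractf algebra_simps)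
lemma \<phi>2_scale: "\<phi>2 (\<lambda>j. c * v j) i = c * \<phi>2 v i"
  by (simp add: \<phi>2_def sum_distrib_left algebra_simps)
lemma \<phi>2_sum: "\<phi>2 (\<lambda>j. \<Sum>k\<in>I. f k j) i = (\<Sum>k\<in>I. \<phi>2 (f k) i)"
  unfolding \<phi>2_def sum_distrib_right by (rule sum.swap)
lemma \<phi>2_zero: "\<phi>2 (\<lambda>_. 0) i = 0"
  by (simp add: \<phi>2_def)
lemma \<phi>2_uminus: "\<phi>2 (\<lambda>j. - v j) i = - \<phi>2 v i"
  by (simp add: \<phi>2_def sum_negf)
lemma \<phi>2_e: "j < m + 2 \<Longrightarrow> \<phi>2 (e j) i = col j i"
  by (simp add: \<phi>2_def e_def if_distrib[of "\<lambda>t. t * _"] cong: if_cong)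

lemma g_swap: "a \<le> d \<Longrightarrow> g (d - a) i = - g a i"
  by (auto simp: g_def n_def)
lemma g_0: "g 0 i = 0"
  by (auto simp: g_def n_def)
lemma g_d: "g d i = 0"
  using g_swap[of 0 i] g_0 by simp

text \<open>The defect \<open>\<delta>\<close> is constant along steps of two and changes sign under
  the reflection. For even \<open>d\<close> the reflection preserves parity, so each of the two
  values is its own negative. For odd \<open>d\<close> it exchanges the parities, and the choice of
  \<open>h 0\<close> makes one value zero, hence both.\<close>

lemma h_swap:
  assumes "a \<le> d" shows "h (d - a) i = h a i - y * g a i"
proof -
  define \<delta> where "\<delta> a = h (d - a) i - h a i + y * g a i" for a
  have step: "\<delta> (Suc (Suc a)) = \<delta> a" if "Suc (Suc a) \<le> d" for a
  proof -
    define b where "b = d - Suc (Suc a)"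
    have b: "d - a = Suc (Suc b)" "d - Suc a = Suc b" "d - Suc (Suc a) = b" using that by (auto simp: b_def)
    have "g (Suc b) i = - g (Suc a) i" "g b i = - g (Suc (Suc a)) i"
      using g_swap[of "Suc a" i] g_swap[of "Suc (Suc a)" i] that b by auto
    then show ?thesis by (simp add: \<delta>_def b algebra_simps)
  qed
  have anti: "\<delta> (d - a) = - \<delta> a" if "a \<le> d" for a
    using that g_swap[OF that] by (simp add: \<delta>_def algebra_simps)
  have ev: "2 * k \<le> d \<Longrightarrow> \<delta> (2 * k) = \<delta> 0" for k
    by (induction k) (auto simp: step)
  have od: "2 * k + 1 \<le> d \<Longrightarrow> \<delta> (2 * k + 1) = \<delta> 1" for k
    by (induction k) (auto simp: step)
  have "\<delta> 0 = 0 \<and> \<delta> 1 = 0 \<or> d = 1 \<and> \<delta> 0 = 0"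
  proof (cases "even d")
    case True
    have "d - 1 = 2 * n + 1" using even_m[OF True] by simp
    with True have "\<delta> 0 = - \<delta> 0" "\<delta> 1 = - \<delta> 1"
      using anti[of 0] anti[of 1] ev[of m] od[of n] even_m by auto
    then show ?thesis by simp
  next
    case False
    have "h (2 * k + 1) i = e m i + (\<Sum>j<k. x * g (2 * j + 2) i - y * g (2 * j + 1) i)" for k
      by (induction k) (auto simp: algebra_simps)
    from this[of m] have "h d i = h 0 i" using odd_m[OF False] False by simp
    then have 0: "\<delta> 0 = 0" by (simp add: \<delta>_def g_0)
    then have "\<delta> 1 = 0" if "d \<noteq> 1"
      using anti[of 0] od[of m] odd_m[OF False] by simp
    with 0 show ?thesis by blast
  qed
  moreover have "\<delta> a = \<delta> 0 \<or> \<delta> a = \<delta> 1"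
  proof -
    have "a = 2 * (a div 2) \<or> a = 2 * (a div 2) + 1" by presburger
    then show ?thesis using ev[of "a div 2"] od[of "a div 2"] assms by metis
  qed
  moreover have "\<delta> 1 = - \<delta> 0" if "d = 1" using anti[of 0] that by simp
  ultimately have "\<delta> a = 0" by auto
  then show ?thesis by (simp add: \<delta>_def algebra_simps)
qed

text \<open>This symmetry is the reason why \<open>m\<close> of the \<open>d - 1\<close> relations
  suffice.\<close>

lemma \<rho>_swap: assumes "0 < a" "a < d" shows "\<rho> (d - a) i = \<rho> a i"
proof -
  have 1: "h (d - a) i = h a i - y * g a i" "h (Suc (d - a)) i = h (a - 1) i - y * g (a - 1) i"
    "g (Suc (d - a)) i = - g (a - 1) i" "g (d - a - 1) i = - g (Suc a) i"
    using h_swap[of a i] h_swap[of "a - 1" i] g_swap[of "a - 1" i] g_swap[of "Suc a" i] assms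
    by (auto simp: Suc_diff_le)
  have 2: "\<kappa> (d - a) = \<kappa> a" using assms by auto
  have "h (Suc a) i = h (a - 1) i + x * g a i - y * g (a - 1) i"
    using assms by (cases a) auto
  then show ?thesis unfolding \<rho>_def 1 2 \<open>h (Suc a) i = _\<close> by (simp add: algebra_simps)
qed

section \<open>Values of \<open>\<phi>2\<close> on the vectors \<open>g a\<close>,
  \<open>h a\<close> and \<open>\<rho> a\<close>\<close>

lemma gl_swap: "a \<le> d \<Longrightarrow> gl (d - a) i = - gl a i"
  by (auto simp: gl_def algebra_simps)

text \<open>Up to \<open>n\<close> the vector \<open>g a\<close> is a basis vector, and the
  reflection covers the upper half. At a midpoint \<open>d = 2 * a\<close> both sides equal their
  own negatives and vanish.\<close>

lemma \<phi>2_g: assumes "0 < a" "a < d" shows "\<phi>2 (g a) i = gl a i"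
proof -
  have small: "\<phi>2 (g a) i = gl a i" if a: "0 < a" "a \<le> n" for a
  proof -
    have "g a = e (a - 1)" using a by (auto simp: g_def e_def n_def fun_eq_iff)
    then show ?thesis using a \<phi>2_e[of "a - 1" i] n_le_m by (cases a) (auto simp: col_def)
  qed
  consider "a \<le> n" | "d - a \<le> n" | "d = 2 * a" using assms unfolding n_def by linarith
  then show ?thesis
  proof cases
    case 2
    have "g a = (\<lambda>i. - g (d - a) i)" using g_swap[of a] assms by simp
    then show ?thesis using small[of "d - a"] 2 assms gl_swap[of a i] \<phi>2_uminus by simp
  next
    case 3
    have "gl a i = - gl a i" using gl_swap[of a i] 3 by simp
    then have "gl a i = 0" by simp
    moreover have "g a i = - g a i" for i using g_swap[of a i] 3 by simp
    then have "g a = (\<lambda>_. 0)" by (simp add: fun_eq_iff)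
    ultimately show ?thesis using \<phi>2_zero by simp
  qed (use small assms in auto)
qed

text \<open>The lifts obey the recursion that defines \<open>h\<close>, so agreement with
  \<open>\<phi>2 (h a)\<close> spreads in steps of two. Writing \<open>d\<close> as
  \<open>a + j + 2\<close> removes the truncated subtractions.\<close>

lemma hl_step:
  assumes "0 < a" "Suc (Suc a) \<le> d"
  shows "hl (Suc (Suc a)) i = hl a i + x * gl (Suc a) i - y * gl a i"
proof -
  obtain j where j: "d = Suc (Suc (a + j))" using assms by (metis add_Suc le_Suc_ex)
  obtain k where k: "a = Suc k" using assms(1) by (cases a) auto
  show ?thesis
    unfolding hl_def gl_def r_def
    by (simp add: j k numeral_3_eq_3 algebra_simps)
qed

lemma hl_2: assumes "2 \<le> d" shows "hl (Suc (Suc 0)) i = Ql i + x * gl 1 i"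
proof -
  obtain j where j: "d = Suc (Suc j)" using assms by (metis add_2_eq_Suc le_Suc_ex)
  show ?thesis
    unfolding hl_def gl_def r_def Ql_def W_def
    by (simp add: j algebra_simps)
qed

lemma hl_1: "hl 1 i = (if i = 1 then - (z * W) else if i = 2 then u d else 0)"
  by (simp add: hl_def r_def W_def algebra_simps)

lemma hl_d: "hl d i = Ql i"
  unfolding hl_def Ql_def W_def r_def using d_pos by (cases d) (auto simp: algebra_simps)

lemma \<phi>2_h_step:
  assumes "\<phi>2 (h a) i = hl a i" "0 < a" "Suc (Suc a) \<le> d"
  shows "\<phi>2 (h (Suc (Suc a))) i = hl (Suc (Suc a)) i"
proof -
  have "h (Suc (Suc a)) = (\<lambda>i. (h a i + x * g (Suc a) i) - y * g a i)" by (simp add: fun_eq_iff)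
  then show ?thesis using assms by (simp add: \<phi>2_add \<phi>2_diff \<phi>2_scale \<phi>2_g hl_step)
qed

lemma h_Suc_0: "h (Suc 0) = e m" by (simp add: fun_eq_iff)

lemma \<phi>2_h_odd: "2 * k + 1 \<le> d \<Longrightarrow> \<phi>2 (h (2 * k + 1)) i = hl (2 * k + 1) i"
proof (induction k)
  case 0
  then show ?case using \<phi>2_e[of m i] n_le_m by (simp add: h_Suc_0 col_def)
qed (auto intro: \<phi>2_h_step simp del: h.simps)

text \<open>For odd \<open>d\<close> one has \<open>h 0 = h d\<close>, and \<open>d\<close> is an
  odd index, so the odd indices have to be settled first. For even \<open>d\<close> the vector
  \<open>h 0\<close> is a basis vector.\<close>

lemma \<phi>2_h_0: "\<phi>2 (h 0) i = Ql i"
proof (cases "even d")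
  case True
  then have "h 0 = e (m - 1)" by (simp add: fun_eq_iff)
  then show ?thesis using \<phi>2_e[of "m - 1" i] even_m[OF True] by (simp add: col_def)
next
  case False
  have "h 0 = h d" using h_swap[of 0] g_0 by (simp add: fun_eq_iff)
  then show ?thesis using \<phi>2_h_odd[of m i] odd_m[OF False] hl_d by simp
qed

lemma \<phi>2_h: assumes "0 < a" "a \<le> d" shows "\<phi>2 (h a) i = hl a i"
proof (cases "even a")
  case True
  have "2 * k + 2 \<le> d \<Longrightarrow> \<phi>2 (h (2 * k + 2)) i = hl (2 * k + 2) i" for k
  proof (induction k)
    case 0
    have "h (Suc (Suc 0)) = (\<lambda>i. h 0 i + x * g 1 i)" by (simp add: fun_eq_iff g_0)
    then show ?case using 0 by (simp add: \<phi>2_add \<phi>2_scale \<phi>2_g hl_2 \<phi>2_h_0 del: h.simps)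
  qed (auto intro: \<phi>2_h_step simp del: h.simps)
  moreover have "a = 2 * (a div 2 - 1) + 2" using True assms(1) by presburger
  ultimately show ?thesis using assms by metis
qed (use \<phi>2_h_odd assms in \<open>auto elim!: oddE simp del: h.simps\<close>)

text \<open>One formula that includes the ends \<open>a = 0\<close> and \<open>a = d\<close>, where
  \<open>g a\<close> vanishes but the right side is a multiple of the Koszul syzygy. It spares a
  case distinction in the computation for \<open>\<rho>\<close>.\<close>

lemma \<phi>2_Z_g:
  assumes "a \<le> d"
  shows "Z * \<phi>2 (g a) i + ((if a = 0 then z else 0) - (if a = d then z else 0)) * Kl i
    = (if i = 0 then - z * (r x a * u (d - a) - r x (d - a) * u a)
       else if i = 1 then - z * (s a * r y (d - a) - s (d - a) * r y a)
       else if i = 2 then Z * (s a * u (d - a) - s (d - a) * u a) else 0)"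
proof -
  consider "a = 0" | "a = d" | k j where "a = Suc k" "d = Suc (Suc (k + j))"
  proof -
    have "a = Suc (a - 1) \<and> d = Suc (Suc ((a - 1) + (d - a - 1)))" if "a \<noteq> 0" "a \<noteq> d"
      using assms that by arith
    then show ?thesis using that by blast
  qed
  then show ?thesis
  proof cases
    case 1
    moreover have "g 0 = (\<lambda>_. 0)" using g_0 by (simp add: fun_eq_iff)
    ultimately show ?thesis using \<phi>2_zero d_pos by (simp add: Kl_def r_def algebra_simps)
  next
    case 2
    moreover have "g d = (\<lambda>_. 0)" using g_d by (simp add: fun_eq_iff)
    ultimately show ?thesis using \<phi>2_zero d_pos by (simp add: Kl_def r_def algebra_simps)
  next
    case 3
    then have *: "\<phi>2 (g a) i = gl a i" by (intro \<phi>2_g) auto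
    show ?thesis unfolding * gl_def r_def using 3 by (simp add: algebra_simps)
  qed
qed

lemma \<phi>2_\<rho>: assumes "0 < a" "a < d" shows "\<phi>2 (\<rho> a) i = 0"
proof -
  obtain k where k: "a = Suc k" using assms(1) by (cases a) auto
  obtain j where j: "d = Suc (Suc (k + j))" using less_imp_Suc_add[OF assms(2)] k by auto
  have eK: "\<phi>2 (e (Suc m)) i = Kl i" using \<phi>2_e[of "Suc m" i] n_le_m by (simp add: col_def)
  have "\<phi>2 (\<rho> a) i = x * hl a i - y * hl (Suc a) i + Z * \<phi>2 (g (Suc a)) i - Z * \<phi>2 (g (a - 1)) i - \<kappa> a * Kl i"
    unfolding \<rho>_def \<phi>2_add \<phi>2_diff \<phi>2_scale eK using assms by (simp add: \<phi>2_h del: h.simps)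
  \<comment> \<open>The correction \<open>\<kappa> a\<close> splits into the end terms for
    \<open>Suc a = d\<close> and \<open>a - 1 = 0\<close>, one for each occurrence of
    \<open>g\<close>.\<close>
  also have "\<dots> = x * hl a i - y * hl (Suc a) i
     + (Z * \<phi>2 (g (Suc a)) i + ((if Suc a = 0 then z else 0) - (if Suc a = d then z else 0)) * Kl i)
     - (Z * \<phi>2 (g (a - 1)) i + ((if a - 1 = 0 then z else 0) - (if a - 1 = d then z else 0)) * Kl i)"
    using assms by (auto simp: algebra_simps)
  also have "\<dots> = 0"
  proof -
    have dd: "d - a = Suc j" "d - Suc a = j" "Suc d - a = Suc (Suc j)" "Suc d - Suc a = Suc j"
      "d - k = Suc (Suc j)" "Suc a - 1 = Suc k" "a - 1 = k"
      using j k by auto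
    show ?thesis
      unfolding \<phi>2_Z_g[of "Suc a", OF Suc_leI[OF assms(2)]] \<phi>2_Z_g[of "a - 1", OF le_trans[OF diff_le_self less_imp_le[OF assms(2)]]]
      unfolding hl_def r_def dd unfolding k by (simp add: algebra_simps)
  qed
  finally show ?thesis .
qed

section \<open>First syzygies and the colon ideal\<close>

lemma y_mem: "y \<in> B" by (rule base.x_mem)
lemma Z_mem: "Z \<in> A" "Z \<in> B" "z \<in> B"
  using base.B_mult[OF z_mem z_mem] base.B_subset z_mem by auto
lemma u_mem: "u k \<in> B" by (intro B_cseq Z_mem y_mem)
lemma u_nonzero: "k > 0 \<Longrightarrow> u k \<noteq> 0" by (rule base.cseq_nonzero[OF Z_mem(1)])

text \<open>Modulo term \<open>d\<close>, multiplication by term \<open>d - 1\<close> sends term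
  \<open>a = i + 1\<close> to a power of \<open>Z\<close> times term \<open>d - a\<close>. So only
  the coordinates \<open>a\<close> and \<open>d - a\<close> interact.\<close>

lemma cseq_docagne_d:
  assumes "i < d"
  shows "cseq Z v (d - 1) * cseq Z v (Suc i) = cseq Z v d * cseq Z v i + Z ^ i * cseq Z v (d - 1 - i)"
  using cseq_docagne[of Z v i "d - 1 - i"] assms by (simp add: algebra_simps)

text \<open>For \<open>v = y\<close> this is the determinant of the 2 by 2 systems met in the colon
  ideal and in the uniqueness of normal forms.\<close>

lemma cseq_add_d:
  assumes "0 < a" "a \<le> d"
  shows "cseq Z v a * cseq Z v (Suc d - a) - Z * cseq Z v (a - 1) * cseq Z v (d - a) = cseq Z v d"
  using cseq_add[of Z v "a - 1" "d - a"] assms by (simp add: Suc_diff_le)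

text \<open>Grouped suitably, each bracket is an instance of \<open>cseq_docagne_d\<close>; the
  products with powers of \<open>Z\<close> that are left cancel in pairs.\<close>

lemma \<phi>1_gl: assumes "0 < a" "a < d" shows "\<phi>1 (gl a) = 0"
proof -
  obtain k where k: "a = Suc k" using assms(1) by (cases a) auto
  obtain j where j: "d = Suc (Suc (k + j))" using less_imp_Suc_add[OF assms(2)] k by auto
  have e: "cseq Z v (d - 1) * cseq Z v (Suc k) = cseq Z v d * cseq Z v k + Z ^ k * cseq Z v (Suc j)"
          "cseq Z v (d - 1) * cseq Z v (Suc j) = cseq Z v d * cseq Z v j + Z ^ j * cseq Z v (Suc k)" for v
    using cseq_docagne_d[of k v] cseq_docagne_d[of j v] j by (auto simp del: cseq.simps)
  have dd: "d - a = Suc j" "Suc j - 1 = j" "a - 1 = k" using j k by auto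
  have "\<phi>1 (gl a) = z * (u (Suc j) * (s (d - 1) * s (Suc k) - s d * s k)
      - u (Suc k) * (s (d - 1) * s (Suc j) - s d * s j)
      + s (Suc k) * (u (d - 1) * u (Suc j) - u d * u j)
      - s (Suc j) * (u (d - 1) * u (Suc k) - u d * u k))"
    unfolding \<phi>1_def gl_def W_def dd unfolding k by (simp add: algebra_simps del: cseq.simps)
  also have "\<dots> = 0" unfolding e by (simp add: algebra_simps del: cseq.simps)
  finally show ?thesis .
qed

lemma \<phi>1_col: assumes "j < m + 2" shows "\<phi>1 (col j) = 0"
proof -
  have "\<phi>1 (hl 1) = 0" "\<phi>1 Kl = 0" "\<phi>1 Ql = 0"
    by (simp_all add: \<phi>1_def hl_def Kl_def Ql_def r_def W_def algebra_simps)
  moreover have "\<phi>1 (gl (Suc j)) = 0" if "j < n" using that by (intro \<phi>1_gl) (auto simp: n_def)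
  ultimately show ?thesis by (simp add: col_def)
qed

lemma \<phi>1_\<phi>2: "\<phi>1 (\<phi>2 w) = 0"
proof -
  have "\<phi>1 (\<phi>2 w) = (\<Sum>j<m + 2. w j * \<phi>1 (col j))"
    unfolding \<phi>1_def \<phi>2_def sum_distrib_right
    by (simp only: sum.distrib[symmetric]) (simp only: distrib_left mult.assoc)
  also have "\<dots> = 0" using \<phi>1_col by (simp del: sum.lessThan_Suc)
  finally show ?thesis .
qed

lemma sum_reflect: "(\<Sum>a\<in>{1..<d}. f (d - a)) = (\<Sum>a\<in>{1..<d}. (f a :: 'a))"
  by (rule sum.reindex_bij_witness[of _ "\<lambda>a. d - a" "\<lambda>a. d - a"]) auto

text \<open>Comparing coordinates at \<open>s a\<close> turns the hypothesis into a congruence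
  modulo \<open>u d\<close> that involves \<open>b a\<close> and \<open>b (d - a)\<close> only. Two
  consequences of it form a linear system with determinant \<open>u d\<close>, and Cramer's rule
  expresses the two coordinates through \<open>\<beta>\<close> and \<open>\<gamma>\<close>.\<close>

lemma colon_coordinates:
  assumes eq: "c * (z * W) = p * u d + q * s d"
    and b: "\<And>a. b a \<in> B" and c: "c = (\<Sum>a\<in>{1..<d}. b a * s a) + q0 * s d" and a: "a \<in> {1..<d}"
  shows "\<exists>\<beta> \<gamma>. b a * s a + b (d - a) * s (d - a) = \<beta> * hl a 2 - \<gamma> * gl a 2"
proof -
  obtain pa p' where pa: "\<And>a. pa a \<in> B" and p: "p = (\<Sum>a\<in>{1..<d}. pa a * s a) + p' * s d"
    using cseq_division[OF Z_mem(2) d_pos, of p] by blast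
  have "(\<Sum>a\<in>{1..<d}. b a * s a) * W =
      (\<Sum>a\<in>{1..<d}. b a * u (d - 1) * s a + b a * s (a - 1) * s d + b a * Z ^ (a - 1) * s (d - a))"
    unfolding sum_distrib_right
  proof (rule sum.cong)
    fix a assume a: "a \<in> {1..<d}"
    then have "a - 1 < d" by auto
    from cseq_docagne_d[OF this, of x] have "s (d - 1) * s a = s d * s (a - 1) + Z ^ (a - 1) * s (d - a)"
      using a by simp
    then have "b a * (s (d - 1) * s a) = b a * s (a - 1) * s d + b a * Z ^ (a - 1) * s (d - a)"
      by (simp add: algebra_simps del: cseq.simps)
    then show "b a * s a * W = b a * u (d - 1) * s a + b a * s (a - 1) * s d + b a * Z ^ (a - 1) * s (d - a)"
      by (simp add: W_def algebra_simps del: cseq.simps)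
  qed simp
  also have "\<dots> = (\<Sum>a\<in>{1..<d}. b a * u (d - 1) * s a) + (\<Sum>a\<in>{1..<d}. b a * s (a - 1)) * s d
      + (\<Sum>a\<in>{1..<d}. b a * Z ^ (a - 1) * s (d - a))"
    by (simp only: sum.distrib sum_distrib_right)
  also have "(\<Sum>a\<in>{1..<d}. b a * Z ^ (a - 1) * s (d - a)) = (\<Sum>a\<in>{1..<d}. b (d - a) * Z ^ (d - a - 1) * s a)"
    by (subst sum_reflect[symmetric]) (auto intro!: sum.cong)
  finally have W: "(\<Sum>a\<in>{1..<d}. b a * s a) * W = (\<Sum>a\<in>{1..<d}. b a * u (d - 1) * s a)
      + (\<Sum>a\<in>{1..<d}. b a * s (a - 1)) * s d + (\<Sum>a\<in>{1..<d}. b (d - a) * Z ^ (d - a - 1) * s a)" .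
  define k where "k a = z * (b a * u (d - 1) + b (d - a) * Z ^ (d - a - 1)) - pa a * u d" for a
  define q' where "q' = z * (\<Sum>a\<in>{1..<d}. b a * s (a - 1)) + z * q0 * W - p' * u d - q"
  have K: "(\<Sum>a\<in>{1..<d}. k a * s a) = z * ((\<Sum>a\<in>{1..<d}. b a * u (d - 1) * s a) + (\<Sum>a\<in>{1..<d}. b (d - a) * Z ^ (d - a - 1) * s a))
      - (\<Sum>a\<in>{1..<d}. pa a * s a) * u d"
    unfolding sum.distrib[symmetric] sum_distrib_left sum_distrib_right sum_subtractf[symmetric]
    by (rule sum.cong) (auto simp: k_def algebra_simps simp del: cseq.simps)
  have "(\<Sum>a\<in>{1..<d}. k a * s a) + q' * s d = z * ((\<Sum>a\<in>{1..<d}. b a * s a) * W) + z * q0 * W * s d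
      - (\<Sum>a\<in>{1..<d}. pa a * s a) * u d - p' * s d * u d - q * s d"
    unfolding K W q'_def by (simp only: algebra_simps)
  also have "\<dots> = c * (z * W) - p * u d - q * s d"
    unfolding c p by (simp only: algebra_simps)
  also have "\<dots> = 0" using eq by simp
  finally have 0: "(\<Sum>a\<in>{1..<d}. k a * s a) + q' * s d = 0" .
  have "k a \<in> B" for a unfolding k_def
    by (intro B_diff B_mult B_add B_power b pa u_mem Z_mem)
  then have "k a = 0"
    using cseq_division_unique(1)[OF Z_mem(2) d_pos _ _ 0 a] by blast
  then have "z * (b a * u (d - 1) + b (d - a) * Z ^ (d - a - 1)) = u d * pa a"
    unfolding k_def by (simp add: mult.commute)
  \<comment> \<open>The factor \<open>z\<close> is a nonzero element of \<open>A\<close>, so it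
    cancels modulo \<open>u d\<close>.\<close>
  then obtain t where t: "t \<in> B" "b a * u (d - 1) + b (d - a) * Z ^ (d - a - 1) = u d * t"
    by (rule base.cseq_dvd_cancel[OF Z_mem(1) d_pos z_mem z_nonzero, rotated 2])
      (use pa in \<open>auto intro!: B_mult B_add B_power b pa u_mem Z_mem\<close>)
  define P where "P = Z ^ (d - a - 1)"
  have P: "P \<in> A" "P \<noteq> 0" using z_nonzero by (auto simp: P_def intro!: base.B_power Z_mem)
  have d1: "u (d - 1) * u (d - a) = u d * u (d - a - 1) + P * u a"
  proof -
    have e: "Suc (d - a - 1) = d - a" "d - 1 - (d - a - 1) = a" "d - a - 1 < d" using a by auto
    show ?thesis using cseq_docagne_d[OF e(3), of y] unfolding e(1,2) P_def .
  qed
  have d2: "u (d - 1) * u (Suc d - a) = u d * u (d - a) + P * (Z * u (a - 1))"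
  proof -
    have e: "Suc (d - a) = Suc d - a" "d - 1 - (d - a) = a - 1" "d - a < d" using a by auto
    have "d - a = Suc (d - a - 1)" using a by auto
    then have "Z ^ (d - a) = P * Z" unfolding P_def by (metis power_Suc2)
    then show ?thesis using cseq_docagne_d[OF e(3), of y] unfolding e(1,2) by (simp only: mult.assoc)
  qed
  \<comment> \<open>Multiplying the congruence by \<open>u (d - a)\<close> and applying
    \<open>d1\<close> brings out the factor \<open>P\<close>, which again cancels modulo
    \<open>u d\<close>. The same with \<open>u (Suc d - a)\<close> and \<open>d2\<close> gives
    \<open>\<gamma>\<close>.\<close>
  have "P * (b a * u a + b (d - a) * u (d - a)) = u (d - a) * (b a * u (d - 1) + b (d - a) * P) - b a * (u d * u (d - a - 1))"
    using d1 by (simp add: algebra_simps del: cseq.simps)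
  also have "\<dots> = u d * (u (d - a) * t - b a * u (d - a - 1))"
    using t(2) by (simp add: P_def algebra_simps del: cseq.simps)
  finally obtain \<beta> where \<beta>: "b a * u a + b (d - a) * u (d - a) = u d * \<beta>"
    by (rule base.cseq_dvd_cancel[OF Z_mem(1) d_pos P, rotated 2])
      (auto intro!: B_mult B_add B_diff b u_mem t)
  have "P * (b a * (Z * u (a - 1)) + b (d - a) * u (Suc d - a)) = u (Suc d - a) * (b a * u (d - 1) + b (d - a) * P) - b a * (u d * u (d - a))"
    using d2 by (simp add: algebra_simps del: cseq.simps)
  also have "\<dots> = u d * (u (Suc d - a) * t - b a * u (d - a))"
    using t(2) by (simp add: P_def algebra_simps del: cseq.simps)
  finally obtain \<gamma> where \<gamma>: "b a * (Z * u (a - 1)) + b (d - a) * u (Suc d - a) = u d * \<gamma>"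
    by (rule base.cseq_dvd_cancel[OF Z_mem(1) d_pos P, rotated 2])
      (auto intro!: B_mult B_add B_diff b u_mem t Z_mem)
  \<comment> \<open>Cramer's rule for the unknowns \<open>b a\<close> and \<open>b (d - a)\<close>:
    the right sides are multiples of \<open>u d\<close>, so the determinant cancels.\<close>
  have det: "u a * u (Suc d - a) - Z * u (a - 1) * u (d - a) = u d"
    using cseq_add_d[of a y] a by auto
  have "u d * (\<beta> * u (Suc d - a) - \<gamma> * u (d - a)) = u (Suc d - a) * (u d * \<beta>) - u (d - a) * (u d * \<gamma>)"
    by (simp only: algebra_simps)
  also have "\<dots> = (u a * u (Suc d - a) - Z * u (a - 1) * u (d - a)) * b a"
    unfolding \<beta>[symmetric] \<gamma>[symmetric] by (simp only: algebra_simps)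
  finally have ba: "b a = \<beta> * u (Suc d - a) - \<gamma> * u (d - a)" unfolding det using u_nonzero[OF d_pos] by simp
  have "u d * (\<gamma> * u a - Z * \<beta> * u (a - 1)) = u a * (u d * \<gamma>) - Z * u (a - 1) * (u d * \<beta>)"
    by (simp only: algebra_simps)
  also have "\<dots> = (u a * u (Suc d - a) - Z * u (a - 1) * u (d - a)) * b (d - a)"
    unfolding \<beta>[symmetric] \<gamma>[symmetric] by (simp only: algebra_simps)
  finally have bd: "b (d - a) = \<gamma> * u a - Z * \<beta> * u (a - 1)" unfolding det using u_nonzero[OF d_pos] by simp
  have "b a * s a + b (d - a) * s (d - a) = \<beta> * hl a 2 - \<gamma> * gl a 2"
    unfolding ba bd hl_def gl_def by (simp add: algebra_simps del: cseq.simps)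
  then show ?thesis by blast
qed

text \<open>Summing the identities for the pairs over all \<open>a\<close> counts every coordinate
  twice, so the result is halved. The remaining multiple of \<open>s d\<close> comes from
  \<open>h 0\<close>.\<close>

lemma colon_ideal:
  assumes "c * (z * W) = p * u d + q * s d"
  shows "\<exists>w. \<phi>2 w 2 = c"
proof -
  obtain b q0 where b: "\<And>a. b a \<in> B" and c: "c = (\<Sum>a\<in>{1..<d}. b a * s a) + q0 * s d"
    using cseq_division[OF Z_mem(2) d_pos, of c] by blast
  have "\<forall>a\<in>{1..<d}. \<exists>\<beta> \<gamma>. b a * s a + b (d - a) * s (d - a) = \<beta> * hl a 2 - \<gamma> * gl a 2"
    using colon_coordinates[OF assms b c] by blast
  then obtain \<beta> \<gamma> where bg: "\<And>a. a \<in> {1..<d} \<Longrightarrow> b a * s a + b (d - a) * s (d - a) = \<beta> a * hl a 2 - \<gamma> a * gl a 2"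
    by metis
  obtain t :: 'a where t: "2 * t = 1" using half by blast
  have c2: "2 * c = (\<Sum>a\<in>{1..<d}. \<beta> a * hl a 2 - \<gamma> a * gl a 2) + 2 * q0 * s d"
  proof -
    have "(\<Sum>a\<in>{1..<d}. \<beta> a * hl a 2 - \<gamma> a * gl a 2) = (\<Sum>a\<in>{1..<d}. b a * s a + b (d - a) * s (d - a))"
      using bg by simp
    also have "\<dots> = 2 * (\<Sum>a\<in>{1..<d}. b a * s a)"
      using sum_reflect[of "\<lambda>a. b a * s a"] by (simp add: sum.distrib)
    finally show ?thesis by (simp add: c algebra_simps del: cseq.simps)
  qed
  define w where "w j = t * (\<Sum>a\<in>{1..<d}. \<beta> a * h a j - \<gamma> a * g a j) + q0 * h 0 j" for j
  have "\<phi>2 w 2 = t * (\<Sum>a\<in>{1..<d}. \<beta> a * \<phi>2 (h a) 2 - \<gamma> a * \<phi>2 (g a) 2) + q0 * \<phi>2 (h 0) 2"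
    unfolding w_def \<phi>2_add \<phi>2_scale \<phi>2_sum \<phi>2_diff ..
  also have "\<dots> = t * (\<Sum>a\<in>{1..<d}. \<beta> a * hl a 2 - \<gamma> a * gl a 2) + q0 * s d"
    by (simp add: \<phi>2_h \<phi>2_g \<phi>2_h_0 Ql_def del: cseq.simps h.simps)
  also have "\<dots> = t * (2 * c - 2 * q0 * s d) + q0 * s d" using c2 by simp
  also have "\<dots> = (2 * t) * c - (2 * t) * (q0 * s d) + q0 * s d" by (simp add: algebra_simps del: cseq.simps)
  finally have "\<phi>2 w 2 = c" using t by simp
  then show ?thesis by blast
qed

text \<open>The colon ideal takes care of the last coordinate. What is left is a relation between
  \<open>s d\<close> and \<open>u d\<close>, which is a multiple of the Koszul syzygy because
  \<open>u d\<close> cancels modulo \<open>s d\<close>.\<close>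

theorem exact_F1:
  assumes v: "\<phi>1 v = 0" and supp: "\<And>i. i \<ge> 3 \<Longrightarrow> v i = 0"
  shows "\<exists>w. \<phi>2 w = v"
proof -
  have "v 2 * (z * W) - ((- v 1) * u d + (- v 0) * s d) = \<phi>1 v"
    by (simp add: \<phi>1_def algebra_simps del: cseq.simps)
  then have "v 2 * (z * W) = (- v 1) * u d + (- v 0) * s d" using v by simp
  then obtain w where w: "\<phi>2 w 2 = v 2" using colon_ideal by blast
  define v0 v1 where "v0 = v 0 - \<phi>2 w 0" and "v1 = v 1 - \<phi>2 w 1"
  have "v0 * s d + v1 * u d = \<phi>1 v - \<phi>1 (\<phi>2 w)"
    unfolding v0_def v1_def \<phi>1_def w by (simp add: algebra_simps del: cseq.simps)
  then have eq: "u d * v1 = s d * (- v0)" using v \<phi>1_\<phi>2 by (simp add: algebra_simps eq_neg_iff_add_eq_0 del: cseq.simps)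
  then obtain p where p: "v1 = s d * p"
    by (rule cseq_dvd_cancel[OF Z_mem(2) d_pos u_mem u_nonzero[OF d_pos], rotated 2]) auto
  have sd: "s d \<noteq> 0" by (rule cseq_nonzero[OF Z_mem(2) d_pos])
  have "s d * (v0 + u d * p) = 0" using eq unfolding p by (simp add: algebra_simps del: cseq.simps)
  then have v0: "v0 = - (p * u d)" using sd by (simp add: eq_neg_iff_add_eq_0 mult.commute)
  have "\<phi>2 (\<lambda>j. w j - p * e (Suc m) j) i = v i" for i
  proof -
    have eq: "\<phi>2 (\<lambda>j. w j - p * e (Suc m) j) i = \<phi>2 w i - p * Kl i"
      using \<phi>2_e[of "Suc m" i] n_le_m by (simp add: \<phi>2_diff \<phi>2_scale col_def)
    have 3: "\<phi>2 w i = 0" if "i \<ge> 3"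
      using that by (auto simp: \<phi>2_def col_def gl_def hl_def Kl_def Ql_def intro!: sum.neutral)
    consider "i = 0" | "i = 1" | "i = 2" | "i \<ge> 3" by linarith
    then show ?thesis
    proof cases
      case 1 then show ?thesis using v0 unfolding eq by (simp add: Kl_def v0_def algebra_simps del: cseq.simps)
    next
      case 2 then show ?thesis using p unfolding eq by (simp add: Kl_def v1_def algebra_simps del: cseq.simps)
    next
      case 3 then show ?thesis using w unfolding eq by (simp add: Kl_def)
    next
      case 4 then show ?thesis using 3 supp unfolding eq by (simp add: Kl_def)
    qed
  qed
  then show ?thesis by blast
qed

section \<open>Second syzygies: normal forms modulo the image of \<open>\<phi>3\<close>\<close>

lemma \<phi>3_add: "\<phi>3 (\<lambda>j. v j + w j) i = \<phi>3 v i + \<phi>3 w i"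
  by (simp add: \<phi>3_def sum.distrib algebra_simps)
lemma \<phi>3_scale: "\<phi>3 (\<lambda>j. c * v j) i = c * \<phi>3 v i"
  by (simp add: \<phi>3_def sum_distrib_left algebra_simps)
lemma \<phi>3_zero: "\<phi>3 (\<lambda>_. 0) i = 0"
  by (simp add: \<phi>3_def)
lemma \<phi>3_e: "a < m \<Longrightarrow> \<phi>3 (e a) i = \<rho> (Suc a) i"
  by (simp add: \<phi>3_def e_def if_distrib[of "\<lambda>t. t * _"] cong: if_cong)

lemma \<rho>_image: assumes "0 < a" "a < d" shows "\<exists>l. \<rho> a = \<phi>3 l"
proof (cases "a \<le> m")
  case True
  then show ?thesis using \<phi>3_e[of "a - 1"] assms by (intro exI[of _ "e (a - 1)"]) (auto simp: fun_eq_iff)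
next
  case False
  then have "d - a - 1 < m" "Suc (d - a - 1) = d - a" using assms by (auto simp: m_def)
  then show ?thesis using \<phi>3_e[of "d - a - 1"] \<rho>_swap[OF assms]
    by (intro exI[of _ "e (d - a - 1)"]) (auto simp: fun_eq_iff)
qed

lemma \<phi>2_\<phi>3: "\<phi>2 (\<phi>3 l) i = 0"
proof -
  have "\<phi>2 (\<phi>3 l) i = (\<Sum>a<m. l a * \<phi>2 (\<rho> (Suc a)) i)"
    unfolding \<phi>3_def[abs_def] \<phi>2_sum \<phi>2_scale ..
  also have "\<dots> = 0"
    using d_pos by (intro sum.neutral ballI) (auto simp: m_def \<phi>2_\<rho>)
  finally show ?thesis .
qed

text \<open>Modulo the image of \<open>\<phi>3\<close> every vector has a normal form whose coefficients at all \<open>g a\<close>, \<open>h a\<close>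
  are free of \<open>x\<close>: the relations \<open>\<rho> a\<close> and the recursion for \<open>h\<close> rewrite \<open>x * g a\<close> and \<open>x * h a\<close>.\<close>

definition normal :: "(nat \<Rightarrow> 'a) set" where
  "normal = {v. \<exists>b c p k l. (\<forall>a. b a \<in> B \<and> c a \<in> B) \<and>
     (\<forall>i. v i = (\<Sum>a\<in>{1..<d}. b a * g a i + c a * h a i) + p * h 0 i + k * e (Suc m) i + \<phi>3 l i)}"

lemma normalI:
  assumes "\<And>a. b a \<in> B" "\<And>a. c a \<in> B"
    "\<And>i. v i = (\<Sum>a\<in>{1..<d}. b a * g a i + c a * h a i) + p * h 0 i + k * e (Suc m) i + \<phi>3 l i"
  shows "v \<in> normal"
  unfolding normal_def using assms by blast

lemma normal_add: assumes "v \<in> normal" "w \<in> normal" shows "(\<lambda>i. v i + w i) \<in> normal"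
proof -
  obtain b c p k l where v: "\<And>a. b a \<in> B" "\<And>a. c a \<in> B"
    "\<And>i. v i = (\<Sum>a\<in>{1..<d}. b a * g a i + c a * h a i) + p * h 0 i + k * e (Suc m) i + \<phi>3 l i"
    using assms(1) unfolding normal_def by blast
  obtain b' c' p' k' l' where w: "\<And>a. b' a \<in> B" "\<And>a. c' a \<in> B"
    "\<And>i. w i = (\<Sum>a\<in>{1..<d}. b' a * g a i + c' a * h a i) + p' * h 0 i + k' * e (Suc m) i + \<phi>3 l' i"
    using assms(2) unfolding normal_def by blast
  have S: "(\<Sum>a\<in>{1..<d}. b a * g a i + c a * h a i) + (\<Sum>a\<in>{1..<d}. b' a * g a i + c' a * h a i)
    = (\<Sum>a\<in>{1..<d}. (b a + b' a) * g a i + (c a + c' a) * h a i)" for i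
    unfolding sum.distrib[symmetric] by (intro sum.cong) (auto simp: algebra_simps)
  show ?thesis
  proof (rule normalI[of "\<lambda>a. b a + b' a" "\<lambda>a. c a + c' a" _ "p + p'" "k + k'" "\<lambda>j. l j + l' j"])
    show "v i + w i = (\<Sum>a\<in>{1..<d}. (b a + b' a) * g a i + (c a + c' a) * h a i) + (p + p') * h 0 i
      + (k + k') * e (Suc m) i + \<phi>3 (\<lambda>j. l j + l' j) i" for i
      unfolding v(3) w(3) S[symmetric] \<phi>3_add by (simp only: distrib_right ac_simps)
  qed (use v(1,2) w(1,2) in \<open>auto intro: B_add\<close>)
qed

lemma normal_scale: assumes "t \<in> B" "v \<in> normal" shows "(\<lambda>i. t * v i) \<in> normal"
proof -
  obtain b c p k l where v: "\<And>a. b a \<in> B" "\<And>a. c a \<in> B"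
    "\<And>i. v i = (\<Sum>a\<in>{1..<d}. b a * g a i + c a * h a i) + p * h 0 i + k * e (Suc m) i + \<phi>3 l i"
    using assms(2) unfolding normal_def by blast
  have S: "t * (\<Sum>a\<in>{1..<d}. b a * g a i + c a * h a i)
    = (\<Sum>a\<in>{1..<d}. (t * b a) * g a i + (t * c a) * h a i)" for i
    unfolding sum_distrib_left by (intro sum.cong) (auto simp: algebra_simps)
  show ?thesis
  proof (rule normalI[of "\<lambda>a. t * b a" "\<lambda>a. t * c a" _ "t * p" "t * k" "\<lambda>j. t * l j"])
    show "t * v i = (\<Sum>a\<in>{1..<d}. (t * b a) * g a i + (t * c a) * h a i) + (t * p) * h 0 i
      + (t * k) * e (Suc m) i + \<phi>3 (\<lambda>j. t * l j) i" for i
      unfolding v(3) S[symmetric] \<phi>3_scale by (simp only: distrib_left mult.assoc)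
  qed (use v(1,2) assms(1) in \<open>auto intro: B_mult\<close>)
qed

lemma normal_special: "(\<lambda>i. p * h 0 i + k * e (Suc m) i + \<phi>3 l i) \<in> normal"
  by (rule normalI[of "\<lambda>_. 0" "\<lambda>_. 0" _ p k l]) (auto simp: B_zero)

lemma normal_\<phi>3: "\<phi>3 l \<in> normal"
  using normal_special[of 0 0 l] by (simp add: fun_eq_iff)

lemma normal_h_0: "(\<lambda>i. p * h 0 i) \<in> normal"
  using normal_special[of p 0 "\<lambda>_. 0"] by (simp add: \<phi>3_zero)

lemma normal_e_last: "(\<lambda>i. k * e (Suc m) i) \<in> normal"
  using normal_special[of 0 k "\<lambda>_. 0"] by (simp add: \<phi>3_zero)

lemma normal_zero: "(\<lambda>_. 0) \<in> normal"
  using normal_h_0[of 0] by simp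

lemma normal_sum: "(\<And>a. a \<in> I \<Longrightarrow> f a \<in> normal) \<Longrightarrow> (\<lambda>i. \<Sum>a\<in>I. f a i) \<in> normal"
  by (induction I rule: infinite_finite_induct) (auto intro: normal_zero normal_add)

lemma normal_g: assumes "a \<le> d" shows "g a \<in> normal"
proof -
  consider "a = 0" | "a = d" | "a \<in> {1..<d}" using assms by force
  then show ?thesis
  proof cases
    case 3
    then show ?thesis
      by (intro normalI[of "\<lambda>i. if i = a then 1 else 0" "\<lambda>_. 0" _ 0 0 "\<lambda>_. 0"])
        (auto simp: B_zero B_one \<phi>3_zero if_distrib[of "\<lambda>t. t * _"] sum.delta cong: if_cong)
  next
    case 1
    then have "g a = (\<lambda>_. 0)" using g_0 by (simp add: fun_eq_iff)
    then show ?thesis using normal_zero by simp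
  next
    case 2
    then have "g a = (\<lambda>_. 0)" using g_d by (simp add: fun_eq_iff)
    then show ?thesis using normal_zero by simp
  qed
qed

lemma h_d: "h d = h 0"
  using h_swap[of 0] g_0 by (simp add: fun_eq_iff)

lemma normal_h: assumes "a \<le> d" shows "h a \<in> normal"
proof -
  have 0: "h 0 \<in> normal" using normal_h_0[of 1] by (simp only: mult_1_left)
  consider "a = 0" | "a = d" | "a \<in> {1..<d}" using assms by force
  then show ?thesis
  proof cases
    case 3
    then show ?thesis
      by (intro normalI[of "\<lambda>_. 0" "\<lambda>i. if i = a then 1 else 0" _ 0 0 "\<lambda>_. 0"])
        (auto simp: B_zero B_one \<phi>3_zero if_distrib[of "\<lambda>t. t * _"] sum.delta cong: if_cong)
  qed (use 0 h_d in auto)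
qed

lemma normal_x_g: assumes "a \<in> {1..<d}" shows "(\<lambda>i. x * g a i) \<in> normal"
proof -
  have "(\<lambda>i. x * g a i) = (\<lambda>i. (h (Suc a) i + (- 1) * h (a - 1) i) + y * g (a - 1) i)"
    using assms by (cases a) (auto simp: fun_eq_iff)
  also have "\<dots> \<in> normal"
    using assms by (intro normal_add normal_scale normal_h normal_g y_mem B_uminus B_one) auto
  finally show ?thesis .
qed

lemma normal_x_h: assumes "a \<in> {1..<d}" shows "(\<lambda>i. x * h a i) \<in> normal"
proof -
  have "0 < a" "a < d" using assms by auto
  then obtain l where l: "\<rho> a = \<phi>3 l" using \<rho>_image by blast
  have "x * h a i = (((y * h (Suc a) i + (- Z) * g (Suc a) i) + Z * g (a - 1) i) + \<kappa> a * e (Suc m) i) + \<phi>3 l i" for i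
    unfolding l[symmetric] \<rho>_def by (simp add: algebra_simps del: h.simps)
  then have "(\<lambda>i. x * h a i) = (\<lambda>i. (((y * h (Suc a) i + (- Z) * g (Suc a) i) + Z * g (a - 1) i) + \<kappa> a * e (Suc m) i) + \<phi>3 l i)"
    by blast
  also have "\<dots> \<in> normal"
    using assms by (intro normal_add normal_scale normal_h normal_g normal_e_last normal_\<phi>3[of l] y_mem Z_mem B_uminus) auto
  finally show ?thesis .
qed

lemma normal_x: assumes "v \<in> normal" shows "(\<lambda>i. x * v i) \<in> normal"
proof -
  obtain b c p k l where v: "\<And>a. b a \<in> B" "\<And>a. c a \<in> B"
    "\<And>i. v i = (\<Sum>a\<in>{1..<d}. b a * g a i + c a * h a i) + p * h 0 i + k * e (Suc m) i + \<phi>3 l i"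
    using assms unfolding normal_def by blast
  have "x * v i = (\<Sum>a\<in>{1..<d}. b a * (x * g a i) + c a * (x * h a i)) + (x * p * h 0 i + x * k * e (Suc m) i + \<phi>3 (\<lambda>j. x * l j) i)" for i
  proof -
    have "(\<Sum>a\<in>{1..<d}. b a * (x * g a i) + c a * (x * h a i)) = x * (\<Sum>a\<in>{1..<d}. b a * g a i + c a * h a i)"
      unfolding sum_distrib_left by (intro sum.cong) (auto simp: algebra_simps)
    then show ?thesis unfolding v(3) \<phi>3_scale by (simp only: distrib_left mult.assoc add.assoc)
  qed
  then have "(\<lambda>i. x * v i) = (\<lambda>i. (\<Sum>a\<in>{1..<d}. b a * (x * g a i) + c a * (x * h a i)) + (x * p * h 0 i + x * k * e (Suc m) i + \<phi>3 (\<lambda>j. x * l j) i))"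
    by blast
  also have "\<dots> \<in> normal"
    by (intro normal_add normal_sum normal_scale normal_x_g normal_x_h v normal_special)
  finally show ?thesis .
qed

lemma normal_mult: assumes "v \<in> normal" shows "(\<lambda>i. p * v i) \<in> normal"
proof -
  define D where "D = {p. \<forall>v\<in>normal. (\<lambda>i. p * v i) \<in> normal}"
  have "p \<in> UNIV" by simp
  then have "p \<in> D"
  proof (induction rule: generated_induct)
    case (add q q')
    then show ?case by (auto simp: D_def distrib_right intro: normal_add)
  next
    case (scale b q)
    then show ?case by (auto simp: D_def mult.assoc intro: normal_scale)
  next
    case (shift q)
    then show ?case by (auto simp: D_def mult.assoc intro: normal_x)
  qed (simp add: D_def)
  then show ?thesis using assms by (simp add: D_def)
qed

lemma normal_e: assumes "j < m + 2" shows "e j \<in> normal"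
proof -
  consider "j < n" | "j = m" | "j = Suc m" | "even d" "j = m - 1"
  proof (cases "even d")
    case True
    then have "m = Suc n" by (rule even_m(1))
    with assms True that show ?thesis by force
  next
    case False
    then have "m = n" by (rule odd_m(1))
    then have "j < n \<or> j = m \<or> j = Suc m" using assms by arith
    with that show ?thesis by blast
  qed
  then show ?thesis
  proof cases
    case 1
    then have "e j = g (Suc j)" by (auto simp: e_def g_def n_def fun_eq_iff)
    then show ?thesis using normal_g[of "Suc j"] 1 by (simp add: n_def)
  next
    case 2
    then show ?thesis using normal_h[of "Suc 0"] d_pos h_Suc_0 by simp
  next
    case 3
    then show ?thesis using normal_e_last[of 1] by simp
  next
    case 4
    then have "e j = h 0" by (simp add: fun_eq_iff)
    then show ?thesis using normal_h[of 0] by simp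
  qed
qed

text \<open>Every standard basis vector is some \<open>g a\<close>, some \<open>h a\<close> or the
  Koszul vector, and normal forms are closed under sums and arbitrary scalars.\<close>

lemma normal_all: assumes "\<And>i. i \<ge> m + 2 \<Longrightarrow> v i = 0" shows "v \<in> normal"
proof -
  have "v i = (\<Sum>j<m + 2. v j * e j i)" for i
    using assms[of i] by (auto simp: e_def if_distrib[of "\<lambda>t. _ * t"] sum.delta not_less simp del: sum.lessThan_Suc cong: if_cong)
  then have "v = (\<lambda>i. \<Sum>j<m + 2. v j * e j i)" by blast
  also have "\<dots> \<in> normal"
    by (intro normal_sum normal_mult normal_e) auto
  finally show ?thesis .
qed

text \<open>The coefficients \<open>b\<close> and \<open>c\<close> themselves are not determined,
  because the vectors for \<open>a\<close> and \<open>d - a\<close> are dependent. What vanishes are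
  the symmetrized coefficients \<open>\<mu>\<close> and \<open>\<tau>\<close>, which solve a
  homogeneous 2 by 2 system with determinant \<open>u d\<close>.\<close>

lemma normal_form_unique:
  assumes b: "\<And>a. b a \<in> B" and c: "\<And>a. c a \<in> B"
    and eq: "(\<Sum>a\<in>{1..<d}. b a * gl a 2 + c a * hl a 2) + p * s d = 0"
  shows "p = 0" and "(\<Sum>a\<in>{1..<d}. b a * g a i + c a * h a i) = 0"
proof -
  \<comment> \<open>The coefficient of \<open>s a\<close> after the terms with
    \<open>s (d - a)\<close> have been reindexed.\<close>
  define k where "k a = (b a - b (d - a)) * u (d - a) + c a * u (Suc d - a) - Z * c (d - a) * u (d - a - 1)" for a
  have "(\<Sum>a\<in>{1..<d}. k a * s a) = (\<Sum>a\<in>{1..<d}. b a * u (d - a) * s a + c a * u (Suc d - a) * s a)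
      - (\<Sum>a\<in>{1..<d}. b (d - a) * u (d - a) * s a + Z * c (d - a) * u (d - a - 1) * s a)"
    unfolding sum_subtractf[symmetric] by (intro sum.cong) (auto simp: k_def algebra_simps simp del: cseq.simps)
  also have "(\<Sum>a\<in>{1..<d}. b (d - a) * u (d - a) * s a + Z * c (d - a) * u (d - a - 1) * s a)
     = (\<Sum>a\<in>{1..<d}. b a * u a * s (d - a) + Z * c a * u (a - 1) * s (d - a))"
    by (subst sum_reflect[symmetric]) (auto intro!: sum.cong)
  also have "(\<Sum>a\<in>{1..<d}. b a * u (d - a) * s a + c a * u (Suc d - a) * s a) - \<dots>
    = (\<Sum>a\<in>{1..<d}. b a * gl a 2 + c a * hl a 2)"
    unfolding sum_subtractf[symmetric] by (intro sum.cong) (auto simp: gl_def hl_def algebra_simps simp del: cseq.simps)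
  finally have 0: "(\<Sum>a\<in>{1..<d}. k a * s a) + p * s d = 0" using eq by simp
  have kB: "k a \<in> B" for a unfolding k_def
    by (intro B_diff B_mult B_add b c u_mem Z_mem)
  show "p = 0" using cseq_division_unique(2)[OF Z_mem(2) d_pos kB _ 0] by simp
  have k0: "k a = 0" if "a \<in> {1..<d}" for a
    using cseq_division_unique(1)[OF Z_mem(2) d_pos kB _ 0 that] by simp
  \<comment> \<open>Adding the combination to its reflection and using \<open>g_swap\<close> and
    \<open>h_swap\<close> leaves exactly these coefficients at \<open>g a\<close> and
    \<open>h a\<close>.\<close>
  define \<mu> \<tau> where "\<mu> a = b a - b (d - a) - y * c (d - a)" and "\<tau> a = c a + c (d - a)" for a
  have rec: "u (Suc a) = y * u a - Z * u (a - 1)" if "0 < a" for a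
    using that by (cases a) auto
  have zero: "\<mu> a = 0 \<and> \<tau> a = 0" if a: "a \<in> {1..<d}" for a
  proof -
    have r1: "Z * u (d - a - 1) = y * u (d - a) - u (Suc d - a)"
      using rec[of "d - a"] a by (simp add: Suc_diff_le)
    have r2: "u (Suc a) = y * u a - Z * u (a - 1)" using rec a by auto
    have "\<mu> a * u (d - a) + \<tau> a * u (Suc d - a) =
       (b a - b (d - a)) * u (d - a) + c a * u (Suc d - a) - c (d - a) * (y * u (d - a) - u (Suc d - a))"
      unfolding \<mu>_def \<tau>_def by (simp add: algebra_simps del: cseq.simps)
    also have "\<dots> = k a" unfolding r1[symmetric] k_def by (simp add: algebra_simps del: cseq.simps)
    finally have e1: "\<mu> a * u (d - a) + \<tau> a * u (Suc d - a) = 0" using k0[OF a] by simp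
    have "- (\<mu> a * u a + \<tau> a * (Z * u (a - 1))) =
       (b (d - a) - b a) * u a + c (d - a) * (y * u a - Z * u (a - 1)) - Z * c a * u (a - 1)"
      unfolding \<mu>_def \<tau>_def by (simp add: algebra_simps del: cseq.simps)
    also have "\<dots> = k (d - a)" unfolding r2[symmetric] k_def using a by (simp add: Suc_diff_le del: cseq.simps)
    also have "\<dots> = 0" using k0[of "d - a"] a by auto
    finally have e2: "\<mu> a * u a + \<tau> a * (Z * u (a - 1)) = 0" by (simp only: neg_equal_0_iff_equal)
    have det: "u a * u (Suc d - a) - Z * u (a - 1) * u (d - a) = u d"
      using cseq_add_d[of a y] a by auto
    have "\<tau> a * u d = u a * (\<mu> a * u (d - a) + \<tau> a * u (Suc d - a)) - u (d - a) * (\<mu> a * u a + \<tau> a * (Z * u (a - 1)))"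
      unfolding det[symmetric] by (simp add: algebra_simps del: cseq.simps)
    also have "\<dots> = 0" unfolding e1 e2 by simp
    finally have t0: "\<tau> a = 0" using u_nonzero[OF d_pos] by simp
    then show ?thesis using e2 u_nonzero[of a] a by simp
  qed
  have "2 * (\<Sum>a\<in>{1..<d}. b a * g a i + c a * h a i)
      = (\<Sum>a\<in>{1..<d}. b a * g a i + c a * h a i) + (\<Sum>a\<in>{1..<d}. b (d - a) * g (d - a) i + c (d - a) * h (d - a) i)"
    unfolding sum_reflect[of "\<lambda>a. b a * g a i + c a * h a i"] by simp
  also have "\<dots> = (\<Sum>a\<in>{1..<d}. \<mu> a * g a i + \<tau> a * h a i)"
    unfolding sum.distrib[symmetric]
  proof (rule sum.cong)
    fix a assume "a \<in> {1..<d}"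
    then have gh: "g (d - a) i = - g a i" "h (d - a) i = h a i - y * g a i" using g_swap h_swap by auto
    show "b a * g a i + c a * h a i + (b (d - a) * g (d - a) i + c (d - a) * h (d - a) i) = \<mu> a * g a i + \<tau> a * h a i"
      unfolding gh \<mu>_def \<tau>_def by (simp add: algebra_simps)
  qed simp
  also have "\<dots> = 0" using zero by simp
  finally show "(\<Sum>a\<in>{1..<d}. b a * g a i + c a * h a i) = 0" by simp
qed

text \<open>In a normal form of \<open>w\<close> the last coordinate of the image forces everything
  but the Koszul term and \<open>\<phi>3 l\<close> to vanish. The first coordinate then kills the
  Koszul coefficient \<open>k\<close>.\<close>

theorem exact_F2:
  assumes ker: "\<And>i. \<phi>2 w i = 0" and supp: "\<And>i. i \<ge> m + 2 \<Longrightarrow> w i = 0"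
  shows "\<exists>l. \<phi>3 l = w"
proof -
  have "w \<in> normal" using supp by (rule normal_all)
  then obtain b c p k l where v: "\<And>a. b a \<in> B" "\<And>a. c a \<in> B"
    "\<And>i. w i = (\<Sum>a\<in>{1..<d}. b a * g a i + c a * h a i) + p * h 0 i + k * e (Suc m) i + \<phi>3 l i"
    unfolding normal_def by blast
  have "\<phi>2 (e (Suc m)) i = Kl i" for i using \<phi>2_e[of "Suc m" i] n_le_m by (simp add: col_def)
  moreover have "w = (\<lambda>i. (\<Sum>a\<in>{1..<d}. b a * g a i + c a * h a i) + p * h 0 i + k * e (Suc m) i + \<phi>3 l i)"
    using v(3) by blast
  ultimately have "\<phi>2 w i = (\<Sum>a\<in>{1..<d}. b a * \<phi>2 (g a) i + c a * \<phi>2 (h a) i) + p * Ql i + k * Kl i" for i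
    by (simp only: \<phi>2_add \<phi>2_sum \<phi>2_scale \<phi>2_\<phi>3 \<phi>2_h_0 add_0_right)
  moreover have "(\<Sum>a\<in>{1..<d}. b a * \<phi>2 (g a) i + c a * \<phi>2 (h a) i) = (\<Sum>a\<in>{1..<d}. b a * gl a i + c a * hl a i)" for i
    by (intro sum.cong) (auto simp: \<phi>2_g \<phi>2_h simp del: h.simps)
  ultimately have 0: "(\<Sum>a\<in>{1..<d}. b a * gl a i + c a * hl a i) + p * Ql i + k * Kl i = 0" for i
    using ker by simp
  have "(\<Sum>a\<in>{1..<d}. b a * gl a 2 + c a * hl a 2) + p * s d = 0"
    using 0[of 2] by (simp add: Ql_def Kl_def)
  note uniq = normal_form_unique[OF v(1,2) this]
  have E: "w i = k * e (Suc m) i + \<phi>3 l i" for i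
    unfolding v(3) uniq(2) by (simp add: uniq(1))
  then have "w = (\<lambda>i. k * e (Suc m) i + \<phi>3 l i)" by blast
  then have "\<phi>2 w 0 = k * Kl 0"
    using \<open>\<And>i. \<phi>2 (e (Suc m)) i = Kl i\<close> by (simp only: \<phi>2_add \<phi>2_scale \<phi>2_\<phi>3 add_0_right)
  then have "k = 0" using ker u_nonzero[OF d_pos] by (simp add: Kl_def)
  then show ?thesis using E by (intro exI[of _ l]) (simp add: fun_eq_iff)
qed

text \<open>By exactness, \<open>u d * e j\<close> lies in the image of \<open>\<phi>3\<close> up to the last two coordinates for each
  \<open>j < m\<close>. So the upper square block of the matrix of \<open>\<phi>3\<close> divides \<open>u d\<close> times the identity and its
  determinant is nonzero.\<close>

theorem \<phi>3_injective:
  assumes "\<And>i. \<phi>3 v i = 0" and "a < m"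
  shows "v a = 0"
proof -
  have "\<exists>l. \<forall>i<m. \<phi>3 l i = (if i = j then u d else 0)" if "j < m" for j
  proof -
    \<comment> \<open>The last coordinate of \<open>hl 1\<close> and the first one of
      \<open>Kl\<close> are both \<open>u d\<close>, so these multiples clear two coordinates of
      \<open>\<phi>2 t\<close>. The third one vanishes because \<open>\<phi>1\<close> annihilates
      \<open>col j\<close>.\<close>
    define t where "t i = u d * e j i - col j 2 * e m i - col j 0 * e (Suc m) i" for i
    have em: "\<phi>2 (e m) i = hl 1 i" "\<phi>2 (e (Suc m)) i = Kl i" "\<phi>2 (e j) i = col j i" for i
      using \<phi>2_e[of "Suc m" i] \<phi>2_e[of m i] \<phi>2_e[of j i] n_le_m that by (auto simp: col_def)
    have "\<phi>2 t i = u d * col j i - col j 2 * hl 1 i - col j 0 * Kl i" for i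
      unfolding t_def \<phi>2_diff \<phi>2_scale em ..
    moreover have "u d * col j i - col j 2 * hl 1 i - col j 0 * Kl i = 0" for i
    proof -
      have "col j 0 * s d + col j 1 * u d + col j 2 * (z * W) = 0"
        using \<phi>1_col[of j] that by (simp add: \<phi>1_def)
      moreover have "u d * col j 1 - (- (col j 2 * (z * W)) - col j 0 * s d) = col j 0 * s d + col j 1 * u d + col j 2 * (z * W)"
        by (simp add: algebra_simps)
      ultimately have 1: "u d * col j 1 = - (col j 2 * (z * W)) - col j 0 * s d" by simp
      consider "i = 0" | "i = 1" | "i = 2" | "i \<ge> 3" by linarith
      then show ?thesis
      proof cases
        case 1 then show ?thesis by (simp add: hl_def Kl_def r_def)
      next
        case 2
        have "hl 1 1 = - (z * W)" by (simp add: hl_def r_def W_def algebra_simps)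
        then show ?thesis unfolding 2 1 by (simp add: Kl_def algebra_simps)
      next
        case 3 then show ?thesis by (simp add: hl_def Kl_def)
      next
        case 4 then show ?thesis by (auto simp: hl_def Kl_def col_def gl_def Ql_def)
      qed
    qed
    ultimately have "\<phi>2 t i = 0" for i by simp
    moreover have "t i = 0" if "i \<ge> m + 2" for i using that \<open>j < m\<close> by (simp add: t_def e_def)
    ultimately obtain l where "\<phi>3 l = t" using exact_F2 by blast
    then show ?thesis by (intro exI[of _ l]) (auto simp: t_def e_def)
  qed
  then obtain l where l: "\<And>i j. i < m \<Longrightarrow> j < m \<Longrightarrow> \<phi>3 (l j) i = (if i = j then u d else 0)"
    by metis
  \<comment> \<open>\<open>M\<close> is the upper square block of the matrix of
    \<open>\<phi>3\<close>, and the columns of \<open>N\<close> are the preimages found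
    above.\<close>
  define M N where "M = Matrix.mat m m (\<lambda>(i, a). \<rho> (Suc a) i)" and "N = Matrix.mat m m (\<lambda>(a, j). l j a)"
  have "M * N = u d \<cdot>\<^sub>m 1\<^sub>m m"
  proof (rule eq_matI)
    fix i j assume "i < dim_row (u d \<cdot>\<^sub>m 1\<^sub>m m)" "j < dim_col (u d \<cdot>\<^sub>m 1\<^sub>m m)"
    then have ij: "i < m" "j < m" by auto
    then have "(M * N) $$ (i, j) = \<phi>3 (l j) i"
      by (simp add: M_def N_def scalar_prod_def \<phi>3_def lessThan_atLeast0 mult.commute)
    then show "(M * N) $$ (i, j) = (u d \<cdot>\<^sub>m 1\<^sub>m m) $$ (i, j)" using l[OF ij] ij by simp
  qed (simp_all add: M_def N_def)
  then have "Determinant.det M * Determinant.det N = u d ^ m"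
    using det_mult[of M m N] by (simp add: M_def N_def det_smult)
  then have "Determinant.det M \<noteq> 0" using u_nonzero[OF d_pos] by auto
  moreover have "M *\<^sub>v Matrix.vec m v = 0\<^sub>v m"
  proof (rule eq_vecI)
    fix i assume "i < dim_vec (0\<^sub>v m :: 'a Matrix.vec)"
    then show "(M *\<^sub>v Matrix.vec m v) $ i = 0\<^sub>v m $ i"
      using assms(1)[of i] by (simp add: M_def scalar_prod_def \<phi>3_def lessThan_atLeast0 mult.commute)
  qed (simp add: M_def)
  moreover have "Matrix.vec m v \<in> carrier_vec m" "M \<in> carrier_mat m m" by (simp_all add: M_def)
  ultimately have "Matrix.vec m v = 0\<^sub>v m"
    using det_0_iff_vec_prod_zero[of M m] by blast
  then show ?thesis using assms(2) by (metis index_vec index_zero_vec(1))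
qed

end

section \<open>Polynomials in three variables\<close>

lemma UNIV_3: "(UNIV :: 3 set) = {1, 2, 3}"
proof -
  have "card {1, 2, 3 :: 3} = CARD(3)" by simp
  then show ?thesis by (metis card_subset_eq finite subset_UNIV)
qed

lemma tdeg_eq: "tdeg t = Poly_Mapping.lookup t 1 + Poly_Mapping.lookup t 2 + Poly_Mapping.lookup t 3"
proof -
  have "(1 :: 3) \<noteq> 2" "(1 :: 3) \<noteq> 3" "(2 :: 3) \<noteq> 3" by simp_all
  then show ?thesis unfolding tdeg_def UNIV_3 by (simp only: sum.insert finite.intros insert_iff empty_iff simp_thms sum.empty add_0_right add.assoc)
qed

lemma tdeg_add: "tdeg (t + v) = tdeg t + tdeg v"
  by (simp add: tdeg_def Poly_Mapping.lookup_add sum.distrib)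

lemma tdeg_single: "tdeg (Poly_Mapping.single i k) = k"
  by (simp add: tdeg_def Poly_Mapping.lookup_single when_def)

lemma poly_mapping_sum_single:
  fixes p :: "'a \<Rightarrow>\<^sub>0 'b::comm_monoid_add"
  shows "p = (\<Sum>t\<in>Poly_Mapping.keys p. Poly_Mapping.single t (Poly_Mapping.lookup p t))"
proof (rule poly_mapping_eqI)
  fix v
  have "(\<Sum>t\<in>Poly_Mapping.keys p. Poly_Mapping.lookup (Poly_Mapping.single t (Poly_Mapping.lookup p t)) v) = (if v \<in> Poly_Mapping.keys p then Poly_Mapping.lookup p v else 0)"
    by (simp add: Poly_Mapping.lookup_single when_def)
  then show "Poly_Mapping.lookup p v = Poly_Mapping.lookup (\<Sum>t\<in>Poly_Mapping.keys p. Poly_Mapping.single t (Poly_Mapping.lookup p t)) v"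
    by (auto simp: Poly_Mapping.lookup_sum in_keys_iff)
qed

lemma poly_mapping_single_induct [case_names single add]:
  fixes p :: "'a \<Rightarrow>\<^sub>0 'b::comm_monoid_add"
  assumes "\<And>t c. P (Poly_Mapping.single t c)" and "\<And>p q. P p \<Longrightarrow> P q \<Longrightarrow> P (p + q)"
  shows "P p"
proof -
  have P0: "P 0" using assms(1)[of undefined 0] by simp
  have "P (\<Sum>t\<in>K. Poly_Mapping.single t (Poly_Mapping.lookup p t))" if "finite K" for K
    using that by (induction K) (auto simp: P0 intro!: assms)
  then show ?thesis using poly_mapping_sum_single[of p] by (metis finite_keys)
qed

lemma lookup_mult_single:
  "Poly_Mapping.lookup (p * Poly_Mapping.single v c) (t + v) = Poly_Mapping.lookup p t * (c :: complex)" for p :: mpoly3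
  by (induction p rule: poly_mapping_single_induct)
    (auto simp: Poly_Mapping.mult_single Poly_Mapping.lookup_single when_def Poly_Mapping.lookup_add distrib_right)

lemma double_mvar_power: "(2 * mvar i) ^ k = Poly_Mapping.single (Poly_Mapping.single i k) (2 ^ k)"
proof (induction k)
  case (Suc k)
  have "2 * mvar i = Poly_Mapping.single (Poly_Mapping.single i 1) 2"
    unfolding mvar_def by (metis add.left_neutral mult.right_neutral Poly_Mapping.mult_single single_numeral)
  then show ?case unfolding power_Suc Suc by (simp add: Poly_Mapping.mult_single flip: Poly_Mapping.single_add)
qed simp

text \<open>For \<open>I = {1}\<close> and \<open>I = {2, 1}\<close> these are the subrings
  \<open>\<complex>[y,z]\<close> and \<open>\<complex>[z]\<close>, kept inside the type of all
  polynomials.\<close>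

definition free_of :: "3 set \<Rightarrow> mpoly3 set" where
  "free_of I = {p. \<forall>t\<in>Poly_Mapping.keys p. \<forall>i\<in>I. Poly_Mapping.lookup t i = 0}"

lemma free_of_empty: "free_of {} = UNIV"
  by (simp add: free_of_def)

lemma free_of_zero: "0 \<in> free_of I"
  by (simp add: free_of_def)

lemma free_of_add: "p \<in> free_of I \<Longrightarrow> q \<in> free_of I \<Longrightarrow> p + q \<in> free_of I"
  using Poly_Mapping.keys_add[of p q] by (fastforce simp: free_of_def)

lemma free_of_mult: "p \<in> free_of I \<Longrightarrow> q \<in> free_of I \<Longrightarrow> p * q \<in> free_of I"
  using Poly_Mapping.keys_mult[of p q] by (fastforce simp: free_of_def Poly_Mapping.lookup_add)

lemma free_of_sum: "(\<And>k. k \<in> K \<Longrightarrow> f k \<in> free_of I) \<Longrightarrow> sum f K \<in> free_of I"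
  by (induction K rule: infinite_finite_induct) (auto intro: free_of_add free_of_zero)

lemma mvar_mem_free_of: "i \<notin> I \<Longrightarrow> mvar i \<in> free_of I"
  by (auto simp: free_of_def mvar_def Poly_Mapping.lookup_single when_def)

lemma free_of_numeral: "numeral k \<in> free_of I"
  by (auto simp: free_of_def simp flip: single_numeral)

lemma single_split:
  fixes c :: complex
  shows "Poly_Mapping.single t c = Poly_Mapping.single (Poly_Mapping.update i 0 t) (c / 2 ^ Poly_Mapping.lookup t i) * (2 * mvar i) ^ Poly_Mapping.lookup t i"
proof -
  have "Poly_Mapping.update i 0 t + Poly_Mapping.single i (Poly_Mapping.lookup t i) = t"
    by (rule poly_mapping_eqI) (auto simp: Poly_Mapping.lookup_add Poly_Mapping.lookup_update Poly_Mapping.lookup_single when_def)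
  then show ?thesis unfolding double_mvar_power by (simp add: Poly_Mapping.mult_single)
qed

text \<open>Sorting the monomials by their exponent of variable \<open>i\<close> gives the
  expansion; the coefficients absorb the powers of 2 that come from using twice the
  variable.\<close>

lemma adjunction_free_of:
  assumes "i \<notin> I"
  shows "adjunction (free_of (insert i I)) (free_of I) (2 * mvar i)"
proof
  fix p q assume pq: "p \<in> free_of I" "q \<in> free_of I"
  show "p + q \<in> free_of I" using pq by (rule free_of_add)
  show "p * q \<in> free_of I" using pq by (rule free_of_mult)
next
  fix p q assume pq: "p \<in> free_of (insert i I)" "q \<in> free_of (insert i I)"
  show "p + q \<in> free_of (insert i I)" using pq by (rule free_of_add)
  show "p * q \<in> free_of (insert i I)" using pq by (rule free_of_mult)
  show "- p \<in> free_of (insert i I)" using pq by (simp add: free_of_def in_keys_iff)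
next
  show "2 * mvar i \<in> free_of I"
    using assms by (intro free_of_mult free_of_numeral mvar_mem_free_of)
next
  fix p assume p: "p \<in> free_of I"
  define n where "n = Suc (Max (insert 0 ((\<lambda>t. Poly_Mapping.lookup t i) ` Poly_Mapping.keys p)))"
  define f where "f k = (\<Sum>t\<in>{t\<in>Poly_Mapping.keys p. Poly_Mapping.lookup t i = k}. Poly_Mapping.single (Poly_Mapping.update i 0 t) (Poly_Mapping.lookup p t / 2 ^ k))" for k
  have n: "Poly_Mapping.lookup t i < n" if "t \<in> Poly_Mapping.keys p" for t
    using that unfolding n_def by (simp add: less_Suc_eq_le Max_ge)
  have "p = (\<Sum>t\<in>Poly_Mapping.keys p. Poly_Mapping.single t (Poly_Mapping.lookup p t))" by (rule poly_mapping_sum_single)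
  also have "\<dots> = (\<Sum>k<n. \<Sum>t\<in>{t\<in>Poly_Mapping.keys p. Poly_Mapping.lookup t i = k}. Poly_Mapping.single t (Poly_Mapping.lookup p t))"
    using n by (intro sum.group[symmetric]) auto
  also have "\<dots> = (\<Sum>k<n. f k * (2 * mvar i) ^ k)"
    unfolding f_def sum_distrib_right
  proof (intro sum.cong refl)
    fix k t assume "t \<in> {t \<in> Poly_Mapping.keys p. Poly_Mapping.lookup t i = k}"
    then have k: "Poly_Mapping.lookup t i = k" by simp
    show "Poly_Mapping.single t (Poly_Mapping.lookup p t)
      = Poly_Mapping.single (Poly_Mapping.update i 0 t) (Poly_Mapping.lookup p t / 2 ^ k) * (2 * mvar i) ^ k"
      using single_split[of t "Poly_Mapping.lookup p t" i] unfolding k .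
  qed
  finally have "p = (\<Sum>k<n. f k * (2 * mvar i) ^ k)" .
  moreover have "f k \<in> free_of (insert i I)" for k
    unfolding f_def using p by (intro free_of_sum) (auto simp: free_of_def Poly_Mapping.lookup_update)
  ultimately show "\<exists>f n. (\<forall>k. f k \<in> free_of (insert i I)) \<and> p = (\<Sum>k<n. f k * (2 * mvar i) ^ k)" by blast
next
  fix f :: "nat \<Rightarrow> mpoly3" and n k assume f: "\<And>k. f k \<in> free_of (insert i I)"
    and 0: "(\<Sum>k<n. f k * (2 * mvar i) ^ k) = 0" and k: "k < n"
  show "f k = 0"
  proof (rule poly_mapping_eqI)
    fix t
    show "Poly_Mapping.lookup (f k) t = Poly_Mapping.lookup 0 t"
    proof (cases "Poly_Mapping.lookup t i = 0")
      case False
      then have "t \<notin> Poly_Mapping.keys (f k)" using f[of k] by (auto simp: free_of_def)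
      then show ?thesis by (simp add: in_keys_iff)
    next
      case True
      \<comment> \<open>No \<open>f l\<close> involves variable \<open>i\<close>, so the monomial
        \<open>v\<close> can occur only in the summand \<open>l = k\<close>, and there it carries
        the coefficient of \<open>t\<close> in \<open>f k\<close> times a power of 2.\<close>
      define v where "v = t + Poly_Mapping.single i k"
      have other: "Poly_Mapping.lookup (f l * (2 * mvar i) ^ l) v = 0" if "l \<noteq> k" for l
      proof (rule ccontr)
        assume "Poly_Mapping.lookup (f l * (2 * mvar i) ^ l) v \<noteq> 0"
        then have "v \<in> Poly_Mapping.keys (f l * (2 * mvar i) ^ l)" by (simp add: in_keys_iff)
        then obtain a where a: "a \<in> Poly_Mapping.keys (f l)" "v = a + Poly_Mapping.single i l"
          using Poly_Mapping.keys_mult[of "f l" "(2 * mvar i) ^ l"] unfolding double_mvar_power by auto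
        have "Poly_Mapping.lookup a i = 0" using f[of l] a(1) by (simp add: free_of_def)
        moreover have "Poly_Mapping.lookup (t + Poly_Mapping.single i k) i = Poly_Mapping.lookup (a + Poly_Mapping.single i l) i"
          using a(2) by (simp add: v_def)
        ultimately have "k = l" using True by (simp add: Poly_Mapping.lookup_add)
        then show False using that by simp
      qed
      have "0 = Poly_Mapping.lookup (\<Sum>l<n. f l * (2 * mvar i) ^ l) v" by (simp only: 0 Poly_Mapping.lookup_zero)
      also have "\<dots> = (\<Sum>l<n. if l = k then Poly_Mapping.lookup (f l * (2 * mvar i) ^ l) v else 0)"
        unfolding Poly_Mapping.lookup_sum using other by (intro sum.cong) auto
      also have "\<dots> = Poly_Mapping.lookup (f k * (2 * mvar i) ^ k) v" using k by simp
      also have "\<dots> = Poly_Mapping.lookup (f k) t * 2 ^ k" unfolding v_def double_mvar_power by (rule lookup_mult_single)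
      finally show ?thesis by simp
    qed
  qed
qed (auto simp: free_of_def)

section \<open>Homogeneous polynomials\<close>

lemma homog_zero: "0 \<in> homog r" by (simp add: homog_def)

lemma homog_add: "p \<in> homog r \<Longrightarrow> q \<in> homog r \<Longrightarrow> p + q \<in> homog r"
  using Poly_Mapping.keys_add[of p q] by (fastforce simp: homog_def)

lemma homog_mult: "p \<in> homog r \<Longrightarrow> q \<in> homog r' \<Longrightarrow> p * q \<in> homog (r + r')"
  using Poly_Mapping.keys_mult[of p q] by (fastforce simp: homog_def tdeg_add)

lemma homog_uminus: "p \<in> homog r \<Longrightarrow> - p \<in> homog r"
  by (simp add: homog_def in_keys_iff)

lemma homog_diff: "p \<in> homog r \<Longrightarrow> q \<in> homog r \<Longrightarrow> p - q \<in> homog r"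
  using homog_add[of p r "- q"] homog_uminus[of q] by simp

lemma homog_sum: "(\<And>k. k \<in> K \<Longrightarrow> f k \<in> homog r) \<Longrightarrow> sum f K \<in> homog r"
  by (induction K rule: infinite_finite_induct) (auto intro: homog_add homog_zero)

lemma homog_mconst: "mconst c \<in> homog 0"
  by (auto simp: homog_def mconst_def tdeg_def)

lemma homog_one: "1 \<in> homog 0"
  using homog_mconst[of 1] by (simp add: mconst_def)

lemma homog_numeral: "numeral k \<in> homog 0"
  using homog_mconst[of "numeral k"] by (simp add: mconst_def)

lemma homog_mvar: "mvar i \<in> homog 1"
  by (auto simp: homog_def mvar_def tdeg_single)

lemma homog_cseq:
  assumes "w \<in> homog 2" "v \<in> homog 1"
  shows "cseq w v k \<in> homog (int k - 1)"
  using assms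
proof (induction w v k rule: cseq.induct)
  case (3 w v k)
  have "v * cseq w v (Suc k) \<in> homog (int (Suc (Suc k)) - 1)" "w * cseq w v k \<in> homog (int (Suc (Suc k)) - 1)"
    using homog_mult[of v 1 "cseq w v (Suc k)" "int (Suc k) - 1"] homog_mult[of w 2 "cseq w v k" "int k - 1"] 3
    by (simp_all add: add.commute)
  then show ?case using homog_diff by simp
qed (auto simp: homog_zero homog_one)

section \<open>Partial derivatives and homogenization\<close>

lemma keys_superset_sum:
  assumes "finite K" "Poly_Mapping.keys p \<subseteq> K" "\<And>t. f t 0 = (0 :: 'c :: comm_monoid_add)"
  shows "(\<Sum>t\<in>Poly_Mapping.keys p. f t (Poly_Mapping.lookup p t)) = (\<Sum>t\<in>K. f t (Poly_Mapping.lookup p t))"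
  using assms by (intro sum.mono_neutral_left) (auto simp: in_keys_iff)

text \<open>Monomials may cancel in \<open>p + q\<close>, so all three sums are first extended to
  the union of the keys. Both \<open>partial_deriv\<close> and \<open>homogenize\<close> are sums of
  this shape.\<close>

lemma keys_sum_add:
  assumes "\<And>t. f t 0 = (0 :: 'c :: comm_monoid_add)" "\<And>t a b. f t (a + b) = f t a + f t b"
  shows "(\<Sum>t\<in>Poly_Mapping.keys (p + q). f t (Poly_Mapping.lookup (p + q) t)) = (\<Sum>t\<in>Poly_Mapping.keys p. f t (Poly_Mapping.lookup p t)) + (\<Sum>t\<in>Poly_Mapping.keys q. f t (Poly_Mapping.lookup q t))"
proof -
  have K: "finite (Poly_Mapping.keys p \<union> Poly_Mapping.keys q)" "Poly_Mapping.keys (p + q) \<subseteq> Poly_Mapping.keys p \<union> Poly_Mapping.keys q"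
    using Poly_Mapping.keys_add[of p q] by auto
  show ?thesis
    unfolding keys_superset_sum[where f = f, OF K assms(1)] keys_superset_sum[where f = f, OF K(1) Un_upper1 assms(1)]
      keys_superset_sum[where f = f, OF K(1) Un_upper2 assms(1)]
    by (simp add: Poly_Mapping.lookup_add assms(2) sum.distrib)
qed

lemma partial_deriv_add: "partial_deriv i (p + q) = partial_deriv i p + partial_deriv i q"
  unfolding partial_deriv_def by (rule keys_sum_add) (auto simp: distrib_left Poly_Mapping.single_add)

lemma partial_deriv_single:
  "partial_deriv i (Poly_Mapping.single t c)
     = Poly_Mapping.single (t - Poly_Mapping.single i 1) (of_nat (Poly_Mapping.lookup t i) * c)"
  by (simp add: partial_deriv_def)

lemma partial_deriv_uminus: "partial_deriv i (- p) = - partial_deriv i p"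
  using partial_deriv_add[of i p "- p"] by (simp add: partial_deriv_def eq_neg_iff_add_eq_0 add.commute)

lemma partial_deriv_diff: "partial_deriv i (p - q) = partial_deriv i p - partial_deriv i q"
  using partial_deriv_add[of i p "- q"] partial_deriv_uminus[of i q] by simp

lemma partial_deriv_double: "partial_deriv i (2 * p) = 2 * partial_deriv i p"
  using partial_deriv_add[of i p p] by (simp only: mult_2)

text \<open>The Leibniz rule for a variable as one factor, which is the case arising in the
  Chebyshev recursion.\<close>

lemma partial_deriv_mvar_mult:
  "partial_deriv i (mvar j * p) = mvar j * partial_deriv i p + (if i = j then p else 0)"
proof (induction p rule: poly_mapping_single_induct)
  case (single t c)
  \<comment> \<open>Subtraction of exponents is truncated, so it commutes with adding a variable
    only for a positive exponent. For exponent zero the coefficient vanishes instead.\<close>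
  have shift: "Poly_Mapping.single j 1 + t - Poly_Mapping.single i 1 = Poly_Mapping.single j 1 + (t - Poly_Mapping.single i 1)"
    if "Poly_Mapping.lookup t i \<noteq> 0"
    using that by (intro poly_mapping_eqI) (auto simp: Poly_Mapping.lookup_add Poly_Mapping.lookup_minus Poly_Mapping.lookup_single when_def)
  have "partial_deriv i (mvar j * Poly_Mapping.single t c)
      = Poly_Mapping.single (Poly_Mapping.single j 1 + t - Poly_Mapping.single i 1) (of_nat (Poly_Mapping.lookup (Poly_Mapping.single j 1 + t) i) * c)"
    by (simp add: mvar_def Poly_Mapping.mult_single partial_deriv_single)
  also have "\<dots> = Poly_Mapping.single (Poly_Mapping.single j 1 + t - Poly_Mapping.single i 1) (of_nat (Poly_Mapping.lookup t i) * c)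
     + (if i = j then Poly_Mapping.single t c else 0)"
    by (auto simp: Poly_Mapping.lookup_add Poly_Mapping.lookup_single distrib_right Poly_Mapping.single_add when_def)
  also have "Poly_Mapping.single (Poly_Mapping.single j 1 + t - Poly_Mapping.single i 1) (of_nat (Poly_Mapping.lookup t i) * c)
     = mvar j * partial_deriv i (Poly_Mapping.single t c)"
    using shift by (cases "Poly_Mapping.lookup t i = 0") (auto simp: partial_deriv_single mvar_def Poly_Mapping.mult_single)
  finally show ?case .
qed (auto simp: partial_deriv_add distrib_left)

lemma homogenize_add: "homogenize n (p + q) = homogenize n p + homogenize n q"
  unfolding homogenize_def by (rule keys_sum_add) (auto simp: Poly_Mapping.single_add)

lemma homogenize_single:
  "homogenize n (Poly_Mapping.single t c) = Poly_Mapping.single (t + Poly_Mapping.single 3 (n - tdeg t)) c"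
  by (simp add: homogenize_def)

lemma homogenize_uminus: "homogenize n (- p) = - homogenize n p"
  using homogenize_add[of n p "- p"] by (simp add: homogenize_def eq_neg_iff_add_eq_0 add.commute)

lemma homogenize_diff: "homogenize n (p - q) = homogenize n p - homogenize n q"
  using homogenize_add[of n p "- q"] homogenize_uminus[of n q] by simp

lemma homogenize_double: "homogenize n (2 * p) = 2 * homogenize n p"
  using homogenize_add[of n p p] by (simp only: mult_2)

lemma homogenize_mvar_mult: "homogenize (Suc n) (mvar i * p) = mvar i * homogenize n p"
  by (induction p rule: poly_mapping_single_induct)
    (auto simp: homogenize_add distrib_left mvar_def Poly_Mapping.mult_single homogenize_single tdeg_add tdeg_single add.assoc)

text \<open>The degree bound keeps the exponent \<open>n - tdeg t\<close> from being truncated, so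
  two more degrees mean a factor of the square of the third variable.\<close>

lemma homogenize_raise:
  assumes "\<And>t. t \<in> Poly_Mapping.keys p \<Longrightarrow> tdeg t \<le> n"
  shows "homogenize (Suc (Suc n)) p = mvar 3 * mvar 3 * homogenize n p"
proof -
  have "mvar 3 * mvar 3 * Poly_Mapping.single (t + Poly_Mapping.single 3 (n - tdeg t)) c
      = Poly_Mapping.single (t + Poly_Mapping.single 3 (Suc (Suc n) - tdeg t)) c" if "t \<in> Poly_Mapping.keys p" for t c
  proof -
    have "Suc (Suc n) - tdeg t = 1 + (1 + (n - tdeg t))" using assms[OF that] by simp
    then show ?thesis by (simp only: mvar_def Poly_Mapping.mult_single Poly_Mapping.single_add) (simp add: ac_simps)
  qed
  then show ?thesis by (simp add: homogenize_def sum_distrib_left)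
qed

section \<open>The partial derivatives of the Chebyshev form\<close>

fun cheb_real :: "nat \<Rightarrow> real poly" where
  "cheb_real 0 = 1"
| "cheb_real (Suc 0) = [:0, 1:]"
| "cheb_real (Suc (Suc n)) = pCons 0 (cheb_real (Suc n)) + pCons 0 (cheb_real (Suc n)) - cheb_real n"

lemma poly_cheb_real: "poly (cheb_real n) (cos t) = cos (real n * t)"
proof (induction n rule: cheb_real.induct)
  case (3 n)
  have "cos (real (Suc (Suc n)) * t) + cos (real n * t) = 2 * cos t * cos (real (Suc n) * t)"
  proof -
    have "real (Suc (Suc n)) * t = real (Suc n) * t + t" "real n * t = real (Suc n) * t - t"
      by (simp_all add: algebra_simps)
    then show ?thesis by (simp only: cos_add cos_diff) simp
  qed
  then show ?case using 3 by (simp add: algebra_simps)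
qed auto

lemma degree_cheb_real: "degree (cheb_real n) = n"
proof -
  have "degree (cheb_real n) \<le> n \<and> coeff (cheb_real n) n > 0"
  proof (induction n rule: cheb_real.induct)
    case (3 n)
    let ?p = "cheb_real (Suc n)" and ?q = "cheb_real n"
    have "degree (pCons 0 ?p) \<le> Suc (Suc n)" "degree ?q \<le> Suc (Suc n)"
      using 3 degree_pCons_le[of 0 ?p] by linarith+
    then have "degree (cheb_real (Suc (Suc n))) \<le> Suc (Suc n)"
      by (simp only: cheb_real.simps) (intro degree_diff_le degree_add_le)
    moreover have "coeff ?q (Suc (Suc n)) = 0" using 3 by (intro coeff_eq_0) auto
    ultimately show ?case
      using 3 by (simp only: cheb_real.simps coeff_add coeff_diff coeff_pCons_Suc) simp
  qed auto
  then show ?thesis by (simp add: antisym le_degree)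
qed

text \<open>The description determines the polynomial because two candidates agree on the infinite
  set \<open>{-1..1}\<close>.\<close>

lemma chebyshev_eq: "chebyshev d = cheb_real d"
  unfolding chebyshev_def
proof (rule the_equality)
  show "degree (cheb_real d) = d \<and> (\<forall>x\<in>{-1..1}. poly (cheb_real d) x = cos (real d * arccos x))"
  proof (intro conjI ballI degree_cheb_real)
    fix x :: real assume "x \<in> {-1..1}"
    then show "poly (cheb_real d) x = cos (real d * arccos x)"
      using poly_cheb_real[of d "arccos x"] by simp
  qed
  fix p assume p: "degree p = d \<and> (\<forall>x\<in>{-1..1}. poly p x = cos (real d * arccos x))"
  have "poly (p - cheb_real d) x = 0" if "x \<in> {-1..1}" for x
    using p that poly_cheb_real[of d "arccos x"] by simp
  then have "{-1..1} \<subseteq> {x. poly (p - cheb_real d) x = 0}" by blast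
  moreover have "infinite {-1..1::real}" by (simp add: infinite_Icc)
  ultimately have "infinite {x. poly (p - cheb_real d) x = 0}" using infinite_super by blast
  then have "p - cheb_real d = 0" using poly_roots_finite by blast
  then show "p = cheb_real d" by simp
qed

text \<open>The recursion of the first kind with a weight: \<open>w = 1\<close> gives the values of
  the Chebyshev polynomials, \<open>w\<close> the square of the third variable gives their
  homogenizations.\<close>

fun tseq :: "'a::comm_ring_1 \<Rightarrow> 'a \<Rightarrow> nat \<Rightarrow> 'a" where
  "tseq w x 0 = 1"
| "tseq w x (Suc 0) = x"
| "tseq w x (Suc (Suc n)) = x * tseq w x (Suc n) + x * tseq w x (Suc n) - w * tseq w x n"

lemma chebyshev_at_eq: "chebyshev_at d q = tseq 1 q d"
proof -
  define F where "F = map_poly (\<lambda>c. mconst (of_real c))"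
  have c: "mconst 0 = 0" "mconst 1 = 1" "mconst (a + b) = mconst a + mconst b"
    "mconst (a - b) = mconst a - mconst b" for a b
    by (auto simp: mconst_def Poly_Mapping.single_add Poly_Mapping.single_diff)
  have F: "F (p + q) = F p + F q" "F (p - q) = F p - F q" "F (pCons 0 p) = pCons 0 (F p)" for p q
    by (auto simp: F_def poly_eq_iff coeff_map_poly c coeff_pCons split: nat.split)
  have F_double: "F (2 * p) = 2 * F p" for p using F(1)[of p p] by (simp only: mult_2)
  have F1: "F 1 = 1" "F [:1:] = 1" "F [:0, 1:] = [:0, 1:]"
    by (auto simp: F_def poly_eq_iff coeff_map_poly c coeff_pCons split: nat.split)
  have "poly (F (cheb_real d)) q = tseq 1 q d"
    by (induction d rule: cheb_real.induct) (simp_all add: F F1 F_double)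
  then show ?thesis by (simp add: chebyshev_at_def chebyshev_eq F_def)
qed

definition bounded_deg :: "nat \<Rightarrow> mpoly3 set" where
  "bounded_deg n = {p. \<forall>t\<in>Poly_Mapping.keys p. tdeg t \<le> n}"

lemma bounded_deg_add: "p \<in> bounded_deg n \<Longrightarrow> q \<in> bounded_deg n \<Longrightarrow> p + q \<in> bounded_deg n"
  using Poly_Mapping.keys_add[of p q] by (fastforce simp: bounded_deg_def)

lemma bounded_deg_tseq: "tseq 1 (mvar i) n \<in> bounded_deg n"
proof (induction n rule: nat_less_induct)
  case (1 n)
  consider "n = 0" | "n = 1" | k where "n = Suc (Suc k)"
    by (metis One_nat_def not0_implies_Suc)
  then show ?case
  proof cases
    case 1 then show ?thesis by (simp add: bounded_deg_def tdeg_def)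
  next
    case 2 then show ?thesis by (simp add: bounded_deg_def mvar_def tdeg_single)
  next
    case 3
    have "mvar i * tseq 1 (mvar i) (Suc k) \<in> bounded_deg n"
      using 1[rule_format, of "Suc k"] 3 keys_mult[of "mvar i" "tseq 1 (mvar i) (Suc k)"]
      by (fastforce simp: bounded_deg_def mvar_def tdeg_single tdeg_add)
    moreover have "- tseq 1 (mvar i) k \<in> bounded_deg n"
      using 1[rule_format, of k] 3 by (fastforce simp: bounded_deg_def in_keys_iff)
    ultimately have "(mvar i * tseq 1 (mvar i) (Suc k) + mvar i * tseq 1 (mvar i) (Suc k)) + - tseq 1 (mvar i) k \<in> bounded_deg n"
      by (intro bounded_deg_add)
    then show ?thesis using 3 by simp
  qed
qed

text \<open>In the recursion the term \<open>tseq 1 (mvar i) k\<close> lags two degrees behind, so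
  homogenizing it replaces the weight 1 by the square of the third variable.\<close>

lemma homogenize_tseq: "homogenize n (tseq 1 (mvar i) n) = tseq (mvar 3 * mvar 3) (mvar i) n"
proof (induction n rule: nat_less_induct)
  case (1 n)
  consider "n = 0" | "n = 1" | k where "n = Suc (Suc k)"
    by (metis One_nat_def not0_implies_Suc)
  then show ?case
  proof cases
    case 1
    have "homogenize 0 (Poly_Mapping.single 0 1) = Poly_Mapping.single 0 1"
      by (simp only: homogenize_single) (simp add: tdeg_def)
    then show ?thesis using 1 by simp
  next
    case 2
    have "homogenize 1 (mvar i) = mvar i" unfolding mvar_def
      by (simp only: homogenize_single tdeg_single) simp
    then show ?thesis using 2 by simp
  next
    case 3
    have "homogenize (Suc (Suc k)) (tseq 1 (mvar i) k) = mvar 3 * mvar 3 * homogenize k (tseq 1 (mvar i) k)"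
      using bounded_deg_tseq[of i k] by (intro homogenize_raise) (simp add: bounded_deg_def)
    then show ?thesis using 1[rule_format, of k] 1[rule_format, of "Suc k"] 3
      by (simp add: homogenize_add homogenize_double homogenize_diff homogenize_mvar_mult)
  qed
qed

lemma chebyshev_form_eq:
  "chebyshev_form d = tseq (mvar 3 * mvar 3) (mvar 1) d + tseq (mvar 3 * mvar 3) (mvar 2) d"
  by (simp add: chebyshev_form_def chebyshev_at_eq homogenize_add homogenize_tseq)

text \<open>The homogenized form of \<open>2 T_k = U_k - U_(k-2)\<close> for
  \<open>k = n + 1\<close>, with the index shift of \<open>cseq\<close>.\<close>

lemma tseq_cseq: "2 * tseq w x (Suc n) = cseq w (2 * x) (Suc (Suc n)) - w * cseq w (2 * x) n"
proof (induction n rule: nat_less_induct)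
  case (1 n)
  consider "n = 0" | "n = 1" | k where "n = Suc (Suc k)"
    by (metis One_nat_def not0_implies_Suc)
  then show ?case
  proof cases
    case 3
    have "2 * tseq w x (Suc n) = 2 * x * (2 * tseq w x (Suc (Suc k))) - w * (2 * tseq w x (Suc k))"
      using 3 by (simp add: algebra_simps)
    also have "\<dots> = 2 * x * (cseq w (2 * x) (Suc (Suc (Suc k))) - w * cseq w (2 * x) (Suc k))
        - w * (cseq w (2 * x) (Suc (Suc k)) - w * cseq w (2 * x) k)"
      using 1[rule_format, of "Suc k"] 1[rule_format, of k] 3 by simp
    also have "\<dots> = cseq w (2 * x) (Suc (Suc n)) - w * cseq w (2 * x) n"
      unfolding 3 by (simp add: algebra_simps)
    finally show ?thesis .
  qed (auto simp: algebra_simps)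
qed

section \<open>Derivatives of the homogenized Chebyshev polynomials\<close>

lemma partial_deriv_one: "partial_deriv i 1 = 0"
  using partial_deriv_single[of i 0 1] by simp

lemma partial_deriv_mvar: "partial_deriv i (mvar j) = (if i = j then 1 else 0)"
  using partial_deriv_mvar_mult[of i j 1] by (simp add: partial_deriv_one)

abbreviation cheb_U :: "3 \<Rightarrow> nat \<Rightarrow> mpoly3" where
  "cheb_U i \<equiv> cseq (mvar 3 * mvar 3) (2 * mvar i)"

lemma partial_deriv_tseq_other:
  assumes "j \<noteq> i" "j \<noteq> 3"
  shows "partial_deriv j (tseq (mvar 3 * mvar 3) (mvar i) n) = 0"
proof (induction n rule: nat_less_induct)
  case (1 n)
  consider "n = 0" | "n = 1" | k where "n = Suc (Suc k)"
    by (metis One_nat_def not0_implies_Suc)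
  then show ?case
    using assms 1[rule_format]
    by cases (simp_all add: partial_deriv_one partial_deriv_mvar partial_deriv_add partial_deriv_diff partial_deriv_double partial_deriv_mvar_mult mult.assoc)
qed

text \<open>The homogenized form of \<open>T_n' = n U_(n-1)\<close>. The Leibniz rule leaves a term
  of the first kind, which \<open>tseq_cseq\<close> converts to the second kind.\<close>

lemma partial_deriv_tseq_self:
  assumes "i \<noteq> 3"
  shows "partial_deriv i (tseq (mvar 3 * mvar 3) (mvar i) n) = of_nat n * cheb_U i n"
proof (induction n rule: nat_less_induct)
  case (1 n)
  consider "n = 0" | "n = 1" | k where "n = Suc (Suc k)"
    by (metis One_nat_def not0_implies_Suc)
  then show ?case
  proof cases
    case 3
    let ?t = "tseq (mvar 3 * mvar 3) (mvar i)"
    have "partial_deriv i (?t n) = 2 * (mvar i * partial_deriv i (?t (Suc k))) + 2 * ?t (Suc k)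
        - mvar 3 * mvar 3 * partial_deriv i (?t k)"
      using 3 assms by (simp add: partial_deriv_add partial_deriv_diff partial_deriv_double partial_deriv_mvar_mult mult.assoc)
    also have "\<dots> = 2 * (mvar i * (of_nat (Suc k) * cheb_U i (Suc k)))
        + (cheb_U i (Suc (Suc k)) - mvar 3 * mvar 3 * cheb_U i k) - mvar 3 * mvar 3 * (of_nat k * cheb_U i k)"
      using 1[rule_format, of "Suc k"] 1[rule_format, of k] 3 tseq_cseq[of "mvar 3 * mvar 3" "mvar i" k] by simp
    also have "\<dots> = of_nat n * cheb_U i n"
      unfolding 3 by (simp add: algebra_simps)
    finally show ?thesis .
  qed (auto simp: partial_deriv_one partial_deriv_mvar)
qed

text \<open>The third variable enters only through the weight, whose derivative supplies the factor
  \<open>mvar 3\<close>. For \<open>n \<le> 1\<close> the index \<open>n - 1\<close> is 0 and both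
  sides vanish.\<close>

lemma partial_deriv_tseq_3:
  assumes "i \<noteq> 3"
  shows "partial_deriv 3 (tseq (mvar 3 * mvar 3) (mvar i) n) = - of_nat n * (mvar 3 * cheb_U i (n - 1))"
proof (induction n rule: nat_less_induct)
  case (1 n)
  let ?t = "tseq (mvar 3 * mvar 3) (mvar i)"
  have rec: "partial_deriv 3 (?t (Suc (Suc k))) = 2 * (mvar i * partial_deriv 3 (?t (Suc k)))
        - mvar 3 * mvar 3 * partial_deriv 3 (?t k) - mvar 3 * (2 * ?t k)" for k
    using assms by (simp add: partial_deriv_add partial_deriv_diff partial_deriv_double partial_deriv_mvar_mult algebra_simps)
  consider "n = 0" | "n = 1" | "n = 2" | k where "n = Suc (Suc (Suc k))"
    by (metis One_nat_def not0_implies_Suc numeral_2_eq_2)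
  then show ?case
  proof cases
    case 3
    then show ?thesis using rec[of 0] assms by (simp add: numeral_2_eq_2 partial_deriv_one partial_deriv_mvar)
  next
    case 4
    have h: "partial_deriv 3 (?t (Suc (Suc k))) = - of_nat (Suc (Suc k)) * (mvar 3 * cheb_U i (Suc k))"
      "partial_deriv 3 (?t (Suc k)) = - of_nat (Suc k) * (mvar 3 * cheb_U i k)"
      using 1[rule_format, of "Suc (Suc k)"] 1[rule_format, of "Suc k"] 4 by (simp_all del: tseq.simps cseq.simps of_nat_Suc)
    have "partial_deriv 3 (?t n) = 2 * (mvar i * (- of_nat (Suc (Suc k)) * (mvar 3 * cheb_U i (Suc k))))
        - mvar 3 * mvar 3 * (- of_nat (Suc k) * (mvar 3 * cheb_U i k))
        - mvar 3 * (cheb_U i (Suc (Suc k)) - mvar 3 * mvar 3 * cheb_U i k)"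
      unfolding 4 rec[of "Suc k"] tseq_cseq h ..
    also have "\<dots> = - of_nat n * (mvar 3 * cheb_U i (n - 1))"
      unfolding 4 by (simp add: algebra_simps)
    finally show ?thesis .
  qed (use assms in \<open>auto simp: partial_deriv_one partial_deriv_mvar\<close>)
qed

lemma partial_deriv_chebyshev_form:
  "partial_deriv 1 (chebyshev_form d) = of_nat d * cheb_U 1 d"
  "partial_deriv 2 (chebyshev_form d) = of_nat d * cheb_U 2 d"
  "partial_deriv 3 (chebyshev_form d) = - of_nat d * (mvar 3 * (cheb_U 1 (d - 1) + cheb_U 2 (d - 1)))"
  unfolding chebyshev_form_eq partial_deriv_add
  by (simp_all add: partial_deriv_tseq_other partial_deriv_tseq_self partial_deriv_tseq_3 distrib_left)

section \<open>Dimensions of graded pieces\<close>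

text \<open>The ambient space of polynomial vectors is infinite-dimensional, so finite dimension is
  treated as a property of subspaces.\<close>

locale vector_space_fin_dim = vector_space
begin

definition fin_dim :: "'b set \<Rightarrow> bool" where
  "fin_dim V \<longleftrightarrow> subspace V \<and> (\<exists>T. finite T \<and> V \<subseteq> span T)"

section \<open>Linear algebra with finite-dimensional subspaces\<close>

lemma fin_dim_basis:
  assumes "fin_dim V"
  obtains C where "finite C" "independent C" "span C = V" "card C = dim V"
proof -
  obtain T where T: "finite T" "V \<subseteq> span T" and V: "subspace V" using assms by (auto simp: fin_dim_def)
  obtain C where C: "C \<subseteq> V" "independent C" "V \<subseteq> span C" "card C = dim V" by (rule basis_exists)
  have "finite C" using independent_span_bound[OF T(1) C(2)] C(1) T(2) by blast
  moreover have "span C = V" using C V by (simp add: span_minimal subset_antisym)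
  ultimately show ?thesis using that C by blast
qed

lemma fin_dim_span: "finite T \<Longrightarrow> fin_dim (span T)"
  by (auto simp: fin_dim_def)

lemma fin_dim_subset: "fin_dim V \<Longrightarrow> subspace U \<Longrightarrow> U \<subseteq> V \<Longrightarrow> fin_dim U"
  by (auto simp: fin_dim_def)

text \<open>Applying \<open>L\<close> to a vanishing combination removes the part from
  \<open>K\<close> and forces the coefficients on \<open>C\<close> to be zero; independence of
  \<open>K\<close> does the rest.\<close>

lemma independent_union_lift:
  assumes add: "\<And>u v. L (u + v) = L u + L v" and scale: "\<And>c v. L (scale c v) = scale c (L v)"
    and K: "finite K" "independent K" "\<And>k. k \<in> K \<Longrightarrow> L k = 0"
    and C: "finite C" "independent (L ` C)" "inj_on L C"
  shows "independent (K \<union> C)" "K \<inter> C = {}"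
proof -
  have L0: "L 0 = 0" using scale[of 0 0] by simp
  show disj: "K \<inter> C = {}" using C(2) K(3) dependent_zero[of "L ` C"] by (metis disjoint_iff image_eqI)
  have sum: "L (\<Sum>v\<in>I. g v) = (\<Sum>v\<in>I. L (g v))" for g :: "'b \<Rightarrow> 'b" and I
    by (induction I rule: infinite_finite_induct) (auto simp: L0 add)
  show "independent (K \<union> C)"
  proof (rule independent_if_scalars_zero)
    show "finite (K \<union> C)" using K C by simp
    fix g v assume 0: "(\<Sum>v\<in>K \<union> C. scale (g v) v) = 0" and v: "v \<in> K \<union> C"
    have split: "(\<Sum>v\<in>K. scale (g v) v) + (\<Sum>v\<in>C. scale (g v) v) = 0"
      using 0 sum.union_disjoint[OF K(1) C(1) disj, of "\<lambda>v. scale (g v) v"] by simp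
    have "L ((\<Sum>v\<in>K. scale (g v) v) + (\<Sum>v\<in>C. scale (g v) v)) = (\<Sum>v\<in>C. scale (g v) (L v))"
      using K(3) by (simp add: add sum scale)
    then have "(\<Sum>v\<in>C. scale (g v) (L v)) = 0" by (simp add: split L0)
    then have "(\<Sum>w\<in>L ` C. scale (g (inv_into C L w)) w) = 0"
      using C(3) by (simp add: sum.reindex)
    then have "g (inv_into C L w) = 0" if "w \<in> L ` C" for w
      using independentD[OF C(2) _ subset_refl, of "\<lambda>w. g (inv_into C L w)"] that C(1) by auto
    then have gC: "g v = 0" if "v \<in> C" for v using that C(3) by (metis image_eqI inv_into_f_f)
    then have "(\<Sum>v\<in>K. scale (g v) v) = 0" using split by simp
    then have "g v = 0" if "v \<in> K" for v using independentD[OF K(2,1) subset_refl] that by blast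
    then show "g v = 0" using gC v by blast
  qed
qed

text \<open>Finite dimension of \<open>V\<close> is a conclusion here, which lets the dimension of a
  free module be built up one summand at a time.\<close>

lemma rank_nullity:
  assumes add: "\<And>u v. L (u + v) = L u + L v" and scale: "\<And>c v. L (scale c v) = scale c (L v)"
    and V: "subspace V" and ker: "fin_dim {v \<in> V. L v = 0}" and im: "fin_dim (L ` V)"
  shows "fin_dim V" "dim V = dim {v \<in> V. L v = 0} + dim (L ` V)"
proof -
  have diff: "L (u - v) = L u - L v" for u v using add[of "u - v" v] by simp
  obtain K where K: "finite K" "independent K" "span K = {v \<in> V. L v = 0}" "card K = dim {v \<in> V. L v = 0}"
    using fin_dim_basis[OF ker] .
  obtain D where D: "finite D" "independent D" "span D = L ` V" "card D = dim (L ` V)"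
    using fin_dim_basis[OF im] .
  \<comment> \<open>Chosen preimages of a basis of the image complete a basis of the kernel to one
    of \<open>V\<close>.\<close>
  define f where "f = inv_into V L"
  have f: "f w \<in> V" "L (f w) = w" if "w \<in> D" for w
    using that span_base[of w D] D(3) by (auto simp: f_def inv_into_into f_inv_into_f)
  define C where "C = f ` D"
  have LC: "L ` C = D" using f by (auto simp: C_def image_image)
  have inj: "inj_on L C" using f by (auto simp: C_def inj_on_def)
  have CV: "C \<subseteq> V" using f by (auto simp: C_def)
  have Lk: "L k = 0" if "k \<in> K" for k using span_base[OF that] K(3) by auto
  have ind: "independent (K \<union> C)" "K \<inter> C = {}"
    using independent_union_lift[OF add scale K(1,2) Lk, of C] D inj LC by (auto simp: C_def)
  have sum: "L (\<Sum>v\<in>I. g v) = (\<Sum>v\<in>I. L (g v))" for g :: "'b \<Rightarrow> 'b" and I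
    using scale[of 0 0] by (induction I rule: infinite_finite_induct) (auto simp: add)
  have span: "span (K \<union> C) = V"
  proof
    show "span (K \<union> C) \<subseteq> V"
      using CV K(3) V span_superset[of K] by (intro span_minimal) auto
    show "V \<subseteq> span (K \<union> C)"
    proof
      fix v assume v: "v \<in> V"
      then have "L v \<in> span D" using D(3) by auto
      then obtain g where g: "L v = (\<Sum>w\<in>D. scale (g w) w)" using span_finite[OF D(1)] by auto
      define w where "w = (\<Sum>c\<in>D. scale (g c) (f c))"
      have "L w = L v" unfolding w_def g sum scale using f by simp
      moreover have "w \<in> V" unfolding w_def using f V by (auto intro!: subspace_sum subspace_scale)
      ultimately have "v - w \<in> span K" using v V K(3) diff by (auto simp: subspace_diff)
      moreover have "w \<in> span C" unfolding w_def C_def by (intro span_sum span_scale span_base) auto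
      ultimately have "(v - w) + w \<in> span (K \<union> C)"
        by (intro span_add) (auto intro: span_mono[THEN subsetD])
      then show "v \<in> span (K \<union> C)" by simp
    qed
  qed
  show "fin_dim V" using span fin_dim_span[of "K \<union> C"] K(1) D(1) by (simp add: C_def)
  have "card C = card D" using card_image[OF inj] LC by simp
  moreover have "dim V = card (K \<union> C)"
    using dim_span_eq_card_independent[OF ind(1)] unfolding span .
  ultimately show "dim V = dim {v \<in> V. L v = 0} + dim (L ` V)"
    using card_Un_disjoint[of K C] ind(2) K D by (simp add: C_def)
qed

lemma fin_dim_image:
  assumes add: "\<And>u v. L (u + v) = L u + L v" and scale: "\<And>c v. L (scale c v) = scale c (L v)" and V: "fin_dim V"
  shows "fin_dim (L ` V)"
proof -
  obtain C where C: "finite C" "span C = V" using fin_dim_basis[OF V] by blast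
  interpret L: Vector_Spaces.linear scale scale L
    by unfold_locales (auto simp: add scale)
  have "L ` V = span (L ` C)" using C(2) L.span_image by metis
  then show ?thesis using C(1) by (simp add: fin_dim_span)
qed

lemma rank_nullity_fin_dim:
  assumes add: "\<And>u v. L (u + v) = L u + L v" and scale: "\<And>c v. L (scale c v) = scale c (L v)"
    and V: "fin_dim V"
  shows "dim V = dim {v \<in> V. L v = 0} + dim (L ` V)"
proof -
  have sV: "subspace V" using V by (simp add: fin_dim_def)
  have "L 0 = 0" using scale[of 0 0] by simp
  then have "subspace {v \<in> V. L v = 0}" using sV by (auto simp: subspace_def add scale)
  then show ?thesis using rank_nullity(2)[OF add scale sV fin_dim_subset[OF V]] fin_dim_image[OF add scale V] by blast
qed

text \<open>A basis of \<open>H\<close> modulo \<open>U\<close>, phrased by representatives because the graded pieces of the quotient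
  ring do not form a type.\<close>

definition basis_modulo :: "'b set \<Rightarrow> 'b set \<Rightarrow> 'b set \<Rightarrow> bool" where
  "basis_modulo U H R \<longleftrightarrow> finite R \<and> R \<subseteq> H \<and>
     (\<forall>v\<in>H. \<exists>c. v - (\<Sum>r\<in>R. scale (c r) r) \<in> U) \<and>
     (\<forall>c. (\<Sum>r\<in>R. scale (c r) r) \<in> U \<longrightarrow> (\<forall>r\<in>R. c r = 0))"

text \<open>Together with a basis of \<open>U\<close> the representatives form a basis of
  \<open>H\<close>.\<close>

lemma card_basis_modulo:
  assumes R: "basis_modulo U H R" and UH: "fin_dim U" "subspace H" "U \<subseteq> H"
  shows "card R + dim U = dim H"
proof -
  obtain K where K: "finite K" "independent K" "span K = U" "card K = dim U"
    using fin_dim_basis[OF UH(1)] .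
  have fR: "finite R" "R \<subseteq> H" using R by (auto simp: basis_modulo_def)
  have indep: "\<forall>r\<in>R. c r = 0" if "(\<Sum>r\<in>R. scale (c r) r) \<in> U" for c
    using R that unfolding basis_modulo_def by blast
  have disj: "K \<inter> R = {}"
  proof (rule ccontr)
    assume "K \<inter> R \<noteq> {}"
    then obtain r where r: "r \<in> K" "r \<in> R" by blast
    have "(\<Sum>v\<in>R. scale (if v = r then 1 else 0) v) = r"
      using fR(1) r(2) by (simp add: if_distrib[of "\<lambda>t. scale t _"] cong: if_cong)
    then have "(\<Sum>v\<in>R. scale (if v = r then 1 else 0) v) \<in> U" using r(1) K(3) span_base by force
    from indep[OF this] r(2) show False by auto
  qed
  have "independent (K \<union> R)"
  proof (rule independent_if_scalars_zero)
    show "finite (K \<union> R)" using K(1) fR(1) by simp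
    fix g v assume 0: "(\<Sum>v\<in>K \<union> R. scale (g v) v) = 0" and v: "v \<in> K \<union> R"
    have split: "(\<Sum>v\<in>K. scale (g v) v) + (\<Sum>v\<in>R. scale (g v) v) = 0"
      using 0 sum.union_disjoint[OF K(1) fR(1) disj, of "\<lambda>v. scale (g v) v"] by simp
    then have "(\<Sum>v\<in>R. scale (g v) v) = - (\<Sum>v\<in>K. scale (g v) v)"
      by (simp add: eq_neg_iff_add_eq_0 add.commute)
    also have "\<dots> \<in> U" unfolding K(3)[symmetric] by (intro span_neg span_sum span_scale span_base)
    finally have gR: "\<forall>r\<in>R. g r = 0" by (rule indep)
    then have "(\<Sum>v\<in>K. scale (g v) v) = 0" using split by simp
    then show "g v = 0" using independentD[OF K(2,1) subset_refl] gR v by blast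
  qed
  moreover have "span (K \<union> R) = H"
  proof
    show "span (K \<union> R) \<subseteq> H"
      using fR(2) UH K(3) span_superset[of K] by (intro span_minimal) auto
    show "H \<subseteq> span (K \<union> R)"
    proof
      fix v assume "v \<in> H"
      then obtain c where "v - (\<Sum>r\<in>R. scale (c r) r) \<in> U" using R unfolding basis_modulo_def by blast
      then have "(v - (\<Sum>r\<in>R. scale (c r) r)) + (\<Sum>r\<in>R. scale (c r) r) \<in> span (K \<union> R)"
        unfolding K(3)[symmetric]
        by (intro span_add span_sum span_scale) (auto intro: span_mono[THEN subsetD] span_base)
      then show "v \<in> span (K \<union> R)" by simp
    qed
  qed
  ultimately have "dim H = card (K \<union> R)" using dim_span_eq_card_independent by metis
  then show ?thesis using card_Un_disjoint[OF K(1) fR(1) disj] K(4) by simp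
qed

text \<open>A basis of \<open>U\<close> is extended to one of \<open>H\<close>; the added vectors
  are the representatives.\<close>

lemma basis_modulo_exists:
  assumes UH: "fin_dim H" "subspace U" "U \<subseteq> H"
  obtains R where "basis_modulo U H R"
proof -
  obtain K where K: "finite K" "independent K" "span K = U" "card K = dim U"
    using fin_dim_basis[OF fin_dim_subset[OF UH]] .
  have "K \<subseteq> H" using K(3) span_superset[of K] UH(3) by blast
  then obtain C where C: "K \<subseteq> C" "C \<subseteq> H" "independent C" "H \<subseteq> span C"
    using maximal_independent_subset_extend[OF _ K(2)] by blast
  obtain T where "finite T" "H \<subseteq> span T" using UH(1) by (auto simp: fin_dim_def)
  then have fC: "finite C" using independent_span_bound[OF _ C(3)] C(2) by blast
  have split: "(\<Sum>v\<in>C. scale (g v) v) = (\<Sum>v\<in>K. scale (g v) v) + (\<Sum>v\<in>C - K. scale (g v) v)" for g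
    using sum.subset_diff[OF C(1) fC, of "\<lambda>v. scale (g v) v"] by (simp add: add.commute)
  have "basis_modulo U H (C - K)"
    unfolding basis_modulo_def
  proof (intro conjI ballI allI impI)
    show "finite (C - K)" "C - K \<subseteq> H" using fC C(2) by auto
    fix v assume "v \<in> H"
    then have "v \<in> span C" using C(4) by blast
    then obtain g where "v = (\<Sum>w\<in>C. scale (g w) w)" using span_finite[OF fC] by auto
    then have "v - (\<Sum>r\<in>C - K. scale (g r) r) = (\<Sum>w\<in>K. scale (g w) w)" using split[of g] by simp
    also have "\<dots> \<in> U" unfolding K(3)[symmetric] by (intro span_sum span_scale span_base)
    finally show "\<exists>c. v - (\<Sum>r\<in>C - K. scale (c r) r) \<in> U" by blast
  next
    fix c r assume "(\<Sum>r\<in>C - K. scale (c r) r) \<in> U" and r: "r \<in> C - K"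
    then have "(\<Sum>r\<in>C - K. scale (c r) r) \<in> span K" using K(3) by simp
    then obtain g where g: "(\<Sum>r\<in>C - K. scale (c r) r) = (\<Sum>w\<in>K. scale (g w) w)" using span_finite[OF K(1)] by auto
    have "(\<Sum>v\<in>C. scale (if v \<in> K then - g v else c v) v) = 0"
      unfolding split[of "\<lambda>v. if v \<in> K then - g v else c v"] using g by (simp add: sum_negf)
    then have "(if r \<in> K then - g r else c r) = 0"
      using independentD[OF C(3) fC subset_refl, of "\<lambda>v. if v \<in> K then - g v else c v" r] r by blast
    then show "c r = 0" using r by simp
  qed
  then show ?thesis by (rule that)
qed

end

section \<open>Dimensions of the graded pieces of free modules\<close>

definition cscale :: "complex \<Rightarrow> (nat \<Rightarrow> mpoly3) \<Rightarrow> nat \<Rightarrow> mpoly3" where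
  "cscale c v = (\<lambda>i. mconst c * v i)"

lemma mconst_simps: "mconst 0 = 0" "mconst 1 = 1" "mconst (a + b) = mconst a + mconst b"
  "mconst (a * b) = mconst a * mconst b"
  by (auto simp: mconst_def Poly_Mapping.single_add Poly_Mapping.mult_single)

global_interpretation V: vector_space_fin_dim cscale
  by unfold_locales (auto simp: cscale_def mconst_simps fun_eq_iff plus_fun_def algebra_simps)

definition graded_part :: "int list \<Rightarrow> int \<Rightarrow> (nat \<Rightarrow> mpoly3) set" where
  "graded_part es r = {v. (\<forall>i\<ge>length es. v i = 0) \<and> (\<forall>i<length es. v i \<in> homog (es ! i + r))}"

lemma homog_scale: "p \<in> homog r \<Longrightarrow> mconst c * p \<in> homog r"
  using homog_mult[OF homog_mconst, of p r c] by simp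

lemma subspace_graded_part: "V.subspace (graded_part es r)"
  by (auto simp: V.subspace_def graded_part_def cscale_def homog_zero homog_add homog_scale)

text \<open>The first two exponents determine the third, so the exponent vectors correspond to the
  points of a triangle.\<close>

lemma card_tdeg: "finite {t. tdeg t = k}" "card {t. tdeg t = k} = (k + 2) choose 2"
proof -
  define T where "T = (SIGMA a:{..k}. {..k - a})"
  define f where "f t = (Poly_Mapping.lookup t 1, Poly_Mapping.lookup t 2)" for t :: "3 \<Rightarrow>\<^sub>0 nat"
  define g where "g = (\<lambda>(a, b). Poly_Mapping.single (1::3) a + Poly_Mapping.single 2 b + Poly_Mapping.single 3 (k - a - b))"
  have ne: "(1 :: 3) \<noteq> 2" "(1 :: 3) \<noteq> 3" "(2 :: 3) \<noteq> 3" "(2 :: 3) \<noteq> 1" "(3 :: 3) \<noteq> 1" "(3 :: 3) \<noteq> 2" by simp_all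
  have lg: "Poly_Mapping.lookup (g (a, b)) 1 = a" "Poly_Mapping.lookup (g (a, b)) 2 = b"
    "Poly_Mapping.lookup (g (a, b)) 3 = k - a - b" for a b
    unfolding g_def using ne by (simp_all only: prod.case Poly_Mapping.lookup_add Poly_Mapping.lookup_single when_def if_False if_True add_0_left add_0_right simp_thms)
  have bij: "bij_betw f {t. tdeg t = k} T"
  proof (rule bij_betw_byWitness[where f' = g])
    show "\<forall>t\<in>{t. tdeg t = k}. g (f t) = t"
    proof
      fix t assume "t \<in> {t. tdeg t = k}"
      then have k: "Poly_Mapping.lookup t 1 + Poly_Mapping.lookup t 2 + Poly_Mapping.lookup t 3 = k" by (simp add: tdeg_eq)
      have "Poly_Mapping.lookup (g (f t)) i = Poly_Mapping.lookup t i" for i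
      proof -
        have "i \<in> {1, 2, 3}" using UNIV_3 by blast
        then consider "i = 1" | "i = 2" | "i = 3" by blast
        then show ?thesis by cases (use k in \<open>auto simp: f_def lg\<close>)
      qed
      then show "g (f t) = t" by (intro poly_mapping_eqI) auto
    qed
    show "\<forall>p\<in>T. f (g p) = p" by (auto simp: f_def lg)
    show "f ` {t. tdeg t = k} \<subseteq> T" by (auto simp: f_def T_def tdeg_eq)
    show "g ` T \<subseteq> {t. tdeg t = k}" by (auto simp: T_def tdeg_eq lg)
  qed
  have "finite T" by (simp add: T_def)
  then show "finite {t. tdeg t = k}" using bij_betw_finite[OF bij] by simp
  have "card T = (\<Sum>a\<le>k. Suc (k - a))" by (simp add: T_def)
  also have "\<dots> = (\<Sum>a\<le>k. Suc a)"
    by (rule sum.reindex_bij_witness[of _ "\<lambda>a. k - a" "\<lambda>a. k - a"]) auto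
  also have "\<dots> = (k + 2) choose 2"
    by (induction k) (simp_all add: numeral_2_eq_2)
  finally show "card {t. tdeg t = k} = (k + 2) choose 2" using bij_betw_same_card[OF bij] by simp
qed

definition hdim :: "int \<Rightarrow> nat" where
  "hdim r = (if r < 0 then 0 else (nat r + 2) choose 2)"

lemma card_tdeg_int: "finite {t. int (tdeg t) = r}" "card {t. int (tdeg t) = r} = hdim r"
proof -
  have "{t. int (tdeg t) = r} = (if r < 0 then {} else {t. tdeg t = nat r})" by auto
  then show "finite {t. int (tdeg t) = r}" "card {t. int (tdeg t) = r} = hdim r"
    using card_tdeg[of "nat r"] by (auto simp: hdim_def)
qed

lemma sum_fun_apply: "(\<Sum>b\<in>B. f b) i = (\<Sum>b\<in>B. f b i)"
  for f :: "'b \<Rightarrow> 'c \<Rightarrow> 'd::comm_monoid_add"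
  by (induction B rule: infinite_finite_induct) auto

lemma lookup_mconst_mult: "Poly_Mapping.lookup (mconst c * p) t = c * Poly_Mapping.lookup p t"
proof -
  have "Poly_Mapping.lookup (p * Poly_Mapping.single 0 c) (t + 0) = Poly_Mapping.lookup p t * c"
    by (rule lookup_mult_single)
  then show ?thesis by (simp add: mconst_def mult.commute)
qed

text \<open>The monomials of degree \<open>e + k\<close>, placed in coordinate 0, form a
  basis.\<close>

lemma dim_graded_part_single: "V.fin_dim (graded_part [e] k)" "V.dim (graded_part [e] k) = hdim (e + k)"
proof -
  define T where "T = {t. int (tdeg t) = e + k}"
  define emb :: "(3 \<Rightarrow>\<^sub>0 nat) \<Rightarrow> nat \<Rightarrow> mpoly3" where
    "emb t = (\<lambda>i. if i = 0 then Poly_Mapping.single t 1 else 0)" for t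
  have fT: "finite T" "card T = hdim (e + k)" using card_tdeg_int by (auto simp: T_def)
  have inj: "inj emb"
  proof (rule injI)
    fix t t' assume "emb t = emb t'"
    then have "emb t 0 = emb t' 0" by simp
    then have "Poly_Mapping.keys (Poly_Mapping.single t (1::complex)) = Poly_Mapping.keys (Poly_Mapping.single t' (1::complex))"
      by (simp add: emb_def)
    then show "t = t'" by simp
  qed
  have ev: "Poly_Mapping.lookup ((\<Sum>t\<in>T. cscale (g t) (emb t)) 0) t = (if t \<in> T then g t else 0)" for g t
    using fT(1) by (simp add: sum_fun_apply cscale_def emb_def Poly_Mapping.lookup_sum lookup_mconst_mult
        Poly_Mapping.lookup_single when_def if_distrib[of "\<lambda>t. _ * t"] cong: if_cong)
  have ind: "V.independent (emb ` T)"
  proof (rule V.independent_if_scalars_zero)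
    fix g v assume 0: "(\<Sum>v\<in>emb ` T. cscale (g v) v) = 0" and v: "v \<in> emb ` T"
    have "(\<Sum>t\<in>T. cscale (g (emb t)) (emb t)) = 0"
      using 0 inj by (subst (asm) sum.reindex) (auto simp: inj_def inj_on_def)
    then have *: "(if t \<in> T then g (emb t) else 0) = 0" for t using ev[of "\<lambda>t. g (emb t)" t] by simp
    obtain t where "t \<in> T" "v = emb t" using v by blast
    then show "g v = 0" using *[of t] by simp
  qed (use fT in simp)
  have span: "V.span (emb ` T) = graded_part [e] k"
  proof
    show "V.span (emb ` T) \<subseteq> graded_part [e] k"
      by (rule V.span_minimal[OF _ subspace_graded_part]) (auto simp: emb_def graded_part_def T_def homog_def)
    show "graded_part [e] k \<subseteq> V.span (emb ` T)"
    proof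
      fix v assume v: "v \<in> graded_part [e] k"
      have "v i = (\<Sum>t\<in>T. cscale (Poly_Mapping.lookup (v 0) t) (emb t)) i" for i
      proof (cases "i = 0")
        case True
        have "Poly_Mapping.lookup (v 0) t = (if t \<in> T then Poly_Mapping.lookup (v 0) t else 0)" for t
          using v by (auto simp: graded_part_def T_def homog_def in_keys_iff)
        then show ?thesis unfolding True by (intro poly_mapping_eqI) (simp only: ev)
      next
        case False
        then show ?thesis using v by (simp add: graded_part_def sum_fun_apply cscale_def emb_def)
      qed
      then have "v = (\<Sum>t\<in>T. cscale (Poly_Mapping.lookup (v 0) t) (emb t))" by blast
      also have "\<dots> \<in> V.span (emb ` T)" by (intro V.span_sum V.span_scale V.span_base) auto
      finally show "v \<in> V.span (emb ` T)" .
    qed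
  qed
  show "V.fin_dim (graded_part [e] k)" using V.fin_dim_span[of "emb ` T"] fT span by simp
  have "card (emb ` T) = card T" using inj by (intro card_image) (auto simp: inj_def inj_on_def)
  then show "V.dim (graded_part [e] k) = hdim (e + k)"
    using V.dim_span_eq_card_independent[OF ind] span fT(2) by simp
qed

lemma dim_graded_part:
  "V.fin_dim (graded_part es k) \<and> V.dim (graded_part es k) = (\<Sum>e\<leftarrow>es. hdim (e + k))"
proof (induction es rule: rev_induct)
  case Nil
  have "graded_part [] k = V.span {}" by (auto simp: graded_part_def fun_eq_iff)
  then show ?case using V.dim_span_eq_card_independent[OF V.independent_empty] V.fin_dim_span[of "{}"] by simp
next
  case (snoc e es)
  \<comment> \<open>Projection onto the last summand, moved to index 0 so that the image is a graded
    piece of a module of rank one. The kernel is the piece for the shorter list.\<close>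
  define L :: "(nat \<Rightarrow> mpoly3) \<Rightarrow> nat \<Rightarrow> mpoly3" where "L v = (\<lambda>i. if i = 0 then v (length es) else 0)" for v
  have lin: "L (u + v) = L u + L v" "L (cscale c v) = cscale c (L v)" for u v c
    by (auto simp: L_def cscale_def)
  have ker: "{v \<in> graded_part (es @ [e]) k. L v = 0} = graded_part es k"
  proof (intro equalityI subsetI)
    fix v assume v: "v \<in> {v \<in> graded_part (es @ [e]) k. L v = 0}"
    then have "L v 0 = 0" by simp
    then have "v (length es) = 0" by (simp add: L_def)
    then have "v i = 0" if "i \<ge> length es" for i
      using v that by (cases "i = length es") (auto simp: graded_part_def)
    moreover have "v i \<in> homog (es ! i + k)" if "i < length es" for i
    proof -
      have "\<forall>i<length (es @ [e]). v i \<in> homog ((es @ [e]) ! i + k)" using v unfolding graded_part_def by blast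
      then show ?thesis using that by (auto simp: nth_append dest!: spec[of _ i])
    qed
    ultimately show "v \<in> graded_part es k" by (simp add: graded_part_def)
  next
    fix v assume "v \<in> graded_part es k"
    then show "v \<in> {v \<in> graded_part (es @ [e]) k. L v = 0}"
      by (auto simp: graded_part_def L_def nth_append homog_zero fun_eq_iff)
  qed
  have im: "L ` graded_part (es @ [e]) k = graded_part [e] k"
  proof (intro equalityI subsetI)
    fix v assume "v \<in> L ` graded_part (es @ [e]) k"
    then show "v \<in> graded_part [e] k" by (auto simp: graded_part_def L_def nth_append)
  next
    fix v assume v: "v \<in> graded_part [e] k"
    then have "L (\<lambda>i. if i = length es then v 0 else 0) = v"
      by (auto simp: L_def graded_part_def fun_eq_iff)
    moreover have "(\<lambda>i. if i = length es then v 0 else 0) \<in> graded_part (es @ [e]) k"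
      using v by (auto simp: graded_part_def nth_append homog_zero)
    ultimately show "v \<in> L ` graded_part (es @ [e]) k" by (metis image_eqI)
  qed
  note rn = V.rank_nullity[of L, OF lin subspace_graded_part, of "es @ [e]" k, unfolded ker im]
  show ?case using rn snoc dim_graded_part_single[of e k] by simp
qed

definition hcomp :: "int \<Rightarrow> mpoly3 \<Rightarrow> mpoly3" where
  "hcomp r p = (\<Sum>t\<in>{t \<in> Poly_Mapping.keys p. int (tdeg t) = r}. Poly_Mapping.single t (Poly_Mapping.lookup p t))"

lemma lookup_hcomp: "Poly_Mapping.lookup (hcomp r p) t = (if int (tdeg t) = r then Poly_Mapping.lookup p t else 0)"
  by (auto simp: hcomp_def Poly_Mapping.lookup_sum Poly_Mapping.lookup_single when_def in_keys_iff)

lemma hcomp_mem: "hcomp r p \<in> homog r"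
  by (auto simp: homog_def in_keys_iff lookup_hcomp split: if_splits)

lemma hcomp_add: "hcomp r (p + q) = hcomp r p + hcomp r q"
  by (rule poly_mapping_eqI) (simp add: lookup_hcomp Poly_Mapping.lookup_add)

lemma hcomp_sum: "hcomp r (sum f I) = (\<Sum>i\<in>I. hcomp r (f i))"
  by (rule poly_mapping_eqI) (simp add: lookup_hcomp Poly_Mapping.lookup_sum)

lemma hcomp_homog: "p \<in> homog r' \<Longrightarrow> hcomp r p = (if r = r' then p else 0)"
  by (rule poly_mapping_eqI) (auto simp: lookup_hcomp homog_def in_keys_iff)

lemma hcomp_mult: assumes q: "q \<in> homog s" shows "hcomp r (p * q) = hcomp (r - s) p * q"
proof (induction p rule: poly_mapping_single_induct)
  case (single t c)
  have t: "Poly_Mapping.single t c \<in> homog (int (tdeg t))" by (auto simp: homog_def)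
  show ?case using hcomp_homog[OF homog_mult[OF t q], of r] hcomp_homog[OF t, of "r - s"] by auto
qed (simp add: distrib_right hcomp_add)

section \<open>Resolutions given by homogeneous matrices\<close>

definition matmap :: "nat \<Rightarrow> (nat \<Rightarrow> nat \<Rightarrow> mpoly3) \<Rightarrow> (nat \<Rightarrow> mpoly3) \<Rightarrow> nat \<Rightarrow> mpoly3" where
  "matmap N c v = (\<lambda>i. \<Sum>j<N. v j * c j i)"

lemma matmap_add: "matmap N c (u + v) = matmap N c u + matmap N c v"
  by (simp add: matmap_def fun_eq_iff sum.distrib distrib_right)

lemma matmap_add': "matmap N c (\<lambda>i. u i + v i) i = matmap N c u i + matmap N c v i"
  by (simp add: matmap_def sum.distrib distrib_right)

lemma matmap_smult: "matmap N c (\<lambda>i. a * v i) i = a * matmap N c v i"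
  by (simp add: matmap_def sum_distrib_left mult.assoc)

lemma matmap_cscale: "matmap N c (cscale a v) = cscale a (matmap N c v)"
  by (simp add: cscale_def matmap_smult fun_eq_iff)

lemma matmap_truncate: "matmap N c (\<lambda>i. if i < N then v i else 0) = matmap N c v"
  by (simp add: matmap_def fun_eq_iff)

text \<open>The degrees of the entries are those that make the map preserve degrees between the
  twisted free modules.\<close>

locale homogeneous_matrix =
  fixes es es' :: "int list" and c :: "nat \<Rightarrow> nat \<Rightarrow> mpoly3"
  assumes entry: "\<And>j i. j < length es \<Longrightarrow> i < length es' \<Longrightarrow> c j i \<in> homog (es' ! i - es ! j)"
    and entry_zero: "\<And>j i. j < length es \<Longrightarrow> i \<ge> length es' \<Longrightarrow> c j i = 0"
begin

abbreviation "f \<equiv> matmap (length es) c"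

lemma supported: "i \<ge> length es' \<Longrightarrow> f v i = 0"
  by (simp add: matmap_def entry_zero)

lemma graded: assumes "v \<in> graded_part es r" shows "f v \<in> graded_part es' r"
proof -
  have "v j * c j i \<in> homog (es' ! i + r)" if "j < length es" "i < length es'" for i j
  proof -
    have "v j \<in> homog (es ! j + r)" using assms that by (simp add: graded_part_def)
    from homog_mult[OF this entry[OF that]] show ?thesis by (simp add: algebra_simps)
  qed
  then show ?thesis by (auto simp: graded_part_def supported) (auto simp: matmap_def intro: homog_sum)
qed

lemma graded_hom: "f \<in> graded_hom (free_graded es) (free_graded es')"
proof -
  have g: "grade (free_graded l) r = graded_part l r" for l r by (simp add: free_graded_def graded_part_def)
  show ?thesis
    unfolding graded_hom_def mem_Collect_eq g using graded
    by (auto simp: free_graded_def supported matmap_add' matmap_smult fun_eq_iff)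
qed

text \<open>Taking the appropriate homogeneous component of each coordinate turns any preimage of a
  homogeneous vector into a homogeneous one. So exactness without gradings implies exactness in each
  degree.\<close>

lemma graded_preimage:
  assumes v: "f w \<in> graded_part es' r"
  obtains w' where "w' \<in> graded_part es r" "f w' = f w"
proof -
  define w' where "w' j = (if j < length es then hcomp (es ! j + r) (w j) else 0)" for j
  have "f w' i = f w i" for i
  proof (cases "i < length es'")
    case True
    have "f w i = hcomp (es' ! i + r) (f w i)"
      using v True hcomp_homog[of "f w i" "es' ! i + r"] by (simp add: graded_part_def)
    also have "\<dots> = (\<Sum>j<length es. hcomp (es' ! i + r) (w j * c j i))"
      by (simp add: matmap_def hcomp_sum)
    also have "\<dots> = (\<Sum>j<length es. w' j * c j i)"
    proof (rule sum.cong)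
      fix j assume "j \<in> {..<length es}"
      then have j: "j < length es" by simp
      have e: "es' ! i + r - (es' ! i - es ! j) = es ! j + r" by simp
      show "hcomp (es' ! i + r) (w j * c j i) = w' j * c j i"
        unfolding hcomp_mult[OF entry[OF j True]] e using j by (simp add: w'_def)
    qed simp
    finally show ?thesis by (simp add: matmap_def)
  qed (simp add: supported)
  moreover have "w' \<in> graded_part es r" by (simp add: graded_part_def w'_def hcomp_mem)
  ultimately show ?thesis using that by blast
qed

end

lemma S_ring_simps [simp]: "carrier S_ring = UNIV" "add S_ring = (+)" "monoid.mult S_ring = (*)"
  "zero S_ring = 0" "one S_ring = 1"
  by (simp_all add: S_ring_def ring_of_type_algebra_def)

text \<open>Exactness is required only for the ungraded maps. Preimages may have any support, since
  \<open>matmap\<close> reads only the coordinates below its size.\<close>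

locale matrix_resolution =
  m3: homogeneous_matrix e3 e2 c3 + m2: homogeneous_matrix e2 e1 c2 + m1: homogeneous_matrix e1 "[0]" c1
  for e3 e2 e1 :: "int list" and c3 c2 c1 :: "nat \<Rightarrow> nat \<Rightarrow> mpoly3" +
  fixes F :: mpoly3
  assumes inj3: "\<And>v j. m3.f v = (\<lambda>_. 0) \<Longrightarrow> j < length e3 \<Longrightarrow> v j = 0"
    and complex2: "\<And>v. m2.f (m3.f v) = (\<lambda>_. 0)" and complex1: "\<And>v. m1.f (m2.f v) = (\<lambda>_. 0)"
    and exact2: "\<And>w. m2.f w = (\<lambda>_. 0) \<Longrightarrow> (\<And>i. i \<ge> length e2 \<Longrightarrow> w i = 0) \<Longrightarrow> \<exists>v. m3.f v = w"
    and exact1: "\<And>w. m1.f w = (\<lambda>_. 0) \<Longrightarrow> (\<And>i. i \<ge> length e1 \<Longrightarrow> w i = 0) \<Longrightarrow> \<exists>v. m2.f v = w"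
    and jacobian: "jacobian_ideal F = range (\<lambda>v. m1.f v 0)"
begin

abbreviation "J \<equiv> jacobian_ideal F"
abbreviation "M \<equiv> milnor_algebra F"

section \<open>The Milnor algebra as a module of cosets\<close>

sublocale S: cring S_ring
  unfolding S_ring_def by (rule cring_from_type_algebra)

sublocale J: ideal J S_ring
  unfolding jacobian_ideal_def by (rule S.genideal_ideal) simp

definition coset :: "mpoly3 \<Rightarrow> mpoly3 set" where "coset p = J +>\<^bsub>S_ring\<^esub> p"

lemma coset_add: "coset p \<oplus>\<^bsub>M\<^esub> coset q = coset (p + q)"
  using J.a_rcos_sum[of p q] by (simp add: milnor_algebra_def Let_def coset_def FactRing_def)

lemma coset_smult: "a \<odot>\<^bsub>M\<^esub> coset p = coset (a * p)"
  using J.rcoset_mult_add[of a p] by (simp add: milnor_algebra_def Let_def coset_def FactRing_def)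

lemma M_zero: "\<zero>\<^bsub>M\<^esub> = J"
  by (simp add: milnor_algebra_def Let_def FactRing_def)

lemma M_carrier: "carrier M = range coset"
  by (auto simp: milnor_algebra_def Let_def coset_def FactRing_def A_RCOSETS_def')

lemma M_grade: "grade M r = coset ` homog r"
  by (auto simp: milnor_algebra_def Let_def coset_def)

lemma J_add: "p \<in> J \<Longrightarrow> q \<in> J \<Longrightarrow> p + q \<in> J"
  using J.a_closed by simp

lemma J_mult: "p \<in> J \<Longrightarrow> a * p \<in> J"
  using J.I_l_closed[of p a] by simp

lemma J_zero: "0 \<in> J"
  using J.zero_closed by simp

lemma coset_eq_J: "coset p = J \<longleftrightarrow> p \<in> J"
proof
  assume "coset p = J"
  moreover have "p \<in> coset p" unfolding coset_def a_r_coset_def' using J_zero by auto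
  ultimately show "p \<in> J" by simp
next
  assume "p \<in> J"
  then show "coset p = J" unfolding coset_def using J.a_rcos_const by simp
qed

lemma coset_0: "coset 0 = J"
  using coset_eq_J J_zero by blast

text \<open>This gives access to the finite sums of cosets that occur in
  \<open>clincomb\<close>.\<close>

lemma M_abelian_monoid: "abelian_monoid M"
  by (rule abelian_monoidI)
    (auto simp: M_carrier coset_add M_zero coset_0[symmetric] ac_simps)

lemma finsum_coset: "finite B \<Longrightarrow> (\<Oplus>\<^bsub>M\<^esub>b\<in>B. coset (g b)) = coset (sum g B)"
proof (induction B rule: finite_induct)
  case empty
  then show ?case using abelian_monoid.finsum_empty[OF M_abelian_monoid] coset_eq_J[of 0] J_zero M_zero by simp
next
  case (insert b B)
  then show ?case
    using abelian_monoid.finsum_insert[OF M_abelian_monoid, of B b "\<lambda>b. coset (g b)"]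
    by (simp add: M_carrier coset_add)
qed

lemma free_grade: "grade (free_graded l) r = graded_part l r"
  by (simp add: free_graded_def graded_part_def)

theorem resolution: "has_graded_free_resolution M e3 e2 e1 [0]"
proof -
  define \<epsilon> where "\<epsilon> v = coset (v (0::nat))" for v
  have eps: "\<epsilon> \<in> graded_hom (free_graded [0]) M"
    unfolding graded_hom_def mem_Collect_eq free_grade
    by (auto simp: \<epsilon>_def M_carrier free_graded_def coset_add coset_smult M_grade graded_part_def)
  have kernel: "a_kernel N N' h = {v \<in> carrier N. h v = \<zero>\<^bsub>N'\<^esub>}"
    for N :: "(mpoly3, 'b) graded_module" and N' :: "(mpoly3, 'c) graded_module" and h
    by (rule a_kernel_def')
  have car: "carrier (free_graded l) = {v. \<forall>i\<ge>length l. v i = 0}" and zero: "\<zero>\<^bsub>free_graded l\<^esub> = (\<lambda>_. 0)" for l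
    by (simp_all add: free_graded_def)
  \<comment> \<open>Cutting a vector off at the length of the list puts it into the carrier without
    changing its image.\<close>
  have trunc: "\<exists>v'\<in>carrier (free_graded l). matmap (length l) c v' = matmap (length l) c v" for l c v
    using matmap_truncate[of "length l" c v] by (intro bexI[of _ "\<lambda>i. if i < length l then v i else 0"]) (auto simp: car)
  have inj: "inj_on m3.f (carrier (free_graded e3))"
  proof (rule inj_onI)
    fix v w assume v: "v \<in> carrier (free_graded e3)" and w: "w \<in> carrier (free_graded e3)" and eq: "m3.f v = m3.f w"
    have "m3.f (\<lambda>i. v i + (- 1) * w i) = (\<lambda>_. 0)"
      unfolding fun_eq_iff matmap_add' matmap_smult by (simp add: eq)
    from inj3[OF this] have eq: "v j = w j" if "j < length e3" for j using that by simp
    have "v j = w j" for j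
    proof (cases "j < length e3")
      case False
      then show ?thesis using v w by (simp add: car)
    qed (rule eq)
    then show "v = w" by blast
  qed
  have ex2: "m3.f ` carrier (free_graded e3) = a_kernel (free_graded e2) (free_graded e1) m2.f"
    unfolding kernel zero
  proof (intro equalityI subsetI)
    fix w assume "w \<in> m3.f ` carrier (free_graded e3)"
    then show "w \<in> {v \<in> carrier (free_graded e2). m2.f v = (\<lambda>_. 0)}"
      using complex2 m3.supported by (auto simp: car)
  next
    fix w assume "w \<in> {v \<in> carrier (free_graded e2). m2.f v = (\<lambda>_. 0)}"
    then obtain v where "m3.f v = w" using exact2 by (auto simp: car)
    then show "w \<in> m3.f ` carrier (free_graded e3)" using trunc[of e3 c3 v] by (metis image_eqI)
  qed
  have ex1: "m2.f ` carrier (free_graded e2) = a_kernel (free_graded e1) (free_graded [0]) m1.f"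
    unfolding kernel zero
  proof (intro equalityI subsetI)
    fix w assume "w \<in> m2.f ` carrier (free_graded e2)"
    then show "w \<in> {v \<in> carrier (free_graded e1). m1.f v = (\<lambda>_. 0)}"
      using complex1 m2.supported by (auto simp: car)
  next
    fix w assume "w \<in> {v \<in> carrier (free_graded e1). m1.f v = (\<lambda>_. 0)}"
    then obtain v where "m2.f v = w" using exact1 by (auto simp: car)
    then show "w \<in> m2.f ` carrier (free_graded e2)" using trunc[of e2 c2 v] by (metis image_eqI)
  qed
  have ex0: "m1.f ` carrier (free_graded e1) = a_kernel (free_graded [0]) M \<epsilon>"
    unfolding kernel M_zero \<epsilon>_def coset_eq_J
  proof (intro equalityI subsetI)
    fix w assume "w \<in> m1.f ` carrier (free_graded e1)"
    then show "w \<in> {v \<in> carrier (free_graded [0]). v 0 \<in> J}"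
      using jacobian m1.supported by (auto simp: car)
  next
    fix w assume w: "w \<in> {v \<in> carrier (free_graded [0]). v 0 \<in> J}"
    then obtain v where v: "m1.f v 0 = w 0" unfolding jacobian by auto
    have "m1.f v i = w i" for i using w v m1.supported[of i v] by (cases i) (auto simp: car)
    then have "m1.f v = w" by blast
    then show "w \<in> m1.f ` carrier (free_graded e1)" using trunc[of e1 c1 v] by (metis image_eqI)
  qed
  have surj: "\<epsilon> ` carrier (free_graded [0]) = carrier M"
    unfolding M_carrier
  proof (intro equalityI subsetI)
    fix C assume "C \<in> range coset"
    then obtain p where "C = coset p" by blast
    then have "C = \<epsilon> (\<lambda>i. if i = 0 then p else 0)" by (simp add: \<epsilon>_def)
    moreover have "(\<lambda>i. if i = 0 then p else 0) \<in> carrier (free_graded [0])" by (simp add: car)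
    ultimately show "C \<in> \<epsilon> ` carrier (free_graded [0])" by blast
  qed (auto simp: \<epsilon>_def)
  show ?thesis
    unfolding has_graded_free_resolution_def Let_def
    using m3.graded_hom m2.graded_hom m1.graded_hom eps inj ex2 ex1 ex0 surj by blast
qed

text \<open>Rank-nullity for the three maps in degree \<open>r\<close>, where exactness identifies
  each kernel with the image of the preceding map. The image of \<open>m1.f\<close> is the degree
  \<open>r\<close> part of the ideal.\<close>

lemma dim_jacobian:
  "int (V.dim (m1.f ` graded_part e1 r)) =
     (\<Sum>e\<leftarrow>e1. int (hdim (e + r))) - (\<Sum>e\<leftarrow>e2. int (hdim (e + r))) + (\<Sum>e\<leftarrow>e3. int (hdim (e + r)))"
proof -
  have fd: "V.fin_dim (graded_part es r)" for es using dim_graded_part by blast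
  have rn: "V.dim (graded_part es r) = V.dim {v \<in> graded_part es r. matmap N c v = 0} + V.dim (matmap N c ` graded_part es r)"
    for es N c by (rule V.rank_nullity_fin_dim[OF matmap_add matmap_cscale fd])
  have z: "(0 :: nat \<Rightarrow> mpoly3) = (\<lambda>_. 0)" by (simp add: fun_eq_iff)
  have k3: "{v \<in> graded_part e3 r. m3.f v = 0} = graded_part [] r"
  proof (intro equalityI subsetI)
    fix v assume v: "v \<in> {v \<in> graded_part e3 r. m3.f v = 0}"
    then have "v j = 0" for j using inj3[of v j] by (cases "j < length e3") (auto simp: z graded_part_def)
    then show "v \<in> graded_part [] r" by (simp add: graded_part_def)
  qed (auto simp: graded_part_def homog_zero matmap_def fun_eq_iff)
  have k2: "{v \<in> graded_part e2 r. m2.f v = 0} = m3.f ` graded_part e3 r"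
  proof (intro equalityI subsetI)
    fix w assume w: "w \<in> {v \<in> graded_part e2 r. m2.f v = 0}"
    then obtain v where "m3.f v = w" using exact2[of w] by (auto simp: z graded_part_def)
    then show "w \<in> m3.f ` graded_part e3 r" using m3.graded_preimage[of v r] w by (metis (no_types, lifting) image_eqI mem_Collect_eq)
  qed (use complex2 m3.graded in \<open>auto simp: z\<close>)
  have k1: "{v \<in> graded_part e1 r. m1.f v = 0} = m2.f ` graded_part e2 r"
  proof (intro equalityI subsetI)
    fix w assume w: "w \<in> {v \<in> graded_part e1 r. m1.f v = 0}"
    then obtain v where "m2.f v = w" using exact1[of w] by (auto simp: z graded_part_def)
    then show "w \<in> m2.f ` graded_part e2 r" using m2.graded_preimage[of v r] w by (metis (no_types, lifting) image_eqI mem_Collect_eq)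
  qed (use complex1 m2.graded in \<open>auto simp: z\<close>)
  have d: "int (V.dim (graded_part es r)) = (\<Sum>e\<leftarrow>es. int (hdim (e + r)))" for es
    using dim_graded_part[of es r] by (induction es) (auto simp: dim_graded_part)
  show ?thesis
    using rn[of e3 "length e3" c3, unfolded k3] rn[of e2 "length e2" c2, unfolded k2] rn[of e1 "length e1" c1, unfolded k1]
      d[of e1] d[of e2] d[of e3] d[of "[]"] by simp
qed

text \<open>The graded piece is \<open>H\<close> modulo \<open>U\<close>. As \<open>cdim\<close> is
  a definite description, a basis must exist and all bases must have the same size; both follow by
  passing from cosets to representatives.\<close>

lemma cdim_milnor:
  "cdim M (grade M r) + V.dim (m1.f ` graded_part e1 r) = hdim r"
proof -
  define U where "U = m1.f ` graded_part e1 r"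
  define H where "H = graded_part [0] r"
  have U: "U = {v \<in> H. v 0 \<in> J}"
  proof (intro equalityI subsetI)
    fix w assume "w \<in> U" then show "w \<in> {v \<in> H. v 0 \<in> J}"
      using m1.graded jacobian by (auto simp: U_def H_def)
  next
    fix w assume w: "w \<in> {v \<in> H. v 0 \<in> J}"
    then obtain v where v: "m1.f v 0 = w 0" unfolding jacobian by auto
    have "w i = 0" if "i \<ge> 1" for i using w that by (simp add: H_def graded_part_def)
    then have "m1.f v i = w i" for i using v m1.supported[of i v] by (cases "i = 0") auto
    then have "m1.f v = w" by blast
    then show "w \<in> U" using m1.graded_preimage[of v r] w unfolding U_def H_def by (metis (no_types, lifting) image_eqI mem_Collect_eq)
  qed
  have fH: "V.fin_dim H" "V.dim H = hdim r" using dim_graded_part[of "[0]" r] by (auto simp: H_def)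
  have sH: "V.subspace H" unfolding H_def by (rule subspace_graded_part)
  have fU: "V.fin_dim U" unfolding U_def
    by (rule V.fin_dim_image[OF matmap_add matmap_cscale]) (simp add: dim_graded_part)
  have sU: "V.subspace U" using fU by (simp add: V.fin_dim_def)
  have UH: "U \<subseteq> H" using U by blast
  define q where "q v = coset (v (0::nat))" for v :: "nat \<Rightarrow> mpoly3"
  have grade: "grade M r = q ` H"
  proof (intro equalityI subsetI)
    fix C assume "C \<in> grade M r"
    then obtain p where p: "p \<in> homog r" "C = coset p" by (auto simp: M_grade)
    then have "(\<lambda>i. if i = 0 then p else 0) \<in> H" "C = q (\<lambda>i. if i = 0 then p else 0)"
      by (auto simp: H_def graded_part_def q_def)
    then show "C \<in> q ` H" by blast
  qed (auto simp: q_def H_def graded_part_def M_grade)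
  have q_diff: "q v = q w \<longleftrightarrow> v - w \<in> U" if "v \<in> H" "w \<in> H" for v w
  proof -
    have "q v = q w \<longleftrightarrow> v 0 - w 0 \<in> J"
    proof
      assume "q v = q w"
      then have "coset (v 0 + - w 0) = coset (w 0 + - w 0)" unfolding q_def by (metis coset_add)
      then show "v 0 - w 0 \<in> J" using coset_0 coset_eq_J by simp
    next
      assume "v 0 - w 0 \<in> J"
      then have "coset (v 0 - w 0) = coset 0" using coset_eq_J J_zero by metis
      then have "coset (v 0 - w 0 + w 0) = coset (0 + w 0)" by (metis coset_add)
      then show "q v = q w" by (simp add: q_def)
    qed
    moreover have "v - w \<in> H" using sH that by (rule V.subspace_diff)
    ultimately show ?thesis by (simp add: U)
  qed
  \<comment> \<open>A combination of cosets is the coset of the combination of representatives,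
    provided distinct representatives have distinct cosets.\<close>
  have comb: "clincomb M c (q ` R) = q (\<Sum>w\<in>R. cscale (c (q w)) w)" if "finite R" "inj_on q R" for R c
  proof -
    define rep where "rep b = inv_into R q b" for b
    have rep: "rep (q w) = w" if "w \<in> R" for w using that \<open>inj_on q R\<close> by (simp add: rep_def)
    have "clincomb M c (q ` R) = (\<Oplus>\<^bsub>M\<^esub>b\<in>q ` R. coset (mconst (c b) * rep b 0))"
      unfolding clincomb_def
    proof (rule abelian_monoid.finsum_cong'[OF M_abelian_monoid])
      fix b assume "b \<in> q ` R"
      then obtain w where w: "w \<in> R" "b = q w" by blast
      have "mconst (c b) \<odot>\<^bsub>M\<^esub> coset (rep b 0) = coset (mconst (c b) * rep b 0)" by (rule coset_smult)
      then show "mconst (c b) \<odot>\<^bsub>M\<^esub> b = coset (mconst (c b) * rep b 0)" using w rep q_def by simp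
    qed (auto simp: M_carrier)
    also have "\<dots> = coset (\<Sum>b\<in>q ` R. mconst (c b) * rep b 0)" using that(1) by (simp add: finsum_coset)
    also have "(\<Sum>b\<in>q ` R. mconst (c b) * rep b 0) = (\<Sum>w\<in>R. mconst (c (q w)) * w 0)"
      using that(2) rep by (simp add: sum.reindex)
    also have "\<dots> = (\<Sum>w\<in>R. cscale (c (q w)) w) 0" by (simp add: sum_fun_apply cscale_def)
    finally show ?thesis by (simp add: q_def)
  qed
  have sumH: "(\<Sum>w\<in>R. cscale (c w) w) \<in> H" if "R \<subseteq> H" for R c
    using that sH by (intro V.subspace_sum V.subspace_scale) auto
  have q0: "q w = \<zero>\<^bsub>M\<^esub> \<longleftrightarrow> w \<in> U" if "w \<in> H" for w
    using that by (simp add: q_def M_zero coset_eq_J U)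
  have key: "cbasis M (grade M r) (q ` R) \<longleftrightarrow> V.basis_modulo U H R"
    if R: "finite R" "R \<subseteq> H" "inj_on q R" for R
  proof -
    have 1: "(\<forall>v\<in>q ` H. \<exists>c. v = clincomb M c (q ` R)) \<longleftrightarrow> (\<forall>v\<in>H. \<exists>c. v - (\<Sum>w\<in>R. cscale (c w) w) \<in> U)"
    proof -
      have "(\<exists>c. q v = clincomb M c (q ` R)) \<longleftrightarrow> (\<exists>c. v - (\<Sum>w\<in>R. cscale (c w) w) \<in> U)" if v: "v \<in> H" for v
      proof
        assume "\<exists>c. q v = clincomb M c (q ` R)"
        then obtain c where "q v = q (\<Sum>w\<in>R. cscale (c (q w)) w)" using comb[OF R(1,3)] by auto
        then show "\<exists>c. v - (\<Sum>w\<in>R. cscale (c w) w) \<in> U" using q_diff[OF v sumH[OF R(2)]] by (intro exI[of _ "\<lambda>w. c (q w)"]) simp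
      next
        assume "\<exists>c. v - (\<Sum>w\<in>R. cscale (c w) w) \<in> U"
        then obtain c where "v - (\<Sum>w\<in>R. cscale (c w) w) \<in> U" by blast
        then have "q v = q (\<Sum>w\<in>R. cscale (c w) w)" using q_diff[OF v sumH[OF R(2)]] by simp
        also have "(\<Sum>w\<in>R. cscale (c w) w) = (\<Sum>w\<in>R. cscale (c (inv_into R q (q w))) w)"
          using R(3) by (intro sum.cong) auto
        also have "q \<dots> = clincomb M (\<lambda>b. c (inv_into R q b)) (q ` R)" using comb[OF R(1,3)] by simp
        finally show "\<exists>c. q v = clincomb M c (q ` R)" by blast
      qed
      then show ?thesis by auto
    qed
    have 2: "(\<forall>c. clincomb M c (q ` R) = \<zero>\<^bsub>M\<^esub> \<longrightarrow> (\<forall>b\<in>q ` R. c b = 0)) \<longleftrightarrow> (\<forall>c. (\<Sum>w\<in>R. cscale (c w) w) \<in> U \<longrightarrow> (\<forall>w\<in>R. c w = 0))"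
    proof (intro iffI allI impI ballI)
      fix c w assume *: "\<forall>c. clincomb M c (q ` R) = \<zero>\<^bsub>M\<^esub> \<longrightarrow> (\<forall>b\<in>q ` R. c b = 0)" and U: "(\<Sum>w\<in>R. cscale (c w) w) \<in> U" and w: "w \<in> R"
      have "(\<Sum>w\<in>R. cscale (c w) w) = (\<Sum>w\<in>R. cscale (c (inv_into R q (q w))) w)"
        using R(3) by (intro sum.cong) auto
      then have "clincomb M (\<lambda>b. c (inv_into R q b)) (q ` R) = \<zero>\<^bsub>M\<^esub>"
        using comb[OF R(1,3)] q0[OF sumH[OF R(2)]] U by simp
      then have "c (inv_into R q (q w)) = 0" using * w by blast
      then show "c w = 0" using R(3) w by simp
    next
      fix c b assume *: "\<forall>c. (\<Sum>w\<in>R. cscale (c w) w) \<in> U \<longrightarrow> (\<forall>w\<in>R. c w = 0)" and 0: "clincomb M c (q ` R) = \<zero>\<^bsub>M\<^esub>" and b: "b \<in> q ` R"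
      then have "(\<Sum>w\<in>R. cscale (c (q w)) w) \<in> U" using comb[OF R(1,3)] q0[OF sumH[OF R(2)]] by simp
      moreover obtain w where "w \<in> R" "b = q w" using b by blast
      ultimately show "c b = 0" using *[rule_format, of "\<lambda>w. c (q w)" w] by simp
    qed
    show ?thesis unfolding cbasis_def V.basis_modulo_def grade using 1 2 R by auto
  qed
  have card: "card B + V.dim U = hdim r" if B: "cbasis M (grade M r) B" for B
  proof -
    define rep where "rep b = (SOME v. v \<in> H \<and> q v = b)" for b
    have rep: "rep b \<in> H" "q (rep b) = b" if "b \<in> B" for b
      using someI_ex[of "\<lambda>v. v \<in> H \<and> q v = b"] B that unfolding rep_def cbasis_def grade by auto
    define R where "R = rep ` B"
    have R: "finite R" "R \<subseteq> H" "inj_on q R" "q ` R = B"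
      using rep B by (auto simp: R_def cbasis_def inj_on_def image_image)
    then have "V.basis_modulo U H R" using key[OF R(1-3)] B by simp
    then have "card R + V.dim U = V.dim H" using V.card_basis_modulo fU sH UH by blast
    moreover have "card R = card B" using card_image[OF R(3)] R(4) by simp
    ultimately show ?thesis using fH by simp
  qed
  obtain R where R: "V.basis_modulo U H R" using V.basis_modulo_exists[OF fH(1) sU UH] .
  then have fR: "finite R" "R \<subseteq> H" by (auto simp: V.basis_modulo_def)
  \<comment> \<open>Two representatives with the same coset would make \<open>v - w\<close> a
    nontrivial relation modulo \<open>U\<close>.\<close>
  have "inj_on q R"
  proof (rule inj_onI, rule ccontr)
    fix v w assume vw: "v \<in> R" "w \<in> R" "q v = q w" "v \<noteq> w"
    define c where "c u = (if u = v then 1 else if u = w then - 1 else 0 :: complex)" for u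
    have "(\<Sum>u\<in>R. cscale (c u) u) = (\<Sum>u\<in>{v, w}. cscale (c u) u)"
      using fR(1) vw by (intro sum.mono_neutral_right) (auto simp: c_def)
    also have "\<dots> = v - w" using vw(4) by (simp add: c_def V.scale_minus_left)
    finally have "(\<Sum>u\<in>R. cscale (c u) u) \<in> U" using q_diff[of v w] vw fR(2) by auto
    then have "c v = 0" using R vw(1) unfolding V.basis_modulo_def by blast
    then show False by (simp add: c_def)
  qed
  then have B: "cbasis M (grade M r) (q ` R)" using key[OF fR] R by simp
  have "cdim M (grade M r) = card (q ` R)"
    unfolding cdim_def
  proof (rule the_equality)
    show "\<exists>B. cbasis M (grade M r) B \<and> card B = card (q ` R)" using B by blast
    show "k = card (q ` R)" if "\<exists>B. cbasis M (grade M r) B \<and> card B = k" for k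
      using that card[OF B] card by force
  qed
  then show ?thesis using card[OF B] by (simp add: U_def)
qed

lemma cdim_formula:
  "int (cdim M (grade M r)) = int (hdim r) - (\<Sum>e\<leftarrow>e1. int (hdim (e + r)))
     + (\<Sum>e\<leftarrow>e2. int (hdim (e + r))) - (\<Sum>e\<leftarrow>e3. int (hdim (e + r)))"
  using cdim_milnor[of r] dim_jacobian[of r] by linarith

end

section \<open>The Milnor algebra of the Chebyshev form\<close>

lemma homog_mult_eq: "p \<in> homog r \<Longrightarrow> q \<in> homog r' \<Longrightarrow> r + r' = k \<Longrightarrow> p * q \<in> homog k"
  using homog_mult by blast

lemma chebyshev_syzygies_mpoly:
  assumes "d > 0"
  shows "chebyshev_syzygies (free_of {2, 1}) (free_of {1}) (2 * mvar 1) (2 * mvar 2) (mvar 3) d"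
proof -
  have ne: "(1 :: 3) \<noteq> 2" "(1 :: 3) \<noteq> 3" "(2 :: 3) \<noteq> 3" by simp_all
  have 1: "adjunction (free_of {1}) UNIV (2 * mvar 1)"
    using adjunction_free_of[of 1 "{}"] by (simp add: free_of_empty)
  have 2: "adjunction (free_of {2, 1}) (free_of {1}) (2 * mvar 2)"
    using ne by (intro adjunction_free_of) simp
  have z: "mvar 3 \<in> free_of {2, 1}" using ne by (intro mvar_mem_free_of) auto
  have nz: "mvar 3 \<noteq> (0 :: mpoly3)"
  proof
    assume "mvar 3 = 0"
    then have "Poly_Mapping.keys (mvar 3) = {}" by simp
    then show False by (simp add: mvar_def)
  qed
  have "mconst (1 / 2) \<in> free_of {1}" by (auto simp: mconst_def free_of_def)
  moreover have "2 * mconst (1 / 2) = 1"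
    by (simp only: mult_2 mconst_simps(3)[symmetric]) (simp add: mconst_simps)
  ultimately have h: "\<exists>h\<in>free_of {1}. 2 * h = 1" by blast
  show ?thesis
    by (intro chebyshev_syzygies.intro chebyshev_syzygies_axioms.intro 1 2 z nz h assms)
qed

locale chebyshev_milnor =
  fixes d :: nat
  assumes d_pos': "d > 0"

sublocale chebyshev_milnor \<subseteq> chebyshev_syzygies "free_of {2, 1}" "free_of {1}" "2 * mvar 1" "2 * mvar 2" "mvar 3" d
  by (rule chebyshev_syzygies_mpoly[OF d_pos'])

context chebyshev_milnor begin

abbreviation "c1 \<equiv> (\<lambda>j i. if i = (0::nat) then (if j = (0::nat) then s d else if j = 1 then u d else mvar 3 * W) else 0)"
abbreviation "c3 \<equiv> (\<lambda>a. \<rho> (Suc a))"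
abbreviation "E1 \<equiv> replicate 3 (1 - int d)"
text \<open>Both parities share this form: the second multiplicity \<open>m + 2 - n\<close> is 3 for
  even \<open>d\<close> and 2 for odd \<open>d\<close>.\<close>

abbreviation "E2 \<equiv> replicate n (3 - 2 * int d) @ replicate (m + 2 - n) (2 - 2 * int d)"
abbreviation "E3 \<equiv> replicate m (1 - 2 * int d)"

section \<open>Degrees and supports of the matrix entries\<close>

lemma homog_vars: "mvar 3 * mvar 3 \<in> homog 2" "2 * mvar i \<in> homog 1"
  by (auto intro!: homog_mult_eq[OF homog_mvar homog_mvar] homog_mult_eq[OF homog_numeral homog_mvar])

lemma homog_s: "s k \<in> homog (int k - 1)" and homog_u: "u k \<in> homog (int k - 1)"
  by (auto intro!: homog_cseq homog_vars)

lemma homog_W: "W \<in> homog (int d - 2)"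
proof -
  have "int (d - 1) - 1 = int d - 2" using d_pos by simp
  then show ?thesis unfolding W_def using homog_add[OF homog_s[of "d - 1"] homog_u[of "d - 1"]] by simp
qed

lemma homog_gl: assumes "0 < a" "a < d" shows "gl a i \<in> homog (int d - 2)"
proof -
  have k: "int (a - Suc 0) = int a - 1" "int (d - a) = int d - int a" "int (d - Suc a) = int d - int a - 1"
    using assms by auto
  have "- mvar 3 * (s (a - 1) * u (d - a) - s (d - a - 1) * u a) \<in> homog (int d - 2)"
    by (rule homog_mult_eq[OF homog_uminus[OF homog_mvar]
        homog_diff[OF homog_mult_eq[OF homog_s homog_u, of _ _ "int d - 3"] homog_mult_eq[OF homog_s homog_u]]])
      (simp_all add: k)
  moreover have "- mvar 3 * (s a * u (d - a - 1) - s (d - a) * u (a - 1)) \<in> homog (int d - 2)"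
    by (rule homog_mult_eq[OF homog_uminus[OF homog_mvar]
        homog_diff[OF homog_mult_eq[OF homog_s homog_u, of _ _ "int d - 3"] homog_mult_eq[OF homog_s homog_u]]])
      (simp_all add: k)
  moreover have "s a * u (d - a) - s (d - a) * u a \<in> homog (int d - 2)"
    by (rule homog_diff[OF homog_mult_eq[OF homog_s homog_u] homog_mult_eq[OF homog_s homog_u]])
      (simp_all add: k)
  ultimately show ?thesis by (auto simp: gl_def homog_zero)
qed

lemma homog_zW: "mvar 3 * W \<in> homog (int d - 1)"
  by (rule homog_mult_eq[OF homog_mvar homog_W]) simp

lemma homog_col:
  "j < n \<Longrightarrow> col j i \<in> homog (int d - 2)" "n \<le> j \<Longrightarrow> col j i \<in> homog (int d - 1)"
proof -
  assume "j < n"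
  then show "col j i \<in> homog (int d - 2)" using homog_gl[of "Suc j" i] by (simp add: col_def n_def)
next
  assume j: "n \<le> j"
  have "hl 1 i \<in> homog (int d - 1)"
    unfolding hl_1 using homog_u[of d] homog_uminus[OF homog_zW] by (simp add: homog_zero)
  moreover have "Kl i \<in> homog (int d - 1)"
    using homog_u[of d] homog_uminus[OF homog_s[of d]] by (simp add: Kl_def homog_zero)
  moreover have "Ql i \<in> homog (int d - 1)"
    using homog_s[of d] homog_uminus[OF homog_zW] by (simp add: Ql_def homog_zero)
  ultimately show "col j i \<in> homog (int d - 1)" using j by (simp add: col_def)
qed

lemma homog_e: "e j i \<in> homog 0"
  by (simp add: e_def homog_zero homog_one)

lemma homog_g: "g a i \<in> homog 0" "n \<le> i \<Longrightarrow> g a i = 0"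
  by (auto simp: g_def homog_zero homog_one homog_uminus)

text \<open>The first \<open>n\<close> coordinates belong to generators of one degree less, so they
  are linear where the others are constant.\<close>

lemma homog_h: "i < n \<Longrightarrow> h a i \<in> homog 1" "n \<le> i \<Longrightarrow> h a i \<in> homog 0"
proof -
  have x: "2 * mvar k * g b i \<in> homog 1" for k b
    by (rule homog_mult_eq[OF homog_vars(2) homog_g(1)]) simp
  assume i: "i < n"
  have em: "e m i = 0" "even d \<Longrightarrow> e (m - 1) i = 0"
    using i n_le_m even_m(1) by (auto simp: e_def)
  have 0: "h 0 i \<in> homog 1"
    using em x by (auto simp: homog_zero intro!: homog_sum homog_diff)
  show "h a i \<in> homog 1"
  proof (induction a rule: nat_less_induct)
    case (1 a)
    consider "a = 0" | "a = Suc 0" | b where "a = Suc (Suc b)" by (metis not0_implies_Suc)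
    then show ?case
    proof cases
      case 1 then show ?thesis using 0 by (simp only:)
    next
      case 2 then show ?thesis using em by (simp add: homog_zero)
    next
      case 3
      then have "h b i \<in> homog 1" using 1 by simp
      then show ?thesis using x 3 by (auto intro!: homog_diff homog_add)
    qed
  qed
next
  assume "n \<le> i"
  then show "h a i \<in> homog 0"
    by (induction a i rule: h.induct) (auto simp: homog_g homog_e)
qed

lemma homog_\<rho>: "i < n \<Longrightarrow> \<rho> a i \<in> homog 2" "n \<le> i \<Longrightarrow> \<rho> a i \<in> homog 1"
proof -
  have \<kappa>: "\<kappa> a \<in> homog 1" using homog_vars(2)[of 3] by (auto simp: homog_zero homog_mvar)
  {
    assume i: "i < n"
    have "e (Suc m) i = 0" using i n_le_m by (auto simp: e_def)
    moreover have "2 * mvar k * h b i \<in> homog 2" for k b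
      by (rule homog_mult_eq[OF homog_vars(2) homog_h(1)[OF i]]) simp
    moreover have "mvar 3 * mvar 3 * g b i \<in> homog 2" for b
      by (rule homog_mult_eq[OF homog_vars(1) homog_g(1)]) simp
    ultimately show "\<rho> a i \<in> homog 2" unfolding \<rho>_def by (auto intro!: homog_diff homog_add simp del: h.simps)
  next
    assume i: "n \<le> i"
    have "2 * mvar k * h b i \<in> homog 1" for k b
      by (rule homog_mult_eq[OF homog_vars(2) homog_h(2)[OF i]]) simp
    moreover have "\<kappa> a * e (Suc m) i \<in> homog 1" by (rule homog_mult_eq[OF \<kappa> homog_e]) simp
    ultimately show "\<rho> a i \<in> homog 1" unfolding \<rho>_def using homog_g(2)[OF i] by (auto intro!: homog_diff simp del: h.simps)
  }
qed

lemma \<rho>_supported: assumes "m + 2 \<le> i" shows "\<rho> a i = 0"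
proof -
  have "g b i = 0" "e m i = 0" "e (m - 1) i = 0" "e (Suc m) i = 0" for b
    using assms n_le_m homog_g(2) by (auto simp: e_def)
  moreover from this have "h b i = 0" for b by (induction b rule: h.induct[where ?a1.0 = i, simplified]) auto
  ultimately show ?thesis by (simp add: \<rho>_def)
qed

lemma length_E: "length E1 = 3" "length E2 = m + 2" "length E3 = m"
  using n_le_m by auto

lemma matmaps: "matmap (length E3) c3 = \<phi>3" "matmap (length E2) col = \<phi>2"
  "matmap (length E1) c1 v i = (if i = 0 then \<phi>1 v else 0)"
  unfolding length_E by (auto simp: matmap_def \<phi>1_def \<phi>2_def \<phi>3_def fun_eq_iff numeral_3_eq_3 numeral_2_eq_2)

text \<open>The number \<open>d\<close> is invertible in \<open>\<complex>\<close>, so the common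
  factor and the sign of the partial derivatives can be removed.\<close>

lemma jacobian_ideal_eq: "jacobian_ideal (chebyshev_form d) = range \<phi>1"
proof -
  define D where "D = (of_nat d :: mpoly3)"
  define D' where "D' = mconst (1 / of_nat d)"
  have "D = mconst (of_nat d)" by (simp add: D_def mconst_def)
  then have DD: "D' * D = 1" using d_pos by (simp add: D'_def mconst_simps(4)[symmetric] mconst_simps(2))
  interpret S: cring S_ring unfolding S_ring_def by (rule cring_from_type_algebra)
  define G where "G = {partial_deriv 1 (chebyshev_form d), partial_deriv 2 (chebyshev_form d), partial_deriv 3 (chebyshev_form d)}"
  have p: "partial_deriv 1 (chebyshev_form d) = D * s d" "partial_deriv 2 (chebyshev_form d) = D * u d"
    "partial_deriv 3 (chebyshev_form d) = - D * (mvar 3 * W)"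
    unfolding partial_deriv_chebyshev_form D_def W_def by (rule refl)+
  interpret J: ideal "jacobian_ideal (chebyshev_form d)" S_ring
    unfolding jacobian_ideal_def by (rule S.genideal_ideal) simp
  have gen: "G \<subseteq> jacobian_ideal (chebyshev_form d)"
    unfolding jacobian_ideal_def G_def by (rule S.genideal_self) simp
  have J_add: "p + q \<in> jacobian_ideal (chebyshev_form d)"
    if "p \<in> jacobian_ideal (chebyshev_form d)" "q \<in> jacobian_ideal (chebyshev_form d)" for p q
    using J.a_closed[OF that] by simp
  have J_mult: "a * p \<in> jacobian_ideal (chebyshev_form d)" if "p \<in> jacobian_ideal (chebyshev_form d)" for a p
    using J.I_l_closed[OF that, of a] by simp
  show ?thesis
  proof (intro equalityI subsetI)
    fix w assume "w \<in> range \<phi>1"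
    then obtain v where w: "w = \<phi>1 v" by blast
    have "w = (D' * D) * \<phi>1 v" by (simp add: w DD)
    also have "\<dots> = (v 0 * D') * (D * s d) + (v 1 * D') * (D * u d) + (- v 2 * D') * (- D * (mvar 3 * W))"
      unfolding \<phi>1_def by (simp add: algebra_simps del: cseq.simps)
    also have "\<dots> \<in> jacobian_ideal (chebyshev_form d)"
      unfolding p[symmetric] using gen unfolding G_def by (intro J_add J_mult) auto
    finally show "w \<in> jacobian_ideal (chebyshev_form d)" .
  next
    have lin: "a * \<phi>1 v + b * \<phi>1 w = \<phi>1 (\<lambda>i. a * v i + b * w i)" for a b v w
      unfolding \<phi>1_def by (simp only: algebra_simps)
    have "ideal (range \<phi>1) S_ring"
    proof (rule idealI)
      show "ring S_ring" by (rule S.ring_axioms)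
      show "subgroup (range \<phi>1) (add_monoid S_ring)"
      proof (rule S.add.subgroupI)
        fix p q assume "p \<in> range \<phi>1" "q \<in> range \<phi>1"
        then obtain v w where pq: "p = \<phi>1 v" "q = \<phi>1 w" by blast
        have "\<ominus>\<^bsub>S_ring\<^esub> p = - p" by (rule S.minus_equality) simp_all
        then show "\<ominus>\<^bsub>S_ring\<^esub> p \<in> range \<phi>1" using lin[of "- 1" v 0 v] by (simp add: pq)
        show "p \<oplus>\<^bsub>S_ring\<^esub> q \<in> range \<phi>1" using lin[of 1 v 1 w] by (simp add: pq)
      qed auto
      fix a p assume "p \<in> range \<phi>1"
      then obtain v where pq: "p = \<phi>1 v" by blast
      show "a \<otimes>\<^bsub>S_ring\<^esub> p \<in> range \<phi>1" using lin[of a v 0 v] by (simp add: pq)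
      then show "p \<otimes>\<^bsub>S_ring\<^esub> a \<in> range \<phi>1" by (simp add: mult.commute)
    qed
    moreover have "G \<subseteq> range \<phi>1"
    proof -
      have "D * s d = \<phi>1 (\<lambda>i. if i = 0 then D else 0)" "D * u d = \<phi>1 (\<lambda>i. if i = 1 then D else 0)"
        "- D * (mvar 3 * W) = \<phi>1 (\<lambda>i. if i = 2 then - D else 0)"
        unfolding \<phi>1_def by simp_all
      then show ?thesis unfolding G_def p by blast
    qed
    ultimately have "jacobian_ideal (chebyshev_form d) \<subseteq> range \<phi>1"
      unfolding jacobian_ideal_def G_def by (rule S.genideal_minimal)
    then show "w \<in> range \<phi>1" if "w \<in> jacobian_ideal (chebyshev_form d)" for w using that by blast
  qed
qed

sublocale res: matrix_resolution E3 E2 E1 c3 col c1 "chebyshev_form d"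
proof
  show "c3 j i \<in> homog (E2 ! i - E3 ! j)" if "j < length E3" "i < length E2" for i j
    using that homog_\<rho>[where i = i and a = "Suc j"] unfolding length_E by (auto simp: nth_append)
  show "c3 j i = 0" if "j < length E3" "length E2 \<le> i" for i j
    using that \<rho>_supported unfolding length_E by simp
  show "col j i \<in> homog (E1 ! i - E2 ! j)" if "j < length E2" "i < length E1" for i j
    using that homog_col[where i = i and j = j] unfolding length_E by (auto simp: nth_append)
  show "col j i = 0" if "j < length E2" "length E1 \<le> i" for i j
    using that unfolding length_E by (auto simp: col_def gl_def hl_def Kl_def Ql_def)
  show "c1 j i \<in> homog ([0] ! i - E1 ! j)" if "j < length E1" "i < length [0::int]" for i j
    using that homog_s[of d] homog_u[of d] homog_zW unfolding length_E by (auto simp: nth_replicate)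
  show "c1 j i = 0" if "j < length E1" "length [0::int] \<le> i" for i j
    using that by simp
  show "v j = 0" if "matmap (length E3) c3 v = (\<lambda>_. 0)" "j < length E3" for v j
    using that \<phi>3_injective[of v j] unfolding matmaps unfolding length_E by (simp add: fun_eq_iff)
  show "matmap (length E2) col (matmap (length E3) c3 v) = (\<lambda>_. 0)" for v
    unfolding matmaps using \<phi>2_\<phi>3 by blast
  show "matmap (length E1) c1 (matmap (length E2) col v) = (\<lambda>_. 0)" for v
    unfolding fun_eq_iff matmaps using \<phi>1_\<phi>2 by simp
  show "\<exists>v. matmap (length E3) c3 v = w"
    if "matmap (length E2) col w = (\<lambda>_. 0)" "\<And>i. length E2 \<le> i \<Longrightarrow> w i = 0" for w
    using that exact_F2[of w] unfolding matmaps unfolding length_E by (simp add: fun_eq_iff)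
  show "\<exists>v. matmap (length E2) col v = w"
    if "matmap (length E1) c1 w = (\<lambda>_. 0)" "\<And>i. length E1 \<le> i \<Longrightarrow> w i = 0" for w
  proof -
    have "\<phi>1 w = 0" using that(1) matmaps(3)[of w 0] by (simp add: fun_eq_iff)
    then show ?thesis using exact_F1[of w] that(2) unfolding matmaps unfolding length_E by blast
  qed
  have "matmap (length E1) c1 v 0 = \<phi>1 v" for v unfolding matmaps by simp
  then show "jacobian_ideal (chebyshev_form d) = range (\<lambda>v. matmap (length E1) c1 v 0)"
    unfolding jacobian_ideal_eq by (simp del: length_replicate)
qed

end

section \<open>The Hilbert series\<close>

lemma fps_choose_two: "Abs_fps (\<lambda>k. of_nat ((k + 2) choose 2)) = inverse ((1 - fps_X) ^ 3 :: rat fps)"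
proof -
  define G where "G = Abs_fps (\<lambda>k. of_nat ((k + 2) choose 2) :: rat)"
  have pascal: "(Suc j + 2) choose 2 = (j + 2) + ((j + 2) choose 2)" for j
    using binomial_Suc_Suc[of "j + 2" 1] by (simp only: choose_one Suc_1 add_Suc)
  \<comment> \<open>By Pascal's rule the successive differences of the coefficients are
    \<open>n + 1\<close>, the coefficients of the inverse square of
    \<open>1 - fps_X\<close>.\<close>
  have "G * (1 - fps_X) = Abs_fps (\<lambda>n. of_nat (n + 1))"
  proof (rule fps_ext)
    fix k
    have nth: "fps_nth (G * (1 - fps_X)) k = fps_nth G k - (if k = 0 then 0 else fps_nth G (k - 1))"
      by (simp add: right_diff_distrib)
    show "fps_nth (G * (1 - fps_X)) k = fps_nth (Abs_fps (\<lambda>n. of_nat (n + 1))) k"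
    proof (cases k)
      case (Suc j)
      have "fps_nth G (Suc j) = of_nat ((j + 2) + ((j + 2) choose 2))"
        unfolding G_def fps_nth_Abs_fps pascal ..
      moreover have "fps_nth G j = of_nat ((j + 2) choose 2)"
        unfolding G_def fps_nth_Abs_fps ..
      ultimately show ?thesis using nth Suc by simp
    next
      case 0
      have "fps_nth G 0 = 1"
        unfolding G_def fps_nth_Abs_fps by (simp only: add_0 binomial_n_n of_nat_1)
      then show ?thesis using nth 0 by simp
    qed
  qed
  then have G: "G * (1 - fps_X) = inverse ((1 - fps_X) ^ 2)"
    by (simp only: fps_one_over_one_minus_fps_X_squared)
  have "(1 - fps_X) ^ 3 * G = (G * (1 - fps_X)) * (1 - fps_X) ^ 2"
    by (simp only: power2_eq_square power3_eq_cube ac_simps)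
  also have "\<dots> = 1"
    unfolding G by (rule inverse_mult_eq_1) simp
  finally have "inverse ((1 - fps_X) ^ 3 :: rat fps) = G" by (rule fps_inverse_unique)
  then show ?thesis by (simp add: G_def)
qed

text \<open>A twist shifts the series; \<open>hdim\<close> being zero in negative degrees supplies
  the missing initial coefficients.\<close>

lemma fps_hdim: "Abs_fps (\<lambda>k. of_nat (hdim (int k - int a))) = fps_X ^ a / (1 - fps_X :: rat fps) ^ 3"
proof -
  have "Abs_fps (\<lambda>k. of_nat (hdim (int k - int a))) = fps_X ^ a * Abs_fps (\<lambda>k. of_nat ((k + 2) choose 2) :: rat)"
    by (rule fps_ext) (auto simp: fps_X_power_mult_nth hdim_def nat_diff_distrib of_nat_diff)
  also have "\<dots> = fps_X ^ a * inverse ((1 - fps_X) ^ 3)" by (simp only: fps_choose_two)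
  finally show ?thesis by (subst fps_divide_unit) simp_all
qed

text \<open>The numerator is unique because the denominator is invertible as a power series.\<close>

lemma HP_numerator_eq:
  assumes "HP N = fps_of_poly p / (1 - fps_X) ^ 3"
  shows "HP_numerator N = p"
  unfolding HP_numerator_def
proof (rule the_equality)
  show "HP N = fps_of_poly p / (1 - fps_X) ^ 3" by (rule assms)
  fix q assume "HP N = fps_of_poly q / (1 - fps_X) ^ 3"
  then have "fps_of_poly q * inverse ((1 - fps_X) ^ 3) * (1 - fps_X) ^ 3 = fps_of_poly p * inverse ((1 - fps_X) ^ 3) * (1 - fps_X) ^ 3"
    using assms by (simp add: fps_divide_unit)
  moreover have "inverse ((1 - fps_X) ^ 3) * (1 - fps_X) ^ 3 = (1 :: rat fps)"
    by (rule inverse_mult_eq_1) simp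
  ultimately show "q = p" by (simp add: mult.assoc)
qed

context chebyshev_milnor begin

lemma HP_numerator_milnor:
  "HP_numerator (milnor_algebra (chebyshev_form d)) =
     1 - monom 3 (d - 1) + monom (of_nat n) (2 * d - 3) + monom (of_nat (m + 2 - n)) (2 * d - 2)
       - monom (of_nat m) (2 * d - 1)"
proof (rule HP_numerator_eq)
  let ?M = "milnor_algebra (chebyshev_form d)"
  define \<eta> where "\<eta> a = Abs_fps (\<lambda>k. of_nat (hdim (int k - int a)) :: rat)" for a
  have cd: "(of_nat (cdim ?M (grade ?M (int k))) :: rat)
    = fps_nth (\<eta> 0 - 3 * \<eta> (d - 1) + of_nat n * \<eta> (2 * d - 3) + of_nat (m + 2 - n) * \<eta> (2 * d - 2) - of_nat m * \<eta> (2 * d - 1)) k" for k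
  proof -
    have shift: "1 - int d + int k = int k - int (d - 1)" "2 - 2 * int d + int k = int k - int (2 * d - 2)"
      "1 - 2 * int d + int k = int k - int (2 * d - 1)" using d_pos by auto
    \<comment> \<open>For \<open>d = 1\<close> the natural number \<open>2 * d - 3\<close> is
      truncated, but then \<open>n = 0\<close> and both sides vanish.\<close>
    have shift': "int n * int (hdim (3 - 2 * int d + int k)) = int n * int (hdim (int k - int (2 * d - 3)))"
    proof (cases "n = 0")
      case False
      then have "3 - 2 * int d + int k = int k - int (2 * d - 3)" by (auto simp: n_def)
      then show ?thesis by (simp only:)
    qed (simp only: of_nat_0 mult_zero_left)
    have twist: "(\<Sum>e\<leftarrow>replicate l c. int (hdim (e + int k))) = int l * int (hdim (c + int k))" for l c
      by (induction l) (simp_all add: algebra_simps)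
    have "int (cdim ?M (grade ?M (int k))) = int (hdim (int k - int 0)) - int 3 * int (hdim (int k - int (d - 1)))
      + (int n * int (hdim (int k - int (2 * d - 3))) + int (m + 2 - n) * int (hdim (int k - int (2 * d - 2))))
      - int m * int (hdim (int k - int (2 * d - 1)))"
      unfolding res.cdim_formula map_append sum_list_append twist shift shift' by (simp only: of_nat_0 diff_zero)
    then have "(of_int (int (cdim ?M (grade ?M (int k)))) :: rat) = of_int (int (hdim (int k - int 0)) - int 3 * int (hdim (int k - int (d - 1)))
      + (int n * int (hdim (int k - int (2 * d - 3))) + int (m + 2 - n) * int (hdim (int k - int (2 * d - 2))))
      - int m * int (hdim (int k - int (2 * d - 1))))" by (rule arg_cong)
    then show ?thesis
      by (simp add: \<eta>_def fps_numeral_fps_const del: of_nat_diff flip: fps_of_nat)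
  qed
  have "HP ?M = \<eta> 0 - 3 * \<eta> (d - 1) + of_nat n * \<eta> (2 * d - 3) + of_nat (m + 2 - n) * \<eta> (2 * d - 2) - of_nat m * \<eta> (2 * d - 1)"
    by (rule fps_ext) (simp only: HP_def fps_nth_Abs_fps cd)
  also have "\<dots> = (fps_X ^ 0 - 3 * fps_X ^ (d - 1) + of_nat n * fps_X ^ (2 * d - 3) + of_nat (m + 2 - n) * fps_X ^ (2 * d - 2)
      - of_nat m * fps_X ^ (2 * d - 1)) * inverse ((1 - fps_X) ^ 3)"
    unfolding \<eta>_def fps_hdim by (simp add: fps_divide_unit algebra_simps)
  also have "\<dots> = fps_of_poly (1 - monom 3 (d - 1) + monom (of_nat n) (2 * d - 3) + monom (of_nat (m + 2 - n)) (2 * d - 2)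
       - monom (of_nat m) (2 * d - 1)) * inverse ((1 - fps_X) ^ 3)"
    by (simp add: fps_of_poly_diff fps_of_poly_add fps_of_poly_monom fps_of_nat fps_numeral_fps_const)
  finally show "HP ?M = fps_of_poly (1 - monom 3 (d - 1) + monom (of_nat n) (2 * d - 3) + monom (of_nat (m + 2 - n)) (2 * d - 2)
       - monom (of_nat m) (2 * d - 1)) / (1 - fps_X) ^ 3"
    by (simp add: fps_divide_unit)
qed

end

theorem theorem1p1:
  fixes d :: nat
  assumes "d > 0"
  shows "(\<forall>m::nat. d = 2 * m \<longrightarrow>
      has_graded_free_resolution (milnor_algebra (chebyshev_form d))
        (replicate m (- 4 * int m + 1))
        (replicate (m - 1) (- 4 * int m + 3) @ replicate 3 (- 4 * int m + 2))
        (replicate 3 (- 2 * int m + 1))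
        [0] \<and>
      HP_numerator (milnor_algebra (chebyshev_form d)) =
        1 - monom 3 (2 * m - 1) + monom (of_nat (m - 1)) (4 * m - 3)
          + monom 3 (4 * m - 2) - monom (of_nat m) (4 * m - 1)) \<and>
    (\<forall>m::nat. d = 2 * m + 1 \<longrightarrow>
      has_graded_free_resolution (milnor_algebra (chebyshev_form d))
        (replicate m (- 4 * int m - 1))
        (replicate m (- 4 * int m + 1) @ replicate 2 (- 4 * int m))
        (replicate 3 (- 2 * int m))
        [0] \<and>
      HP_numerator (milnor_algebra (chebyshev_form d)) =
        1 - monom 3 (2 * m) + monom (of_nat m) (4 * m - 1)
          + monom 2 (4 * m) - monom (of_nat m) (4 * m + 1))"
proof -
  interpret chebyshev_milnor d by (rule chebyshev_milnor.intro[OF assms])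
  note result = res.resolution HP_numerator_milnor
  show ?thesis
  proof (intro conjI allI impI)
    fix k assume d: "d = 2 * k"
    have nm: "n = k - 1" "m = k" unfolding n_def m_def using d by auto
    then have "m + 2 - n = 3" using d assms by simp
    have "1 - int d = - 2 * int k + 1" "3 - 2 * int d = - 4 * int k + 3" "2 - 2 * int d = - 4 * int k + 2" "1 - 2 * int d = - 4 * int k + 1"
      "d - 1 = 2 * k - 1" "2 * d - 3 = 4 * k - 3" "2 * d - 2 = 4 * k - 2" "2 * d - 1 = 4 * k - 1"
      using assms d by auto
    note eqs = nm \<open>m + 2 - n = _\<close> this
    show "has_graded_free_resolution (milnor_algebra (chebyshev_form d))
        (replicate k (- 4 * int k + 1))
        (replicate (k - 1) (- 4 * int k + 3) @ replicate 3 (- 4 * int k + 2))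
        (replicate 3 (- 2 * int k + 1)) [0]"
      using result(1) unfolding eqs(3-7) unfolding eqs(1,2) .
    show "HP_numerator (milnor_algebra (chebyshev_form d)) =
        1 - monom 3 (2 * k - 1) + monom (of_nat (k - 1)) (4 * k - 3)
          + monom 3 (4 * k - 2) - monom (of_nat k) (4 * k - 1)"
      unfolding result(2) eqs(3,8-11) unfolding eqs(1,2) by simp
  next
    fix k assume d: "d = 2 * k + 1"
    have nm: "n = k" "m = k" unfolding n_def m_def using d by auto
    then have "m + 2 - n = 2" by simp
    \<comment> \<open>For \<open>k = 0\<close> the differences \<open>2 * d - 3\<close> and
      \<open>4 * k - 1\<close> are both truncated to 0, so the equation between them still
      holds.\<close>
    have "1 - int d = - 2 * int k" "3 - 2 * int d = - 4 * int k + 1" "2 - 2 * int d = - 4 * int k" "1 - 2 * int d = - 4 * int k - 1"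
      "d - 1 = 2 * k" "2 * d - 3 = 4 * k - 1" "2 * d - 2 = 4 * k" "2 * d - 1 = 4 * k + 1"
      using assms d by auto
    note eqs = nm \<open>m + 2 - n = _\<close> this
    show "has_graded_free_resolution (milnor_algebra (chebyshev_form d))
        (replicate k (- 4 * int k - 1))
        (replicate k (- 4 * int k + 1) @ replicate 2 (- 4 * int k))
        (replicate 3 (- 2 * int k)) [0]"
      using result(1) unfolding eqs(3-7) unfolding eqs(1,2) .
    show "HP_numerator (milnor_algebra (chebyshev_form d)) =
        1 - monom 3 (2 * k) + monom (of_nat k) (4 * k - 1)
          + monom 2 (4 * k) - monom (of_nat k) (4 * k + 1)"
      unfolding result(2) eqs(3,8-11) unfolding eqs(1,2) by simp
  qed
qed

end
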